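(* Let $n\ge 1$ and let $\lambda=(\lambda_1,\dots,\lambda_n)$ be a partition with at most $n$ nonzero parts, i.e. integers $\lambda_1\ge\lambda_2\ge\dots\ge\lambda_n\ge 0$. Let $J_\lambda(x;\alpha)=J_\lambda(x_1,\dots,x_n;\alpha)$ be the Jack polynomial in $n$ variables, normalized so that the coefficient of $m_{1^N}$ in the Jack symmetric function $J_\lambda$ is $N!$, where $N=|\lambda|$. Let $B_1^+,\dots,B_n^+$ be the creation operators $$B_i^+=\sum_{J\subset\{1,\dots,n\},\ |J|=i} x_J D_J .$$ Then $$J_\lambda(x;\alpha)=(B_n^+)^{\lambda_n}(B_{n-1}^+)^{\lambda_{n-1}-\lambda_n}\cdots(B_1^+)^{\lambda_1-\lambda_2}\cdot 1,$$ where the operators are composed in the order written (the rightmost acts first) and applied to the constant polynomial $1$.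
   Context: Partitions. A partition is a sequence $\lambda=(\lambda_1,\lambda_2,\dots)$ of non-negative integers with $\lambda_1\ge\lambda_2\ge\cdots$ and finite sum $|\lambda|=\sum_i\lambda_i$; $\ell(\lambda)$ is the number of nonzero parts and $m_i(\lambda)$ is the number of parts equal to $i$. For partitions $\lambda,\mu$ of the same integer $N$, the dominance order is: $\lambda\ge\mu$ iff $\lambda_1+\dots+\lambda_i\ge\mu_1+\dots+\mu_i$ for all $i$. Put $z_\lambda=\prod_{i\ge1} i^{m_i(\lambda)}\,m_i(\lambda)!$. Jack polynomials. Let $\alpha$ be a parameter (indeterminate) and let $\Lambda$ be the ring of symmetric functions over $\mathbb{Q}(\alpha)$ in infinitely many variables $x_1,x_2,\dots$, with bases the power sums $p_\lambda=p_{\lambda_1}p_{\lambda_2}\cdots$, $p_i=\sum_k x_k^i$ (product over the nonzero parts), and the monomial symmetric functions $m_\lambda=\sum x_1^{\lambda_1}x_2^{\lambda_2}\cdots$ (sum over distinct permutations of the exponents). Define a scalar product on $\Lambda$ by $\langle p_\lambda,p_\mu\rangle=\delta_{\lambda\mu}z_\lambda\alpha^{\ell(\lambda)}$. The Jack symmetric functions $J_\lambda$ are the unique family in $\Lambda$, indexed by partitions, such that: (i) $\langle J_\lambda,J_\mu\rangle=0$ if $\lambda\neq\mu$; (ii) $J_\lambda=\sum_{\mu\le\lambda}v_{\lambda\mu}(\alpha)m_\mu$ with $v_{\lambda\mu}(\alpha)\in\mathbb{Q}(\alpha)$; (iii) if $|\lambda|=N$, then $v_{\lambda,1^N}=N!$,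 where $1^N=(1,\dots,1)$ ($N$ ones). (Existence and uniqueness of this family are known.) The Jack polynomial $J_\lambda(x_1,\dots,x_n;\alpha)$ in $n$ variables is the image of $J_\lambda$ under setting $x_{n+1}=x_{n+2}=\dots=0$. Operators. All operators act on polynomials in $x_1,\dots,x_n$ over $\mathbb{Q}(\alpha)$. $K_{ij}=K_{ji}$ is the operator exchanging the variables $x_i$ and $x_j$. The Dunkl operators are $$D_i=\alpha x_i\frac{\partial}{\partial x_i}+\sum_{j=1,\ j\ne i}^n\frac{x_i}{x_i-x_j}(1-K_{ij}),\qquad i=1,\dots,n.$$ For $J=\{j_1<j_2<\dots<j_\ell\}\subset\{1,\dots,n\}$, set $$D_J=(D_{j_1}+1)(D_{j_2}+2)\cdots(D_{j_\ell}+\ell)$$ (composition in the order written) and $x_J=\prod_{i\in J}x_i$, regarded as a multiplication operator. In the definition of $B_i^+$ the sum is over all subsets $J$ of $\{1,\dots,n\}$ of cardinality $i$. *)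

theory Defs
  imports
    Complex_Main
    "HOL-Library.Poly_Mapping"
    "HOL-Computational_Algebra.Polynomial"
    "HOL-Computational_Algebra.Fraction_Field"
    "HOL-Combinatorics.Transposition"
begin

text \<open>
  Indices of parts and of variables start at 0: the variables $x_1, x_2, \dots$ are those with
  index $0, 1, \dots$, and \<open>lookup \<lambda> i\<close> is the part $\lambda_{i+1}$.  Partitions and
  exponent vectors of monomials are both finitely supported maps from \<^typ>\<open>nat\<close>
  to \<^typ>\<open>nat\<close>.
\<close>

type_synonym exponent = "nat \<Rightarrow>\<^sub>0 nat"

definition is_partition :: "exponent \<Rightarrow> bool" where
  "is_partition l \<longleftrightarrow> (\<forall>i j. i \<le> j \<longrightarrow> Poly_Mapping.lookup l j \<le> Poly_Mapping.lookup l i)"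

definition psize :: "exponent \<Rightarrow> nat" where
  "psize l = (\<Sum>i\<in>Poly_Mapping.keys l. Poly_Mapping.lookup l i)"

definition plength :: "exponent \<Rightarrow> nat" where
  "plength l = card (Poly_Mapping.keys l)"

definition part_mult :: "exponent \<Rightarrow> nat \<Rightarrow> nat" where
  "part_mult l r = card {i. Poly_Mapping.lookup l i = r}"

text \<open>\<open>Poly_Mapping.range l\<close> is the set of nonzero values of \<open>l\<close>; all other $r \ge 1$
  would contribute a factor 1.\<close>

definition zee :: "exponent \<Rightarrow> nat" where
  "zee l = (\<Prod>r\<in>Poly_Mapping.range l. r ^ part_mult l r * fact (part_mult l r))"

definition dominated_by :: "exponent \<Rightarrow> exponent \<Rightarrow> bool" where
  "dominated_by m l \<longleftrightarrow> psize m = psize l \<and>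
     (\<forall>i. (\<Sum>k<i. Poly_Mapping.lookup m k) \<le> (\<Sum>k<i. Poly_Mapping.lookup l k))"

definition ones :: "nat \<Rightarrow> exponent" where
  "ones N = (\<Sum>i<N. Poly_Mapping.single i 1)"


type_synonym ratfun = "rat poly fract"

definition alpha :: ratfun where
  "alpha = Fract [:0, 1:] 1"


text \<open>
  Formal power series in countably many variables, given by their coefficient functions.
  Symmetric functions are the symmetric ones of bounded degree.
\<close>

type_synonym series = "exponent \<Rightarrow> ratfun"

definition series_one :: series where
  "series_one a = (if a = 0 then 1 else 0)"

definition series_mult :: "series \<Rightarrow> series \<Rightarrow> series" where
  "series_mult f g a = (\<Sum>(b, c) | b + c = a. f b * g c)"

definition power_sum :: "nat \<Rightarrow> series" where
  "power_sum r a = (if \<exists>k. a = Poly_Mapping.single k r then 1 else 0)"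

text \<open>The nonzero parts of a partition are those with index below its length.\<close>

definition p_sym :: "exponent \<Rightarrow> series" where
  "p_sym l = foldr (\<lambda>i. series_mult (power_sum (Poly_Mapping.lookup l i))) [0..<plength l] series_one"

definition m_sym :: "exponent \<Rightarrow> series" where
  "m_sym l a = (if \<exists>\<pi>. bij \<pi> \<and> a = Poly_Mapping.map_key \<pi> l then 1 else 0)"

text \<open>Well defined for symmetric \<open>f\<close> of bounded degree, as the power sums \<open>p_sym l\<close> of
  partitions \<open>l\<close> are a basis of the space of these.\<close>

definition p_coords :: "series \<Rightarrow> (exponent \<Rightarrow>\<^sub>0 ratfun)" where
  "p_coords f = (THE c. Poly_Mapping.keys c \<subseteq> Collect is_partition \<and>
     f = (\<lambda>a. \<Sum>l\<in>Poly_Mapping.keys c. Poly_Mapping.lookup c l * p_sym l a))"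

text \<open>The bilinear form with $\langle p_\lambda, p_\mu\rangle
  = \delta_{\lambda\mu} z_\lambda \alpha^{\ell(\lambda)}$.\<close>

definition jack_inner :: "series \<Rightarrow> series \<Rightarrow> ratfun" where
  "jack_inner f g = (\<Sum>l\<in>Poly_Mapping.keys (p_coords f).
     Poly_Mapping.lookup (p_coords f) l * Poly_Mapping.lookup (p_coords g) l *
     (of_nat (zee l) * alpha ^ plength l))"

text \<open>The defining properties of the family of Jack symmetric functions; the values of the
  family outside the partitions are irrelevant.\<close>

definition is_jack_family :: "(exponent \<Rightarrow> series) \<Rightarrow> bool" where
  "is_jack_family J \<longleftrightarrow>
     (\<forall>l m. is_partition l \<and> is_partition m \<and> l \<noteq> m \<longrightarrow> jack_inner (J l) (J m) = 0) \<and>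
     (\<exists>v. \<forall>l. is_partition l \<longrightarrow>
        J l = (\<lambda>a. \<Sum>m | is_partition m \<and> dominated_by m l. v l m * m_sym m a) \<and>
        v l (ones (psize l)) = fact (psize l))"


text \<open>Polynomials in countably many variables; the operators below depending on \<open>n\<close> are
  meant for polynomials in the variables with index below \<open>n\<close>.\<close>

type_synonym mpol = "exponent \<Rightarrow>\<^sub>0 ratfun"

text \<open>Setting all variables with index at least \<open>n\<close> to 0. For \<open>f\<close> of bounded degree the
  coefficient function below has finite support, so that it is the one of a polynomial.\<close>

definition restrict_vars :: "nat \<Rightarrow> series \<Rightarrow> mpol" where
  "restrict_vars n f =
     Poly_Mapping.Abs_poly_mapping (\<lambda>a. if Poly_Mapping.keys a \<subseteq> {..<n} then f a else 0)"

definition X :: "nat \<Rightarrow> mpol" where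
  "X i = Poly_Mapping.single (Poly_Mapping.single i 1) 1"

definition const :: "ratfun \<Rightarrow> mpol" where
  "const c = Poly_Mapping.single 0 c"

text \<open>In the partial derivative, the summands with \<open>lookup a i = 0\<close>, for which the subtraction
  truncates, vanish.\<close>

definition pdiff :: "nat \<Rightarrow> mpol \<Rightarrow> mpol" where
  "pdiff i f = (\<Sum>a\<in>Poly_Mapping.keys f.
     Poly_Mapping.single (a - Poly_Mapping.single i 1)
       (of_nat (Poly_Mapping.lookup a i) * Poly_Mapping.lookup f a))"

definition swap_vars :: "nat \<Rightarrow> nat \<Rightarrow> mpol \<Rightarrow> mpol" where
  "swap_vars i j f = (\<Sum>a\<in>Poly_Mapping.keys f.
     Poly_Mapping.single (Poly_Mapping.map_key (transpose i j) a) (Poly_Mapping.lookup f a))"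

text \<open>Well defined if \<open>g\<close> is nonzero and divides \<open>f\<close>, as polynomials form an integral
  domain; $x_i - x_j$ divides $(1 - K_{ij}) f$.\<close>

definition exact_quot :: "mpol \<Rightarrow> mpol \<Rightarrow> mpol" where
  "exact_quot f g = (THE q. g * q = f)"

definition dunkl :: "nat \<Rightarrow> nat \<Rightarrow> mpol \<Rightarrow> mpol" where
  "dunkl n i f = const alpha * X i * pdiff i f +
     (\<Sum>j\<in>{..<n} - {i}. exact_quot (X i * (f - swap_vars i j f)) (X i - X j))"

text \<open>\<open>dunkl_list n k [j, j', \<dots>]\<close> is the composition $(D_j + k)(D_{j'} + k + 1)\cdots$.\<close>

primrec dunkl_list :: "nat \<Rightarrow> nat \<Rightarrow> nat list \<Rightarrow> mpol \<Rightarrow> mpol" where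
  "dunkl_list n k [] f = f"
| "dunkl_list n k (j # js) f =
     dunkl n j (dunkl_list n (Suc k) js f) + of_nat k * dunkl_list n (Suc k) js f"

definition dunkl_set :: "nat \<Rightarrow> nat set \<Rightarrow> mpol \<Rightarrow> mpol" where
  "dunkl_set n J = dunkl_list n 1 (sorted_list_of_set J)"

definition creation :: "nat \<Rightarrow> nat \<Rightarrow> mpol \<Rightarrow> mpol" where
  "creation n i f = (\<Sum>J | J \<subseteq> {..<n} \<and> card J = i. (\<Prod>j\<in>J. X j) * dunkl_set n J f)"

text \<open>\<open>creation_prod n l k\<close> is
  $(B_k^+)^{\lambda_k - \lambda_{k+1}} \cdots (B_1^+)^{\lambda_1 - \lambda_2}$, the rightmost
  operator acting first. With \<open>k = n\<close> and $\lambda_{n+1} = 0$ the leftmost exponent is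
  $\lambda_n$.\<close>

primrec creation_prod :: "nat \<Rightarrow> exponent \<Rightarrow> nat \<Rightarrow> mpol \<Rightarrow> mpol" where
  "creation_prod n l 0 = id"
| "creation_prod n l (Suc k) =
     (creation n (Suc k) ^^ (Poly_Mapping.lookup l k - Poly_Mapping.lookup l (Suc k)))
       \<circ> creation_prod n l k"

end

theory Submission
  imports Defs "HOL-Combinatorics.Permutations" "HOL-Library.FuncSet"
begin

text \<open>
  The operators $\xi_i = D_i + \sum_{j<i} K_{ji}$ commute and satisfy the relations of the degenerate
  affine Hecke algebra with the permutations, so $Z = \sum_i \xi_i^2$ commutes with all permutations and
  all $D_i$. For symmetric \<open>f\<close> whose Jack expansion only involves partitions of length at most \<open>k\<close>,
  the polynomial $g_J = D_J f$ with $|J| = k$ is annihilated by $D_i$ for $i \notin J$. The raising operator of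
  Knop and Sahi intertwines the $\xi_i$ up to a shift by \<open>\<alpha>\<close> and maps $g_J$, for the set \<open>J\<close> of the last
  \<open>k\<close> indices, to $x_I D_I f$ for the set \<open>I\<close> of the first \<open>k\<close> indices. Hence $B_k^+$ maps eigenvectors
  of \<open>Z\<close> to eigenvectors of \<open>Z\<close>, and the product of creation operators is an eigenvector with eigenvalue
  $\sum_i (\alpha\lambda_i + n - i)^2$; this is strictly increasing in the dominance order.

  On symmetric polynomials, expressed in power sums, \<open>Z\<close> is self-adjoint. Since the creation operators
  are triangular with respect to dominance, well-founded induction on the dominance order shows that the
  product of creation operators is a multiple of $J_\lambda$. The factor is found from the coefficient of
  $x_1 \cdots x_N$: as $D_j g$ only has monomials divisible by $x_j$, applying $B_k^+$ to a polynomial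
  of degree \<open>N\<close> multiplies it by $(N+1)\cdots(N+k)$. If $n < N$, one passes to more variables,
  because setting the last variable to zero commutes with the creation operators on symmetric polynomials.
\<close>

text \<open>The crux is that D_i annihilates g_J; it is not visible from the Dunkl operators, which
  do not commute. On symmetric \<open>f\<close> the product D_t (D_{t+1} + 1)(D_{t+2} + 2) ... over
  all indices from t on equals the product of the xi_i - t with i >= t. Being symmetric in these
  xi_i, it commutes with exchanges of indices >= t, so each summand x_J D_J h of \<open>f\<close>
  can be moved until a single factor kills it. Those summands come from the preceding creation
  operator, so the property reproduces itself along the product.

  The sum of the xi_i is the degree operator up to constants, so the sum of squares is the first
  symmetric function of them that can distinguish partitions of equal size. It need not separate all
  of them: by triangularity only partitions below lambda have to be excluded. Strict monotonicity of
  eigenvalues and positive definiteness of the scalar product refer to the order on Q(alpha) given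
  by leading coefficients, in which alpha is positive.\<close>

abbreviation lookup where "lookup \<equiv> Poly_Mapping.lookup"
abbreviation keys where "keys \<equiv> Poly_Mapping.keys"
abbreviation single where "single \<equiv> Poly_Mapping.single"
abbreviation map_key where "map_key \<equiv> Poly_Mapping.map_key"

section \<open>Linear operators on polynomials\<close>

lemma const_add: "const (c + d) = const c + const d"
  by (simp add: const_def single_add)

lemma const_diff: "const (c - d) = const c - const d"
  by (simp add: const_def single_diff)

lemma const_uminus: "const (- c) = - const c"
  by (simp add: const_def single_uminus)

lemma const_mult: "const (c * d) = const c * const d"
  by (simp add: const_def mult_single)

lemma const_0 [simp]: "const 0 = 0"
  by (simp add: const_def)

lemma const_1 [simp]: "const 1 = 1"
  by (simp add: const_def)

lemma const_of_nat: "const (of_nat k) = of_nat k"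
  by (simp add: const_def)

lemma const_sum: "const (sum c A) = (\<Sum>i\<in>A. const (c i))"
  by (induction A rule: infinite_finite_induct) (simp_all add: const_add)

lemma single_conv_const: "single a c = const c * single a 1"
  by (simp add: const_def mult_single)

lemma lookup_const_mult [simp]: "lookup (const c * f) a = c * lookup f a"
  by (simp add: const_def mult_map_scale_conv_mult [symmetric] map.rep_eq when_def)

lemma poly_mapping_sum_singles:
  fixes f :: "'a \<Rightarrow>\<^sub>0 'b::comm_monoid_add"
  shows "f = (\<Sum>a\<in>keys f. single a (lookup f a))"
proof (rule poly_mapping_eqI)
  fix k
  have "lookup (\<Sum>a\<in>keys f. single a (lookup f a)) k = (\<Sum>a\<in>keys f. if a = k then lookup f a else 0)"
    by (simp add: lookup_sum lookup_single when_def)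
  also have "\<dots> = lookup f k"
    by (simp add: in_keys_iff)
  finally show "lookup f k = lookup (\<Sum>a\<in>keys f. single a (lookup f a)) k" by simp
qed

definition linear_op :: "(mpol \<Rightarrow> mpol) \<Rightarrow> bool" where
  "linear_op L \<longleftrightarrow> (\<forall>f g. L (f + g) = L f + L g) \<and> (\<forall>c f. L (const c * f) = const c * L f)"

lemma linear_opI:
  assumes "\<And>f g. L (f + g) = L f + L g" and "\<And>c f. L (const c * f) = const c * L f"
  shows "linear_op L"
  using assms by (simp add: linear_op_def)

lemma linear_op_add: "linear_op L \<Longrightarrow> L (f + g) = L f + L g"
  by (simp add: linear_op_def)

lemma linear_op_const: "linear_op L \<Longrightarrow> L (const c * f) = const c * L f"
  by (simp add: linear_op_def)

lemma linear_op_of_nat: "linear_op L \<Longrightarrow> L (of_nat k * f) = of_nat k * L f"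
  by (metis const_of_nat linear_op_const)

lemma linear_op_0: "linear_op L \<Longrightarrow> L 0 = 0"
  by (metis const_0 linear_op_const mult_zero_left)

lemma linear_op_uminus: "linear_op L \<Longrightarrow> L (- f) = - L f"
  using linear_op_const [of L "-1" f] by (simp add: const_uminus)

lemma linear_op_diff: "linear_op L \<Longrightarrow> L (f - g) = L f - L g"
  by (metis add_uminus_conv_diff linear_op_add linear_op_uminus)

lemma linear_op_sum: "linear_op L \<Longrightarrow> L (sum f A) = (\<Sum>i\<in>A. L (f i))"
  by (induction A rule: infinite_finite_induct) (simp_all add: linear_op_0 linear_op_add)

lemma linear_op_expand:
  assumes "linear_op L"
  shows "L f = (\<Sum>a\<in>keys f. const (lookup f a) * L (single a 1))"
proof -
  have "L f = L (\<Sum>a\<in>keys f. single a (lookup f a))"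
    by (simp flip: poly_mapping_sum_singles)
  also have "\<dots> = (\<Sum>a\<in>keys f. L (single a (lookup f a)))"
    by (rule linear_op_sum [OF assms])
  also have "\<dots> = (\<Sum>a\<in>keys f. const (lookup f a) * L (single a 1))"
    by (intro sum.cong refl) (metis single_conv_const linear_op_const [OF assms])
  finally show ?thesis .
qed

text \<open>Operators are compared on monomials only. The restriction to \<open>keys f\<close> lets
  knowledge about the exponents of \<open>f\<close> enter, such as its degree.\<close>

lemma linear_op_eqI:
  assumes "linear_op L" "linear_op M" "\<And>a. a \<in> keys f \<Longrightarrow> L (single a 1) = M (single a 1)"
  shows "L f = M f"
  using assms by (simp add: linear_op_expand [of L f] linear_op_expand [of M f])

lemma linear_op_plus: "linear_op L \<Longrightarrow> linear_op M \<Longrightarrow> linear_op (\<lambda>f. L f + M f)"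
  by (simp add: linear_op_def algebra_simps)

lemma linear_op_minus: "linear_op L \<Longrightarrow> linear_op M \<Longrightarrow> linear_op (\<lambda>f. L f - M f)"
  by (simp add: linear_op_def algebra_simps)

lemma linear_op_comp: "linear_op L \<Longrightarrow> linear_op M \<Longrightarrow> linear_op (\<lambda>f. L (M f))"
  by (simp add: linear_op_def)

lemma linear_op_mult: "linear_op L \<Longrightarrow> linear_op (\<lambda>f. h * L f)"
  by (simp add: linear_op_def algebra_simps)

lemma linear_op_mult_right: "linear_op L \<Longrightarrow> linear_op (\<lambda>f. L f * h)"
  by (simp add: linear_op_def algebra_simps)

lemma linear_op_id: "linear_op (\<lambda>f. f)"
  by (simp add: linear_op_def)

lemma linear_op_Sum: "(\<And>i. i \<in> A \<Longrightarrow> linear_op (L i)) \<Longrightarrow> linear_op (\<lambda>f. \<Sum>i\<in>A. L i f)"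
  by (simp add: linear_op_def sum.distrib sum_distrib_left cong: sum.cong)

lemma linear_op_multl: "linear_op (\<lambda>f. h * f)"
  by (rule linear_op_mult, rule linear_op_id)

lemma linear_op_multr: "linear_op (\<lambda>f. f * h)"
  by (rule linear_op_mult_right, rule linear_op_id)

text \<open>The permutation \<open>p\<close> acts on polynomials by $x_i \mapsto x_{p(i)}$.\<close>

definition perm :: "(nat \<Rightarrow> nat) \<Rightarrow> mpol \<Rightarrow> mpol" where
  "perm p f = (\<Sum>a\<in>keys f. single (map_key (inv p) a) (lookup f a))"

lemma lookup_map_key: "bij p \<Longrightarrow> lookup (map_key p a) i = lookup a (p i)"
  by (simp add: map_key.rep_eq bij_is_inj)

lemma map_key_comp: "bij p \<Longrightarrow> bij q \<Longrightarrow> map_key p (map_key q a) = map_key (q \<circ> p) a"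
  by (rule poly_mapping_eqI) (simp add: lookup_map_key bij_comp)

lemma map_key_inv: "bij p \<Longrightarrow> map_key p (map_key (inv p) a) = a"
  "bij p \<Longrightarrow> map_key (inv p) (map_key p a) = a"
  by (rule poly_mapping_eqI; simp add: lookup_map_key bij_imp_bij_inv bij_is_surj surj_f_inv_f bij_is_inj)+

lemma lookup_perm:
  assumes "bij p"
  shows "lookup (perm p f) a = lookup f (map_key p a)"
proof -
  have "lookup (perm p f) a = (\<Sum>b\<in>keys f. if map_key (inv p) b = a then lookup f b else 0)"
    by (simp add: perm_def lookup_sum lookup_single when_def)
  also have "\<dots> = (\<Sum>b\<in>keys f. if b = map_key p a then lookup f b else 0)"
  proof -
    have "map_key (inv p) b = a \<longleftrightarrow> b = map_key p a" for b
      using map_key_inv [OF assms] by metis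
    then show ?thesis by simp
  qed
  also have "\<dots> = lookup f (map_key p a)"
    by (simp add: in_keys_iff)
  finally show ?thesis .
qed

lemma swap_vars_eq_perm: "swap_vars i j = perm (transpose i j)"
  by (rule ext) (simp add: swap_vars_def perm_def)

lemma linear_op_perm: "bij p \<Longrightarrow> linear_op (perm p)"
  by (rule linear_opI; rule poly_mapping_eqI) (simp_all add: lookup_perm lookup_add)

lemma perm_single: "bij p \<Longrightarrow> perm p (single a c) = single (map_key (inv p) a) c"
  by (rule poly_mapping_eqI) (auto simp: lookup_perm lookup_single map_key_inv when_def)

lemma map_key_add: "bij p \<Longrightarrow> map_key p (a + b) = map_key p a + map_key p (b :: exponent)"
  by (simp add: map_key_plus bij_is_inj)

text \<open>Both sides are bilinear, so linearity reduces first \<open>f\<close> and then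
  \<open>g\<close> to monomials. The same two rounds give the product rule for \<open>theta\<close>
  and the multiplicativity of \<open>restrict_poly\<close>.\<close>

lemma perm_mult:
  assumes "bij p"
  shows "perm p (f * g) = perm p f * perm p g"
proof -
  note L = linear_op_perm [OF assms]
  have "perm p (f * single b 1) = perm p f * perm p (single b 1)" for b
  proof (rule linear_op_eqI [OF linear_op_comp [OF L linear_op_multr [of "single b 1"]]
        linear_op_mult_right [OF L, of "perm p (single b 1)"]])
    show "perm p (single a 1 * single b 1) = perm p (single a 1) * perm p (single b 1)" for a
      by (simp only: perm_single mult_single assms map_key_add bij_imp_bij_inv)
  qed
  then show ?thesis
    by (rule linear_op_eqI [OF linear_op_comp [OF L linear_op_multl [of f]] linear_op_mult [OF L, of "perm p f"]])
qed

lemma perm_comp: "bij p \<Longrightarrow> bij q \<Longrightarrow> perm p (perm q f) = perm (p \<circ> q) f"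
  by (rule poly_mapping_eqI) (simp add: lookup_perm map_key_comp bij_comp)

lemma perm_id [simp]: "perm id f = f" "perm (\<lambda>i. i) f = f"
proof -
  have "map_key (\<lambda>i. i) a = a" for a :: exponent
    by (rule map_key_id)
  then show "perm (\<lambda>i. i) f = f"
    by (intro poly_mapping_eqI) (simp add: lookup_perm bij_id [unfolded id_def])
  then show "perm id f = f" by (simp add: id_def)
qed

lemma perm_const [simp]: "bij p \<Longrightarrow> perm p (const c) = const c"
  by (simp add: const_def perm_single bij_imp_bij_inv bij_is_inj)

lemma perm_1 [simp]: "bij p \<Longrightarrow> perm p 1 = 1"
  by (metis const_1 perm_const)

lemma perm_0 [simp]: "bij p \<Longrightarrow> perm p 0 = 0"
  by (metis const_0 perm_const)

lemma perm_of_nat [simp]: "bij p \<Longrightarrow> perm p (of_nat k) = of_nat k"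
  by (metis const_of_nat perm_const)

lemma map_key_single_bij: "bij p \<Longrightarrow> map_key (inv p) (single k c) = single (p k) c"
  by (rule poly_mapping_eqI)
     (metis bij_inv_eq_iff bij_imp_bij_inv lookup_map_key lookup_single_eq lookup_single_not_eq)

lemma perm_X [simp]: "bij p \<Longrightarrow> perm p (X k) = X (p k)"
  by (simp add: X_def perm_single map_key_single_bij)

lemma perm_add: "bij p \<Longrightarrow> perm p (f + g) = perm p f + perm p g"
  by (rule linear_op_add [OF linear_op_perm])

lemma perm_diff: "bij p \<Longrightarrow> perm p (f - g) = perm p f - perm p g"
  by (rule linear_op_diff [OF linear_op_perm])

lemma perm_uminus: "bij p \<Longrightarrow> perm p (- f) = - perm p f"
  by (rule linear_op_uminus [OF linear_op_perm])

lemma perm_sum: "bij p \<Longrightarrow> perm p (sum f A) = (\<Sum>i\<in>A. perm p (f i))"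
  by (rule linear_op_sum [OF linear_op_perm])

lemma perm_prod: "bij p \<Longrightarrow> perm p (prod f A) = (\<Prod>i\<in>A. perm p (f i))"
  by (induction A rule: infinite_finite_induct) (simp_all add: perm_mult)

lemmas perm_simps = perm_add perm_diff perm_uminus perm_sum perm_mult perm_prod

section \<open>The derivations x_i d/dx_i\<close>

definition theta :: "nat \<Rightarrow> mpol \<Rightarrow> mpol" where
  "theta i f = X i * pdiff i f"

text \<open>Where the subtraction of exponents truncates, the coefficient is zero.\<close>

lemma X_pdiff_single:
  "X i * single (a - single i 1) (of_nat (lookup a i) * c) = single a (of_nat (lookup a i) * c)"
proof (cases "lookup a i = 0")
  case False
  then have "single i 1 + (a - single i 1) = a"
    by (intro poly_mapping_eqI) (auto simp: lookup_add lookup_minus lookup_single when_def)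
  then show ?thesis by (simp add: X_def mult_single)
qed simp

lemma lookup_theta: "lookup (theta i f) a = of_nat (lookup a i) * lookup f a"
proof -
  have "theta i f = (\<Sum>b\<in>keys f. single b (of_nat (lookup b i) * lookup f b))"
    by (simp only: theta_def pdiff_def sum_distrib_left X_pdiff_single)
  then have "lookup (theta i f) a = (\<Sum>b\<in>keys f. if b = a then of_nat (lookup b i) * lookup f b else 0)"
    by (simp add: lookup_sum lookup_single when_def)
  then show ?thesis by (simp add: in_keys_iff)
qed

lemma linear_op_theta: "linear_op (theta i)"
  by (rule linear_opI; rule poly_mapping_eqI) (simp_all add: lookup_theta lookup_add distrib_left mult.left_commute)

lemma theta_single: "theta i (single a c) = const (of_nat (lookup a i)) * single a c"
  by (rule poly_mapping_eqI) (simp add: lookup_theta lookup_single when_def)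

lemma theta_mult: "theta i (f * g) = theta i f * g + f * theta i g"
proof -
  note L = linear_op_theta [of i]
  have "theta i (f * single b 1) = theta i f * single b 1 + f * theta i (single b 1)" for b
  proof (rule linear_op_eqI [OF linear_op_comp [OF L linear_op_multr [of "single b 1"]]
          linear_op_plus [OF linear_op_mult_right [OF L, of "single b 1"] linear_op_multr [of "theta i (single b 1)"]]])
    fix a
    have "theta i (single a 1 * single b 1) = const (of_nat (lookup a i + lookup b i)) * (single a 1 * single b 1)"
      by (simp only: theta_single mult_single lookup_add mult_1)
    also have "\<dots> = const (of_nat (lookup a i)) * single a 1 * single b 1
        + single a 1 * (const (of_nat (lookup b i)) * single b 1)"
      by (simp only: of_nat_add const_add distrib_right distrib_left mult.assoc mult.left_commute)
    finally show "theta i (single a 1 * single b 1) = theta i (single a 1) * single b 1 + single a 1 * theta i (single b 1)"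
      by (simp only: theta_single)
  qed
  then show ?thesis
    by (rule linear_op_eqI [OF linear_op_comp [OF L linear_op_multl [of f]]
          linear_op_plus [OF linear_op_multl [of "theta i f"] linear_op_mult [OF L, of f]]])
qed

lemma theta_const [simp]: "theta i (const c) = 0"
  by (simp add: const_def theta_single)

lemma theta_1 [simp]: "theta i 1 = 0"
  by (metis const_1 theta_const)

lemma theta_X: "theta i (X j) = (if i = j then X j else 0)"
  by (simp add: X_def theta_single lookup_single)

lemma theta_diff: "theta i (f - g) = theta i f - theta i g"
  by (rule linear_op_diff [OF linear_op_theta])

lemma theta_commute: "theta i (theta j f) = theta j (theta i f)"
  by (rule poly_mapping_eqI) (simp add: lookup_theta)

lemma perm_theta: "bij p \<Longrightarrow> perm p (theta i f) = theta (p i) (perm p f)"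
  by (rule poly_mapping_eqI) (simp add: lookup_theta lookup_perm lookup_map_key)

lemma X_diff_nonzero: "i \<noteq> j \<Longrightarrow> X i - X j \<noteq> 0"
proof
  assume "i \<noteq> j" and "X i - X j = 0"
  then have "keys (X i) = keys (X j)" by simp
  with \<open>i \<noteq> j\<close> have "single i 1 = (single j 1 :: exponent)"
    by (simp add: X_def)
  then have "keys (single i 1 :: exponent) = keys (single j 1 :: exponent)" by (rule arg_cong)
  with \<open>i \<noteq> j\<close> show False by simp
qed

section \<open>Dunkl operators and their commutation relations\<close>

text \<open>The divided difference x_i/(x_i - x_j) (1 - K_ij) that occurs in D_i.\<close>

definition quot :: "nat \<Rightarrow> nat \<Rightarrow> mpol \<Rightarrow> mpol" where
  "quot i j f = exact_quot (X i * (f - swap_vars i j f)) (X i - X j)"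

lemma single_plus_single: "single (a + b) 1 = single a 1 * (single b 1 :: mpol)"
  by (simp add: mult_single)

lemma single_power: "single (single i k) 1 = X i ^ k"
proof (induction k)
  case (Suc k)
  have "single i (Suc k) = single i 1 + single i k"
    by (simp flip: single_add)
  then show ?case using Suc by (simp add: single_plus_single X_def)
qed simp

text \<open>The factor \<open>X i - X j\<close> can be cancelled in an integral domain. Identities
  about \<open>quot\<close> are therefore proved by clearing denominators.\<close>

lemma quot_eqI:
  assumes "i \<noteq> j" "(X i - X j) * q = X i * (f - perm (transpose i j) f)"
  shows "quot i j f = q"
  unfolding quot_def exact_quot_def swap_vars_eq_perm
proof (rule the_equality)
  show "(X i - X j) * q = X i * (f - perm (transpose i j) f)" by fact
  fix q' assume "(X i - X j) * q' = X i * (f - perm (transpose i j) f)"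
  with assms have "(X i - X j) * q' = (X i - X j) * q" by simp
  with X_diff_nonzero [OF assms(1)] show "q' = q" by simp
qed

text \<open>The quotient for a single monomial, written as a finite geometric sum. \<open>b\<close>
  collects the variables other than x_i and x_j; the sign reflects that 1 - K_ij changes sign when
  \<open>p\<close> and \<open>q\<close> are interchanged.\<close>

definition quot_exp :: "nat \<Rightarrow> nat \<Rightarrow> exponent \<Rightarrow> mpol" where
  "quot_exp i j a = (let p = lookup a i; q = lookup a j; b = Poly_Mapping.update i 0 (Poly_Mapping.update j 0 a) in
     if q \<le> p then \<Sum>c<p - q. single (b + single i (q + 1 + c) + single j (p - 1 - c)) 1
     else - (\<Sum>c<q - p. single (b + single i (p + 1 + c) + single j (q - 1 - c)) 1))"

lemma transpose_map_key_update:
  "i \<noteq> j \<Longrightarrow> map_key (transpose i j) (Poly_Mapping.update i 0 (Poly_Mapping.update j 0 a))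
     = Poly_Mapping.update i 0 (Poly_Mapping.update j 0 (a::exponent))"
  by (rule poly_mapping_eqI) (simp add: lookup_map_key lookup_update transpose_def)

lemma quot_exp:
  assumes "i \<noteq> j"
  shows "(X i - X j) * quot_exp i j a = X i * (single a 1 - perm (transpose i j) (single a 1))"
proof -
  define p q b where "p = lookup a i" and "q = lookup a j"
    and "b = Poly_Mapping.update i 0 (Poly_Mapping.update j 0 a)"
  have a: "a = b + single i p + single j q"
    using assms by (intro poly_mapping_eqI) (auto simp: b_def p_def q_def lookup_update lookup_add lookup_single when_def)
  define M where "M = single b (1::ratfun)"
  have 1: "single a 1 = M * X i ^ p * X j ^ q"
    by (simp add: a single_plus_single single_power M_def)
  have 2: "perm (transpose i j) (single a 1) = M * X j ^ p * X i ^ q"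
    using assms unfolding 1 by (simp add: perm_mult flip: single_power)
      (simp add: M_def perm_single map_key_single_bij transpose_map_key_update b_def
            map_key_single_bij [of "transpose i j", simplified])
  \<comment> \<open>With \<open>l\<close> the smaller of the two exponents, (xy)^l splits off and
    x^m - y^m remains.\<close>
  have geo: "(x - y) * (\<Sum>c<m. x ^ (l + 1 + c) * y ^ (l + m - 1 - c)) = x * (x ^ (l + m) * y ^ l - y ^ (l + m) * x ^ l)"
    for x y :: mpol and l m
  proof -
    have "(x - y) * (\<Sum>c<m. x ^ (l + 1 + c) * y ^ (l + m - 1 - c)) = (x - y) * (\<Sum>c<m. x * x ^ l * y ^ l * (y ^ (m - Suc c) * x ^ c))"
    proof (intro arg_cong [where f = "(*) (x - y)"] sum.cong refl)
      fix c assume "c \<in> {..<m}"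
      then have e: "l + m - 1 - c = l + (m - Suc c)" by simp
      show "x ^ (l + 1 + c) * y ^ (l + m - 1 - c) = x * x ^ l * y ^ l * (y ^ (m - Suc c) * x ^ c)"
        unfolding e by (simp add: power_add mult_ac)
    qed
    also have "\<dots> = x * x ^ l * y ^ l * ((x - y) * (\<Sum>c<m. y ^ (m - Suc c) * x ^ c))"
      by (simp add: sum_distrib_left mult_ac)
    also have "\<dots> = x * x ^ l * y ^ l * (x ^ m - y ^ m)"
      by (simp add: power_diff_sumr2)
    finally show ?thesis by (simp add: power_add algebra_simps)
  qed
  show ?thesis
  proof (cases "q \<le> p")
    case True
    then have "quot_exp i j a = (\<Sum>c<p - q. M * (X i ^ (q + 1 + c) * X j ^ (q + (p - q) - 1 - c)))"
      by (simp add: quot_exp_def Let_def flip: p_def q_def b_def)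
         (simp add: single_plus_single single_power M_def mult_ac)
    then have "(X i - X j) * quot_exp i j a = M * ((X i - X j) * (\<Sum>c<p - q. (X i ^ (q + 1 + c) * X j ^ (q + (p - q) - 1 - c))))"
      by (simp add: sum_distrib_left mult_ac)
    then show ?thesis unfolding geo 2 unfolding 1 using True by (simp add: algebra_simps)
  next
    case False
    then have "quot_exp i j a = - (\<Sum>c<q - p. M * (X i ^ (p + 1 + c) * X j ^ (p + (q - p) - 1 - c)))"
      by (simp add: quot_exp_def Let_def flip: p_def q_def b_def)
         (simp add: single_plus_single single_power M_def mult_ac)
    then have "(X i - X j) * quot_exp i j a = - M * ((X i - X j) * (\<Sum>c<q - p. (X i ^ (p + 1 + c) * X j ^ (p + (q - p) - 1 - c))))"
      by (simp add: sum_distrib_left mult_ac sum_negf)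
    then show ?thesis unfolding geo 2 unfolding 1 using False by (simp add: algebra_simps)
  qed
qed

lemma quot_expand:
  assumes "i \<noteq> j"
  shows "quot i j f = (\<Sum>a\<in>keys f. const (lookup f a) * quot_exp i j a)"
proof (rule quot_eqI [OF assms])
  have L: "linear_op (\<lambda>f. X i * (f - perm (transpose i j) f))"
    by (rule linear_op_mult [OF linear_op_minus [OF linear_op_id linear_op_perm]]) simp
  show "(X i - X j) * (\<Sum>a\<in>keys f. const (lookup f a) * quot_exp i j a) = X i * (f - perm (transpose i j) f)"
    unfolding linear_op_expand [OF L, of f] quot_exp [OF assms, symmetric]
    by (simp add: sum_distrib_left mult_ac)
qed

text \<open>Divisibility holds for monomials by the geometric sum and extends linearly; it makes the
  definite description in \<open>exact_quot\<close> meaningful.\<close>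

lemma quot_eq:
  assumes "i \<noteq> j"
  shows "(X i - X j) * quot i j f = X i * (f - perm (transpose i j) f)"
proof -
  have L: "linear_op (\<lambda>f. X i * (f - perm (transpose i j) f))"
    by (rule linear_op_mult [OF linear_op_minus [OF linear_op_id linear_op_perm]]) simp
  show ?thesis
    unfolding linear_op_expand [OF L, of f] quot_exp [OF assms, symmetric] quot_expand [OF assms]
    by (simp add: sum_distrib_left mult_ac)
qed

lemma linear_op_quot: "i \<noteq> j \<Longrightarrow> linear_op (quot i j)"
proof (intro linear_opI quot_eqI)
  fix f g c assume ij: "i \<noteq> j"
  have "(X i - X j) * (quot i j f + quot i j g) = X i * (f - perm (transpose i j) f) + X i * (g - perm (transpose i j) g)"
    by (simp only: distrib_left quot_eq [OF ij])
  then show "(X i - X j) * (quot i j f + quot i j g) = X i * (f + g - perm (transpose i j) (f + g))"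
    by (simp add: perm_simps algebra_simps)
  have "(X i - X j) * (const c * quot i j f) = const c * (X i * (f - perm (transpose i j) f))"
    by (simp only: mult.left_commute quot_eq [OF ij])
  then show "(X i - X j) * (const c * quot i j f) = X i * (const c * f - perm (transpose i j) (const c * f))"
    by (simp add: perm_simps algebra_simps)
qed

lemma perm_quot:
  assumes "bij p" "i \<noteq> j"
  shows "perm p (quot i j f) = quot (p i) (p j) (perm p f)"
proof (rule quot_eqI [symmetric])
  show "p i \<noteq> p j" using assms by (simp add: bij_is_inj inj_eq)
  have *: "transpose (p i) (p j) \<circ> p = p \<circ> transpose i j"
    using assms by (auto simp: fun_eq_iff transpose_def bij_is_inj inj_eq)
  have "perm p ((X i - X j) * quot i j f) = perm p (X i * (f - perm (transpose i j) f))"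
    by (simp add: quot_eq assms)
  then show "(X (p i) - X (p j)) * perm p (quot i j f) = X (p i) * (perm p f - perm (transpose (p i) (p j)) (perm p f))"
    by (simp add: assms perm_simps perm_comp *)
qed

lemma dunkl_eq: "dunkl n i f = const alpha * theta i f + (\<Sum>j\<in>{..<n} - {i}. quot i j f)"
  by (simp add: dunkl_def quot_def theta_def mult.assoc)

lemma linear_op_dunkl: "linear_op (dunkl n i)"
  unfolding dunkl_eq [abs_def]
  by (intro linear_op_plus linear_op_mult linear_op_Sum linear_op_theta linear_op_quot) auto

lemmas dunkl_add = linear_op_add [OF linear_op_dunkl]
  and dunkl_sum = linear_op_sum [OF linear_op_dunkl]
  and dunkl_const = linear_op_const [OF linear_op_dunkl]
  and dunkl_of_nat = linear_op_of_nat [OF linear_op_dunkl]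

lemma perm_dunkl:
  assumes "p permutes {..<n}"
  shows "perm p (dunkl n i f) = dunkl n (p i) (perm p f)"
proof -
  have b: "bij p" using assms by (rule permutes_bij)
  have "(\<Sum>j\<in>{..<n} - {i}. quot (p i) (p j) (perm p f)) = (\<Sum>j\<in>{..<n} - {p i}. quot (p i) j (perm p f))"
  proof (rule sum.reindex_cong [symmetric])
    show "inj_on p ({..<n} - {i})" using b by (meson bij_is_inj inj_on_subset subset_UNIV)
    show "{..<n} - {p i} = p ` ({..<n} - {i})"
      using permutes_image [OF assms] b by (metis bij_is_inj image_empty image_insert image_set_diff)
  qed auto
  then show ?thesis
    unfolding dunkl_eq using b
    by (simp add: perm_simps perm_theta perm_quot)
qed

section \<open>Commutation relations of the divided differences\<close>

abbreviation swap :: "nat \<Rightarrow> nat \<Rightarrow> mpol \<Rightarrow> mpol" where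
  "swap a b \<equiv> perm (transpose a b)"

lemma swap_swap [simp]: "swap a b (swap a b f) = f"
  by (simp add: perm_comp)

lemma swap_commute: "swap a b = swap b a"
  by (simp add: transpose_commute)

lemma perm_swap:
  assumes "bij p"
  shows "perm p (swap a b f) = swap (p a) (p b) (perm p f)"
proof -
  have "p \<circ> transpose a b = transpose (p a) (p b) \<circ> p"
    using assms by (auto simp: fun_eq_iff transpose_def bij_is_inj inj_eq)
  with assms show ?thesis by (simp add: perm_comp)
qed

lemma theta_quot:
  assumes "i \<noteq> j" "i \<noteq> k" "j \<noteq> k"
  shows "theta i (quot j k f) = quot j k (theta i f)"
proof (rule quot_eqI [symmetric])
  have "(X j - X k) * theta i (quot j k f) = theta i ((X j - X k) * quot j k f)"
    using assms by (simp add: theta_mult theta_diff theta_X)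
  also have "\<dots> = theta i (X j * (f - swap j k f))"
    using assms by (simp add: quot_eq)
  also have "\<dots> = X j * (theta i f - swap j k (theta i f))"
    using assms by (simp add: theta_mult theta_diff theta_X perm_theta)
  finally show "(X j - X k) * theta i (quot j k f) = X j * (theta i f - swap j k (theta i f))" .
qed fact

text \<open>This is x_i/(x_i - x_j) + x_j/(x_j - x_i) = 1.\<close>

lemma quot_flip:
  assumes "i \<noteq> j"
  shows "quot j i f = f - swap i j f - quot i j f"
proof (rule quot_eqI)
  show "(X j - X i) * (f - swap i j f - quot i j f) = X j * (f - swap j i f)"
    using quot_eq [OF assms, of f] by (simp add: swap_commute [of j i] algebra_simps)
qed (use assms in simp)

text \<open>A divided difference preserves the joint degree in x_i and x_j, though not the two
  separate degrees.\<close>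

lemma theta_plus_quot:
  assumes "i \<noteq> j"
  shows "theta i (quot i j f) + theta j (quot i j f) = quot i j (theta i f) + quot i j (theta j f)"
proof -
  let ?E = "\<lambda>f. theta i f + theta j f"
  have "(X i - X j) * ?E (quot i j f) = ?E ((X i - X j) * quot i j f) - (X i - X j) * quot i j f"
    using assms by (simp add: theta_mult theta_diff theta_X algebra_simps)
  also have "\<dots> = ?E (X i * (f - swap i j f)) - X i * (f - swap i j f)"
    by (simp only: quot_eq [OF assms])
  also have "\<dots> = X i * (?E f - swap i j (?E f))"
    using assms by (simp add: theta_mult theta_diff theta_X perm_add perm_theta algebra_simps)
  finally have "?E (quot i j f) = quot i j (?E f)"
    using assms by (intro quot_eqI [symmetric])
  then show ?thesis
    by (simp add: linear_op_add [OF linear_op_quot [OF assms]])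
qed

text \<open>The first-order terms of [D_i, D_j] that involve only the pair \<open>i\<close>,
  \<open>j\<close>. After \<open>quot_flip\<close> the joint derivation of
  \<open>theta_plus_quot\<close> drops out and the terms with K_ij are left.\<close>

lemma theta_quot_commutator:
  assumes "i \<noteq> j"
  shows "theta i (quot j i f) - quot j i (theta i f) + quot i j (theta j f) - theta j (quot i j f)
     = theta j (swap i j f) - theta i (swap i j f)"
  using theta_plus_quot [OF assms, of f]
  by (simp only: quot_flip [OF assms] theta_diff) (simp add: perm_theta algebra_simps)

text \<open>After \<open>quot_flip\<close> the squares of \<open>quot i j\<close> cancel, which
  leaves only its commutator with K_ij.\<close>

lemma quot_commutator_two:
  assumes "i \<noteq> j"
  shows "quot i j (quot j i f) - quot j i (quot i j f) = quot j i (swap i j f) - quot i j (swap i j f)"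
proof -
  have "swap i j (quot i j f) = quot j i (swap i j f)"
    using assms by (simp add: perm_quot)
  then show ?thesis
    by (simp only: quot_flip [OF assms] linear_op_diff [OF linear_op_quot [OF assms]]) (simp add: algebra_simps)
qed

lemma quot_quot:
  assumes "a \<noteq> b" "c \<noteq> e"
  shows "(X a - X b) * quot a b (quot c e f) = X a * (quot c e f - quot (transpose a b c) (transpose a b e) (swap a b f))"
  using assms by (simp add: quot_eq perm_quot)

lemma quot_commute_four:
  assumes "i \<noteq> j" "i \<noteq> l" "k \<noteq> j" "k \<noteq> l" "i \<noteq> k" "j \<noteq> l"
  shows "quot i k (quot j l f) = quot j l (quot i k f)"
proof (rule quot_eqI [symmetric])
  show "j \<noteq> l" by fact
  have "(X i - X k) * quot i k (quot j l f) = X i * (quot j l f - quot j l (swap i k f))"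
    using assms by (simp add: quot_quot)
  then have "(X i - X k) * ((X j - X l) * quot i k (quot j l f)) = X i * ((X j - X l) * quot j l f - (X j - X l) * quot j l (swap i k f))"
    by algebra
  also have "\<dots> = X i * (X j * (f - swap j l f) - X j * (swap i k f - swap j l (swap i k f)))"
    using assms by (simp add: quot_eq)
  also have "\<dots> = X j * (X i * (f - swap i k f) - X i * (swap j l f - swap i k (swap j l f)))"
    using assms by (simp add: perm_swap [of "transpose j l"] algebra_simps)
  also have "\<dots> = (X i - X k) * (X j * (quot i k f - swap j l (quot i k f)))"
  proof -
    have "swap j l (quot i k f) = quot i k (swap j l f)"
      using assms by (simp add: perm_quot)
    then have "(X i - X k) * (X j * (quot i k f - swap j l (quot i k f)))
        = X j * ((X i - X k) * quot i k f - (X i - X k) * quot i k (swap j l f))"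
      by (simp only: right_diff_distrib left_diff_distrib mult_ac)
    then show ?thesis
      by (simp only: quot_eq [OF assms(5)])
  qed
  finally show "(X j - X l) * quot i k (quot j l f) = X j * (quot i k f - swap j l (quot i k f))"
    using X_diff_nonzero [of i k] assms by simp
qed

text \<open>The classical Yang-Baxter equation. Multiplied by all three differences it becomes a
  polynomial identity in the six images of \<open>f\<close> under the permutations of
  \<open>i\<close>, \<open>j\<close>, \<open>k\<close>.\<close>

lemma quot_yang_baxter:
  assumes ij: "i \<noteq> j" and ik: "i \<noteq> k" and jk: "j \<noteq> k"
  shows "quot i j (quot j k f) - quot j k (quot i j f) + (quot i k (quot j k f) - quot j k (quot i k f))
    + (quot i j (quot i k f) - quot i k (quot i j f)) = 0" (is "?S = 0")
proof -
  \<comment> \<open>The images of \<open>f\<close> under the two 3-cycles; every product of two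
    different exchanges is one of them.\<close>
  define c c' where "c = swap i k (swap i j f)" and "c' = swap j k (swap i j f)"
  have c: "swap i k (swap i j f) = c" "swap i j (swap j k f) = c" "swap j k (swap i k f) = c"
    using assms unfolding c_def by (simp_all add: perm_comp) (rule arg_cong2 [where f = perm]; auto simp: fun_eq_iff transpose_def)+
  have c': "swap j k (swap i j f) = c'" "swap i k (swap j k f) = c'" "swap i j (swap i k f) = c'"
    using assms unfolding c'_def by (simp_all add: perm_comp) (rule arg_cong2 [where f = perm]; auto simp: fun_eq_iff transpose_def)+
  define d1 d2 d3 where d: "d1 = X i - X j" "d2 = X i - X k" "d3 = X j - X k"
  note sw = swap_commute [of j i] swap_commute [of k i] swap_commute [of k j]
  have q: "d3 * quot j k f = X j * (f - swap j k f)" "d1 * quot i j f = X i * (f - swap i j f)"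
    "d2 * quot i k f = X i * (f - swap i k f)" "d2 * quot i k (swap i j f) = X i * (swap i j f - c)"
    "d3 * quot j k (swap i j f) = X j * (swap i j f - c')"
    "d2 * quot i k (swap j k f) = X i * (swap j k f - c')"
    "d1 * quot i j (swap j k f) = X i * (swap j k f - c)"
    using assms by (simp_all add: d quot_eq c c')
  have q': "d1 * quot j i (swap i k f) = - X j * (swap i k f - c')"
    "d3 * quot k j (swap i k f) = - X k * (swap i k f - c)"
    using quot_eq [OF ij [symmetric], of "swap i k f"] quot_eq [OF jk [symmetric], of "swap i k f"]
    unfolding d sw c c' by algebra+
  have qq: "d1 * quot i j (quot j k f) = X i * (quot j k f - quot i k (swap i j f))"
    "d3 * quot j k (quot i j f) = X j * (quot i j f - quot i k (swap j k f))"
    "d2 * quot i k (quot j k f) = X i * (quot j k f - quot j i (swap i k f))"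
    "d3 * quot j k (quot i k f) = X j * (quot i k f - quot i j (swap j k f))"
    "d1 * quot i j (quot i k f) = X i * (quot i k f - quot j k (swap i j f))"
    "d2 * quot i k (quot i j f) = X i * (quot i j f - quot k j (swap i k f))"
    using assms unfolding d by (simp_all add: quot_quot)
  have "d1 * d2 * d3 * quot i j (quot j k f) = X i * (d2 * (d3 * quot j k f) - d3 * (d2 * quot i k (swap i j f)))"
    using qq(1) by algebra
  moreover have "d1 * d2 * d3 * quot j k (quot i j f) = X j * (d2 * (d1 * quot i j f) - d1 * (d2 * quot i k (swap j k f)))"
    using qq(2) by algebra
  moreover have "d1 * d2 * d3 * quot i k (quot j k f) = X i * (d1 * (d3 * quot j k f) - d3 * (d1 * quot j i (swap i k f)))"
    using qq(3) by algebra
  moreover have "d1 * d2 * d3 * quot j k (quot i k f) = X j * (d1 * (d2 * quot i k f) - d2 * (d1 * quot i j (swap j k f)))"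
    using qq(4) by algebra
  moreover have "d1 * d2 * d3 * quot i j (quot i k f) = X i * (d3 * (d2 * quot i k f) - d2 * (d3 * quot j k (swap i j f)))"
    using qq(5) by algebra
  moreover have "d1 * d2 * d3 * quot i k (quot i j f) = X i * (d3 * (d1 * quot i j f) - d1 * (d3 * quot k j (swap i k f)))"
    using qq(6) by algebra
  moreover have "d1 * d2 * d3 * ?S = d1 * d2 * d3 * quot i j (quot j k f) - d1 * d2 * d3 * quot j k (quot i j f)
    + (d1 * d2 * d3 * quot i k (quot j k f) - d1 * d2 * d3 * quot j k (quot i k f))
    + (d1 * d2 * d3 * quot i j (quot i k f) - d1 * d2 * d3 * quot i k (quot i j f))"
    by (simp add: algebra_simps)
  ultimately have "d1 * d2 * d3 * ?S = 0"
    unfolding q q' by (simp only: d) (simp add: algebra_simps)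
  moreover have "d1 * d2 * d3 \<noteq> 0"
    using X_diff_nonzero assms unfolding d by simp
  ultimately show ?thesis by simp
qed

text \<open>The Yang-Baxter relation with \<open>quot j i\<close> in place of
  \<open>quot i j\<close>, which is the shape in which [D_i, D_j] produces it for a third index
  \<open>k\<close>.\<close>

lemma quot_commutator_three:
  assumes ij: "i \<noteq> j" and ik: "i \<noteq> k" and jk: "j \<noteq> k"
  shows "quot i j (quot j k f) - quot j k (quot i j f) + (quot i k (quot j k f) - quot j k (quot i k f))
    + (quot i k (quot j i f) - quot j i (quot i k f)) = quot j k (swap i j f) - quot i k (swap i j f)"
proof -
  have "swap i j (quot i k f) = quot j k (swap i j f)"
    using assms by (simp add: perm_quot)
  then show ?thesis
    using quot_yang_baxter [OF assms, of f]
    by (simp only: quot_flip [OF ij] linear_op_diff [OF linear_op_quot [OF ik]]) (simp add: algebra_simps)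
qed

text \<open>The terms are grouped by the indices involved: the pair \<open>i\<close>,
  \<open>j\<close> alone, one further index \<open>k\<close>, or two further indices. The first two
  groups are the relations above; the last one vanishes.\<close>

lemma dunkl_commutator:
  assumes "i < n" "j < n" "i \<noteq> j"
  shows "dunkl n i (dunkl n j f) - dunkl n j (dunkl n i f) = dunkl n j (swap i j f) - dunkl n i (swap i j f)"
proof -
  define R where "R = {..<n} - {i, j}"
  have R: "finite R" "i \<notin> R" "j \<notin> R" "{..<n} - {i} = insert j R" "{..<n} - {j} = insert i R"
    using assms by (auto simp: R_def)
  define c where "c a b = quot i a (quot j b f) - quot j b (quot i a f)" for a b
  define t where "t b = theta i (quot j b f) - quot j b (theta i f)" for b
  define u where "u a = quot i a (theta j f) - theta j (quot i a f)" for a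
  note lin = linear_op_sum [OF linear_op_quot] linear_op_add [OF linear_op_quot] linear_op_const [OF linear_op_quot]
     linear_op_sum [OF linear_op_theta] linear_op_add [OF linear_op_theta] linear_op_const [OF linear_op_theta]
  have ne: "i \<noteq> a" if "a \<in> insert j R" for a using that assms R by auto
  have ne': "j \<noteq> b" if "b \<in> insert i R" for b using that assms R by auto
  have "dunkl n i (dunkl n j f) = const alpha * const alpha * theta i (theta j f)
      + const alpha * (\<Sum>b\<in>insert i R. theta i (quot j b f)) + const alpha * (\<Sum>a\<in>insert j R. quot i a (theta j f))
      + (\<Sum>a\<in>insert j R. \<Sum>b\<in>insert i R. quot i a (quot j b f))"
    unfolding dunkl_eq R(4,5)
    by (simp only: lin ne not_False_eq_True sum.distrib sum_distrib_left distrib_left distrib_right mult.assoc add.assoc cong: sum.cong)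
  moreover have "dunkl n j (dunkl n i f) = const alpha * const alpha * theta j (theta i f)
      + const alpha * (\<Sum>a\<in>insert j R. theta j (quot i a f)) + const alpha * (\<Sum>b\<in>insert i R. quot j b (theta i f))
      + (\<Sum>b\<in>insert i R. \<Sum>a\<in>insert j R. quot j b (quot i a f))"
    unfolding dunkl_eq R(4,5)
    by (simp only: lin ne' not_False_eq_True sum.distrib sum_distrib_left distrib_left distrib_right mult.assoc add.assoc cong: sum.cong)
  moreover have "(\<Sum>b\<in>insert i R. \<Sum>a\<in>insert j R. quot j b (quot i a f)) = (\<Sum>a\<in>insert j R. \<Sum>b\<in>insert i R. quot j b (quot i a f))"
    by (rule sum.swap)
  ultimately have "dunkl n i (dunkl n j f) - dunkl n j (dunkl n i f) =
      const alpha * ((\<Sum>b\<in>insert i R. t b) + (\<Sum>a\<in>insert j R. u a)) + (\<Sum>a\<in>insert j R. \<Sum>b\<in>insert i R. c a b)"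
    unfolding t_def u_def c_def
    by (simp only: sum_subtractf theta_commute [of j i] algebra_simps)
  also have "(\<Sum>b\<in>insert i R. t b) = t i"
    using R assms by (simp add: t_def theta_quot ne ne' cong: sum.cong)
  also have "(\<Sum>a\<in>insert j R. u a) = u j"
    using R assms by (simp add: u_def) (intro sum.neutral ballI, metis theta_quot diff_self assms(3))
  also have "t i + u j = theta j (swap i j f) - theta i (swap i j f)"
    using theta_quot_commutator [OF assms(3), of f] by (simp add: t_def u_def algebra_simps)
  also have "(\<Sum>a\<in>insert j R. \<Sum>b\<in>insert i R. c a b) = c j i + ((\<Sum>k\<in>R. c j k) + (\<Sum>k\<in>R. \<Sum>b\<in>R. c k b) + (\<Sum>k\<in>R. c k i))"
    using R by (simp add: sum.distrib algebra_simps)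
  \<comment> \<open>For distinct \<open>k\<close> and \<open>b\<close> all four indices differ and
    the divided differences commute, so only the diagonal survives.\<close>
  also have "(\<Sum>k\<in>R. \<Sum>b\<in>R. c k b) = (\<Sum>k\<in>R. c k k)"
  proof (rule sum.cong [OF refl])
    fix k assume k: "k \<in> R"
    have "c k b = (if b = k then c k k else 0)" if "b \<in> R" for b
      using quot_commute_four [of i j b k f] that k R assms by (auto simp: c_def)
    then have "(\<Sum>b\<in>R. c k b) = (\<Sum>b\<in>R. if b = k then c k k else 0)"
      by (rule sum.cong [OF refl])
    then show "(\<Sum>b\<in>R. c k b) = c k k"
      using k R by simp
  qed
  also have "c j i = quot j i (swap i j f) - quot i j (swap i j f)"
    using quot_commutator_two [OF assms(3)] by (simp add: c_def)
  also have "(\<Sum>k\<in>R. c j k) + (\<Sum>k\<in>R. c k k) + (\<Sum>k\<in>R. c k i) = (\<Sum>k\<in>R. quot j k (swap i j f) - quot i k (swap i j f))"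
    unfolding sum.distrib [symmetric] c_def
    by (rule sum.cong [OF refl], rule quot_commutator_three) (use R assms in auto)
  finally show ?thesis
    unfolding dunkl_eq R(4,5) using R by (simp add: sum_subtractf algebra_simps)
qed

lemma swap_dunkl: "a < n \<Longrightarrow> b < n \<Longrightarrow> swap a b (dunkl n i f) = dunkl n (transpose a b i) (swap a b f)"
  by (intro perm_dunkl permutes_swap_id) auto

section \<open>Cherednik operators\<close>

text \<open>The commuting (Cherednik) variant of the Dunkl operators.\<close>

definition xi :: "nat \<Rightarrow> nat \<Rightarrow> mpol \<Rightarrow> mpol" where
  "xi n i f = dunkl n i f + (\<Sum>j<i. swap j i f)"

lemma linear_op_xi: "linear_op (xi n i)"
  unfolding xi_def [abs_def]
  by (intro linear_op_plus linear_op_dunkl linear_op_Sum linear_op_perm) auto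

lemmas xi_add = linear_op_add [OF linear_op_xi]
  and xi_diff = linear_op_diff [OF linear_op_xi]
  and xi_sum = linear_op_sum [OF linear_op_xi]
  and xi_const = linear_op_const [OF linear_op_xi]
  and xi_of_nat = linear_op_of_nat [OF linear_op_xi]
  and xi_0 [simp] = linear_op_0 [OF linear_op_xi]

lemma perm_xi:
  assumes "p permutes {..<n}" "p i = i" "p ` {..<i} = {..<i}"
  shows "perm p (xi n i f) = xi n i (perm p f)"
proof -
  have b: "bij p" using assms(1) by (rule permutes_bij)
  have "(\<Sum>j<i. swap (p j) i (perm p f)) = (\<Sum>j<i. swap j i (perm p f))"
    by (rule sum.reindex_cong [symmetric, where l = p])
       (use b assms in \<open>auto simp: bij_is_inj intro: inj_on_subset [OF bij_is_inj]\<close>)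
  then show ?thesis
    using assms by (simp add: xi_def perm_simps b perm_dunkl perm_swap)
qed

lemma transpose_image_insert: "i \<notin> J \<Longrightarrow> j \<in> J \<Longrightarrow> transpose i j ` J = insert i (J - {j})"
  by (auto simp: transpose_def image_iff)

lemma transpose_image_same: "(i \<in> J \<longleftrightarrow> j \<in> J) \<Longrightarrow> transpose i j ` J = J"
  by (auto simp: transpose_def image_iff)

lemma swap_xi:
  assumes "i < n" "a < n" "b < n" "a < i \<and> b < i \<or> i < a \<and> i < b"
  shows "swap a b (xi n i f) = xi n i (swap a b f)"
proof (rule perm_xi)
  show "transpose a b permutes {..<n}" using assms by (intro permutes_swap_id) auto
  show "transpose a b i = i" using assms by auto
  show "transpose a b ` {..<i} = {..<i}" using assms by (intro transpose_image_same) auto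
qed

text \<open>For \<open>i < j\<close> the exchange K_ij contained in xi_j absorbs [D_i, D_j]. The
  other exchanges in xi_j can be moved past D_i, and those in xi_i past xi_j.\<close>

lemma xi_commute:
  assumes "i < n" "j < n"
  shows "xi n i (xi n j f) = xi n j (xi n i f)"
proof -
  have *: "xi n i (xi n j f) = xi n j (xi n i f)" if ij: "i < j" and jn: "j < n" for i j
  proof -
    have "xi n i (xi n j f) = dunkl n i (xi n j f) + (\<Sum>a<i. xi n j (swap a i f))"
      unfolding xi_def [of n i] using ij jn by (simp add: swap_xi)
    moreover have "xi n j (xi n i f) = xi n j (dunkl n i f) + (\<Sum>a<i. xi n j (swap a i f))"
      unfolding xi_def [of n i] by (simp add: xi_add xi_sum)
    moreover have "dunkl n i (xi n j f) = xi n j (dunkl n i f)"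
    proof -
      have "(\<Sum>b\<in>{..<j}-{i}. swap b j (dunkl n i f)) = (\<Sum>b\<in>{..<j}-{i}. dunkl n i (swap b j f))"
        using ij jn by (intro sum.cong refl) (simp add: swap_dunkl)
      then have 1: "xi n j (dunkl n i f) = dunkl n j (dunkl n i f) + dunkl n j (swap i j f)
          + (\<Sum>b\<in>{..<j}-{i}. dunkl n i (swap b j f))"
        using ij jn by (simp add: xi_def sum.remove [of "{..<j}" i] swap_dunkl)
      have 2: "dunkl n i (xi n j f) = dunkl n i (dunkl n j f) + dunkl n i (swap i j f)
          + (\<Sum>b\<in>{..<j}-{i}. dunkl n i (swap b j f))"
        using ij by (simp add: xi_def dunkl_add dunkl_sum sum.remove [of "{..<j}" i])
      show ?thesis
        using dunkl_commutator [of i n j f] ij jn unfolding 1 2 by (simp add: algebra_simps)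
    qed
    ultimately show ?thesis by simp
  qed
  show ?thesis
    using *[of i j] *[of j i] assms by (cases i j rule: linorder_cases) auto
qed

text \<open>The relation of the degenerate affine Hecke algebra. The extra \<open>f\<close> stems
  from K_{i,i+1}, which xi_{i+1} contains and xi_i does not.\<close>

lemma adjacent_swap_xi:
  assumes "Suc i < n"
  shows "swap i (Suc i) (xi n i f) = xi n (Suc i) (swap i (Suc i) f) - f"
    and "swap i (Suc i) (xi n (Suc i) f) = xi n i (swap i (Suc i) f) + f"
proof -
  have *: "swap i (Suc i) (xi n i f) = xi n (Suc i) (swap i (Suc i) f) - f" for f
    using assms by (simp add: xi_def perm_simps swap_dunkl perm_swap [of "transpose i (Suc i)"])
  show "swap i (Suc i) (xi n i f) = xi n (Suc i) (swap i (Suc i) f) - f" by (rule *)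
  show "swap i (Suc i) (xi n (Suc i) f) = xi n i (swap i (Suc i) f) + f"
    using arg_cong [OF * [of "swap i (Suc i) f"], of "swap i (Suc i)"] by (simp add: perm_diff)
qed

text \<open>Every transposition is obtained from an adjacent one by repeated conjugation with
  adjacent ones inside the range.\<close>

lemma commutes_swap_if_commutes_adjacent:
  assumes adj: "\<And>j f. lo \<le> j \<Longrightarrow> Suc j < n \<Longrightarrow> L (swap j (Suc j) f) = swap j (Suc j) (L f)"
    and "lo \<le> a" "lo \<le> b" "a < n" "b < n"
  shows "L (swap a b f) = swap a b (L f)"
proof -
  have *: "L (swap a (a + Suc d) f) = swap a (a + Suc d) (L f)" if "lo \<le> a" "a + Suc d < n" for a d f
    using that
  proof (induction d arbitrary: f)
    case 0
    then show ?case using adj by simp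
  next
    case (Suc d)
    let ?b = "a + Suc d"
    have t: "transpose a (Suc ?b) = transpose ?b (Suc ?b) \<circ> (transpose a ?b \<circ> transpose ?b (Suc ?b))"
      by (auto simp: fun_eq_iff transpose_def)
    have "swap a (Suc ?b) g = swap ?b (Suc ?b) (swap a ?b (swap ?b (Suc ?b) g))" for g
      unfolding t by (simp add: perm_comp bij_comp comp_assoc)
    then show ?case
      using Suc adj [of ?b] by simp
  qed
  consider "a = b" | d where "b = a + Suc d" | d where "a = b + Suc d"
    by (metis less_imp_Suc_add linorder_neqE_nat add_Suc_right)
  then show ?thesis
  proof cases
    case 2
    then show ?thesis using * assms by simp
  next
    case 3
    then show ?thesis using * [of b] assms swap_commute [of a b] by simp
  qed simp
qed

text \<open>The operator called Z above.\<close>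

definition xi_squares :: "nat \<Rightarrow> mpol \<Rightarrow> mpol" where
  "xi_squares n f = (\<Sum>i<n. xi n i (xi n i f))"

lemma linear_op_xi_squares: "linear_op (xi_squares n)"
  unfolding xi_squares_def [abs_def]
  by (intro linear_op_Sum linear_op_comp [OF linear_op_xi] linear_op_xi)

lemma xi_squares_xi:
  assumes "i < n"
  shows "xi_squares n (xi n i f) = xi n i (xi_squares n f)"
  using assms by (simp add: xi_squares_def xi_sum xi_commute [of _ n i])

text \<open>Passing the exchange through xi_j^2 and xi_{j+1}^2 produces the corrections -(xi_j +
  xi_{j+1}) and xi_j + xi_{j+1}, which cancel.\<close>

lemma xi_squares_adjacent_swap:
  assumes "Suc j < n"
  shows "xi_squares n (swap j (Suc j) f) = swap j (Suc j) (xi_squares n f)"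
proof -
  let ?s = "swap j (Suc j)" and ?R = "{..<n} - {j, Suc j}"
  have split: "xi_squares n g = xi n j (xi n j g) + (xi n (Suc j) (xi n (Suc j) g) + (\<Sum>i\<in>?R. xi n i (xi n i g)))" for g
  proof -
    have "{..<n} = insert j (insert (Suc j) ?R)" using assms by auto
    then show ?thesis unfolding xi_squares_def by (metis (no_types, lifting) Diff_iff finite_Diff finite_insert finite_lessThan insertCI insertE n_not_Suc_n sum.insert)
  qed
  have "(\<Sum>i\<in>?R. ?s (xi n i (xi n i f))) = (\<Sum>i\<in>?R. xi n i (xi n i (?s f)))"
  proof (rule sum.cong [OF refl])
    fix i assume "i \<in> ?R"
    then have "i < n" "j < i \<and> Suc j < i \<or> i < j \<and> i < Suc j" by auto
    then show "?s (xi n i (xi n i f)) = xi n i (xi n i (?s f))"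
      using assms by (simp add: swap_xi)
  qed
  then show ?thesis
    unfolding split using assms
    by (simp add: perm_simps adjacent_swap_xi xi_add xi_diff)
qed

lemma xi_squares_swap:
  assumes "a < n" "b < n"
  shows "xi_squares n (swap a b f) = swap a b (xi_squares n f)"
  by (rule commutes_swap_if_commutes_adjacent [where lo = 0 and n = n]) (use assms xi_squares_adjacent_swap in auto)

lemma xi_squares_perm:
  assumes "p permutes {..<n}"
  shows "xi_squares n (perm p f) = perm p (xi_squares n f)"
  using assms finite_lessThan
proof (induction p rule: permutes_induct)
  case (swap a b p)
  then have "bij p" by (blast intro: permutes_bij)
  then have "perm (transpose a b \<circ> p) g = swap a b (perm p g)" for g
    by (simp add: perm_comp)
  with swap.IH show ?case using swap.hyps by (simp only: xi_squares_swap lessThan_iff)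
qed simp

text \<open>D_0 equals xi_0, as no index is below 0, and D_i is the conjugate of D_0 by
  K_0i.\<close>

lemma xi_squares_dunkl:
  assumes "i < n"
  shows "xi_squares n (dunkl n i f) = dunkl n i (xi_squares n f)"
proof -
  have 0: "dunkl n 0 = xi n 0" by (simp add: fun_eq_iff xi_def)
  have *: "dunkl n i g = swap 0 i (xi n 0 (swap 0 i g))" for g
    using assms by (simp add: swap_dunkl flip: 0)
  show ?thesis
    unfolding * using assms by (simp add: xi_squares_swap xi_squares_xi)
qed

section \<open>Products of shifted Cherednik operators\<close>

definition xi_prod :: "nat \<Rightarrow> nat \<Rightarrow> nat list \<Rightarrow> mpol \<Rightarrow> mpol" where
  "xi_prod n c is f = foldr (\<lambda>i g. xi n i g - of_nat c * g) is f"

lemma xi_prod_simps [simp]: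
  "xi_prod n c [] f = f"
  "xi_prod n c (i # is) f = xi n i (xi_prod n c is f) - of_nat c * xi_prod n c is f"
  "xi_prod n c (is @ js) f = xi_prod n c is (xi_prod n c js f)"
  by (simp_all add: xi_prod_def)

lemma xi_prod_0 [simp]: "xi_prod n c is 0 = 0"
  by (induction "is") auto

lemma linear_op_xi_prod: "linear_op (xi_prod n c is)"
proof (induction "is")
  case Nil
  then show ?case by (simp add: linear_op_def)
next
  case (Cons i "is")
  then have "linear_op (\<lambda>f. xi n i (xi_prod n c is f) - of_nat c * xi_prod n c is f)"
    by (intro linear_op_minus linear_op_mult linear_op_comp [OF linear_op_xi])
  then show ?case by (simp add: linear_op_def)
qed

lemma xi_prod_xi:
  assumes "set is \<subseteq> {..<n}" "j < n"
  shows "xi_prod n c is (xi n j f) = xi n j (xi_prod n c is f)"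
  using assms by (induction "is") (auto simp: xi_diff xi_of_nat xi_commute [of _ n j])

lemma xi_prod_eq_0:
  assumes "set is \<subseteq> {..<n}" "j \<in> set is" "xi n j f = of_nat c * f"
  shows "xi_prod n c is f = 0"
proof -
  obtain xs ys where xs: "is = xs @ j # ys"
    using assms by (meson split_list)
  have "xi n j (xi_prod n c ys f) = of_nat c * xi_prod n c ys f"
    using assms by (simp add: xs linear_op_of_nat [OF linear_op_xi_prod] flip: xi_prod_xi)
  then show ?thesis by (simp add: xs)
qed

lemma swap_xi_prod:
  assumes "set is \<subseteq> {..<n}" "a < n" "b < n" "\<And>i. i \<in> set is \<Longrightarrow> a < i \<and> b < i \<or> i < a \<and> i < b"
  shows "swap a b (xi_prod n c is f) = xi_prod n c is (swap a b f)"
  using assms by (induction "is") (auto simp: perm_simps swap_xi)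

text \<open>An adjacent exchange meets only two factors. They carry the same shift \<open>c\<close>,
  so their product is symmetric in the two Cherednik operators and the corrections cancel.\<close>

lemma xi_prod_swap:
  assumes "lo \<le> a" "lo \<le> b" "a < n" "b < n"
  shows "xi_prod n c [lo..<n] (swap a b f) = swap a b (xi_prod n c [lo..<n] f)"
proof (rule commutes_swap_if_commutes_adjacent [OF _ assms])
  fix j f assume j: "lo \<le> j" "Suc j < n"
  have split: "[lo..<n] = [lo..<j] @ [j, Suc j] @ [Suc (Suc j)..<n]"
  proof -
    have "[lo..<j + (n - j)] = [lo..<j] @ [j..<j + (n - j)]"
      using j by (intro upt_add_eq_append)
    then show ?thesis using j by (simp add: upt_conv_Cons)
  qed
  let ?s = "swap j (Suc j)"
  have 1: "?s (xi_prod n c [lo..<j] g) = xi_prod n c [lo..<j] (?s g)" for g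
    using j by (intro swap_xi_prod) auto
  have 2: "?s (xi_prod n c [Suc (Suc j)..<n] g) = xi_prod n c [Suc (Suc j)..<n] (?s g)" for g
    using j by (intro swap_xi_prod) auto
  have 3: "?s (xi_prod n c [j, Suc j] g) = xi_prod n c [j, Suc j] (?s g)" for g
  proof -
    have "xi n (Suc j) (xi n j (?s g)) = xi n j (xi n (Suc j) (?s g))"
      using j by (simp add: xi_commute)
    then show ?thesis
      using j by (simp add: perm_simps adjacent_swap_xi xi_add xi_diff xi_of_nat) (simp add: algebra_simps)
  qed
  show "xi_prod n c [lo..<n] (?s f) = ?s (xi_prod n c [lo..<n] f)"
    unfolding split xi_prod_simps(3) 1 3 2 ..
qed

text \<open>The relations between the summands $x_J D_J f$ of a creation operator.
  For \<open>J\<close> the set of the first \<open>k\<close> indices they make \<open>q J\<close> an eigenvector of \<open>xi n i\<close> with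
  eigenvalue \<open>i - k\<close> for $i \ge k$.\<close>

definition layered :: "nat \<Rightarrow> nat \<Rightarrow> (nat set \<Rightarrow> mpol) \<Rightarrow> bool" where
  "layered n k q \<longleftrightarrow>
     (\<forall>p J. p permutes {..<n} \<longrightarrow> J \<subseteq> {..<n} \<longrightarrow> card J = k \<longrightarrow> perm p (q J) = q (p ` J)) \<and>
     (\<forall>J i. J \<subseteq> {..<n} \<longrightarrow> card J = k \<longrightarrow> i < n \<longrightarrow> i \<notin> J \<longrightarrow>
        dunkl n i (q J) = - (\<Sum>j\<in>J. q (insert i (J - {j}))))"

lemma layered_swap:
  assumes "layered n k q" "J \<subseteq> {..<n}" "card J = k" "a < n" "b < n"
  shows "swap a b (q J) = q (transpose a b ` J)"
  using assms by (auto simp: layered_def permutes_swap_id)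

text \<open>The exchanges of \<open>i\<close> with the elements of \<open>J\<close> cancel the value
  of D_i; the other \<open>i - k\<close> exchanges in xi_i fix \<open>q J\<close>.\<close>

lemma xi_layered:
  assumes q: "layered n k q" "J \<subseteq> {..<n}" "card J = k" and i: "i < n" "\<And>j. j \<in> J \<Longrightarrow> j < i"
  shows "xi n i (q J) = of_nat (i - k) * q J"
proof -
  have iJ: "i \<notin> J" and J: "J \<subseteq> {..<i}" using i by auto
  have fin: "finite J" using J finite_subset by blast
  have "(\<Sum>j<i. swap j i (q J)) = (\<Sum>j\<in>J. swap j i (q J)) + (\<Sum>j\<in>{..<i} - J. swap j i (q J))"
    using J by (metis add.commute finite_lessThan sum.subset_diff)
  also have "(\<Sum>j\<in>J. swap j i (q J)) = (\<Sum>j\<in>J. q (insert i (J - {j})))"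
  proof (rule sum.cong [OF refl])
    fix j assume j: "j \<in> J"
    then have "j < n" using q by auto
    then show "swap j i (q J) = q (insert i (J - {j}))"
      using layered_swap [OF q \<open>j < n\<close> i(1)] j iJ by (simp add: transpose_commute [of j i] transpose_image_insert)
  qed
  also have "(\<Sum>j\<in>{..<i} - J. swap j i (q J)) = (\<Sum>j\<in>{..<i} - J. q J)"
    using iJ i by (intro sum.cong refl) (auto simp: layered_swap [OF q] transpose_image_same)
  also have "\<dots> = of_nat (i - k) * q J"
    using J fin q by (simp add: card_Diff_subset)
  finally show ?thesis
    using q i iJ by (simp add: xi_def layered_def)
qed

text \<open>Exchanges of indices >= \<open>lo\<close> commute with the product, so elements of
  \<open>J\<close> can be moved down into gaps, which lowers the sum of \<open>J\<close>. Once no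
  gap is left, xi_{lo+k} has eigenvalue \<open>lo\<close> on \<open>q J\<close> and the
  corresponding factor kills it.\<close>

lemma xi_prod_layered:
  assumes q: "layered n k q" and J: "J \<subseteq> {..<n}" "card J = k" and k: "k + lo < n"
  shows "xi_prod n lo [lo..<n] (q J) = 0"
  using J
proof (induction "\<Sum>J" arbitrary: J rule: less_induct)
  case less
  have fin: "finite J" using less.prems finite_subset by blast
  show ?case
  proof (cases "\<exists>a b. lo \<le> a \<and> a < b \<and> a \<notin> J \<and> b \<in> J")
    case True
    then obtain a b where ab: "lo \<le> a" "a < b" "a \<notin> J" "b \<in> J" by blast
    then have n: "a < n" "b < n" using less.prems by auto
    define J' where "J' = transpose a b ` J"
    have J': "J' = insert a (J - {b})" using ab by (simp add: J'_def transpose_image_insert)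
    have "\<Sum>J = b + \<Sum>(J - {b})" using fin ab by (simp add: sum.remove)
    then have "\<Sum>J' < \<Sum>J" using ab fin J' by simp
    moreover have "J' \<subseteq> {..<n}" "card J' = k"
      using less.prems n ab fin card_Suc_Diff1 [of J b] unfolding J' by auto
    ultimately have "xi_prod n lo [lo..<n] (q J') = 0" using less.hyps by blast
    moreover have "q J' = swap a b (q J)"
      using layered_swap [OF q less.prems n] by (simp add: J'_def)
    ultimately have "swap a b (xi_prod n lo [lo..<n] (q J)) = 0"
      using ab n by (simp add: xi_prod_swap)
    then show ?thesis by (metis bij_transpose perm_0 swap_swap)
  next
    case False
    \<comment> \<open>Without gaps the whole interval from \<open>lo\<close> to \<open>j\<close>
      lies in \<open>J\<close>, which has \<open>k\<close> elements.\<close>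
    have "j < lo + k" if "j \<in> J" for j
    proof (rule ccontr)
      assume "\<not> j < lo + k"
      moreover have "{lo..j} \<subseteq> J"
      proof
        fix a assume "a \<in> {lo..j}"
        then show "a \<in> J" using False that by (cases "a = j") (force, meson atLeastAtMost_iff le_neq_implies_less)
      qed
      then have "card {lo..j} \<le> k" using fin less.prems card_mono by blast
      ultimately show False by simp
    qed
    then have "xi n (lo + k) (q J) = of_nat lo * q J"
      using xi_layered [OF q less.prems, of "lo + k"] k by simp
    then show ?thesis using k by (intro xi_prod_eq_0 [where j = "lo + k"]) auto
  qed
qed

section \<open>Creation operators\<close>

definition symmetric_poly :: "nat \<Rightarrow> mpol \<Rightarrow> bool" where
  "symmetric_poly n f \<longleftrightarrow> (\<forall>p. p permutes {..<n} \<longrightarrow> perm p f = f)"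

lemma symmetric_poly_swap: "symmetric_poly n f \<Longrightarrow> a < n \<Longrightarrow> b < n \<Longrightarrow> swap a b f = f"
  by (simp add: symmetric_poly_def permutes_swap_id)

lemma perm_dunkl_list:
  assumes "p permutes {..<n}"
  shows "perm p (dunkl_list n k js f) = dunkl_list n k (map p js) (perm p f)"
  using permutes_bij [OF assms]
  by (induction js arbitrary: k) (simp_all add: perm_simps perm_dunkl [OF assms])

lemma linear_op_dunkl_list: "linear_op (dunkl_list n k js)"
proof (induction js arbitrary: k)
  case Nil
  then show ?case by (simp add: linear_op_def)
next
  case (Cons j js)
  have "linear_op (\<lambda>f. dunkl n j (dunkl_list n (Suc k) js f) + of_nat k * dunkl_list n (Suc k) js f)"
    by (intro linear_op_plus linear_op_comp [OF linear_op_dunkl] linear_op_mult Cons)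
  then show ?case by (simp add: linear_op_def)
qed

text \<open>On a polynomial fixed by K_ij the commutator [D_i, D_j] reduces to D_j - D_i. The shifts
  increasing by one compensate exactly this, which explains the constants in D_J.\<close>

lemma dunkl_list_adjacent:
  assumes "symmetric_poly n f" "distinct (i # j # js)" "i < n" "j < n"
  shows "dunkl_list n k (i # j # js) f = dunkl_list n k (j # i # js) f"
proof -
  let ?g = "dunkl_list n (Suc (Suc k)) js f"
  have "swap i j ?g = dunkl_list n (Suc (Suc k)) (map (transpose i j) js) (swap i j f)"
    using assms by (intro perm_dunkl_list permutes_swap_id) auto
  moreover have "map (transpose i j) js = js"
    using assms by (intro map_idI) (auto simp: transpose_def)
  ultimately have "swap i j ?g = ?g"
    using assms by (simp add: symmetric_poly_swap)
  then have "dunkl n i (dunkl n j ?g) - dunkl n j (dunkl n i ?g) = dunkl n j ?g - dunkl n i ?g"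
    using dunkl_commutator [of i n j ?g] assms by simp
  then show ?thesis
    by (simp add: dunkl_add dunkl_of_nat algebra_simps del: of_nat_Suc) (simp add: algebra_simps)
qed

lemma dunkl_list_Cons_append:
  assumes "symmetric_poly n f" "distinct (j # xs @ ys)" "j < n" "set xs \<subseteq> {..<n}"
  shows "dunkl_list n k (xs @ j # ys) f = dunkl_list n k (j # xs @ ys) f"
  using assms
proof (induction xs arbitrary: k)
  case (Cons x xs)
  then have "dunkl_list n k ((x # xs) @ j # ys) f = dunkl_list n k (x # j # (xs @ ys)) f"
    by simp
  also have "\<dots> = dunkl_list n k (j # x # (xs @ ys)) f"
    using Cons.prems by (intro dunkl_list_adjacent) auto
  finally show ?case by simp
qed simp

lemma dunkl_list_set_eq:
  assumes "symmetric_poly n f" "distinct js" "distinct js'" "set js = set js'" "set js \<subseteq> {..<n}"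
  shows "dunkl_list n k js f = dunkl_list n k js' f"
  using assms(2-)
proof (induction js arbitrary: js' k)
  case (Cons j js)
  then obtain xs ys where js': "js' = xs @ j # ys"
    by (metis list.set_intros(1) split_list)
  have "dunkl_list n k js' f = dunkl_list n k (j # xs @ ys) f"
    unfolding js' using Cons.prems js' by (intro dunkl_list_Cons_append assms) auto
  moreover have "dunkl_list n (Suc k) js f = dunkl_list n (Suc k) (xs @ ys) f"
    using Cons.prems js' by (intro Cons.IH) auto
  ultimately show ?case by simp
qed simp

lemma dunkl_set_eq:
  assumes "symmetric_poly n f" "distinct js" "set js \<subseteq> {..<n}"
  shows "dunkl_set n (set js) f = dunkl_list n 1 js f"
  unfolding dunkl_set_def using assms by (intro dunkl_list_set_eq) auto

text \<open>A permutation destroys the sorted order chosen in \<open>dunkl_set\<close>, but on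
  symmetric polynomials the order of the factors is immaterial.\<close>

lemma perm_dunkl_set:
  assumes "symmetric_poly n f" "p permutes {..<n}" "J \<subseteq> {..<n}"
  shows "perm p (dunkl_set n J f) = dunkl_set n (p ` J) f"
proof -
  define js where "js = sorted_list_of_set J"
  have fin: "finite J" using assms(3) finite_subset by blast
  have js: "distinct js" "set js = J" using fin by (simp_all add: js_def)
  have "perm p (dunkl_set n J f) = dunkl_list n 1 (map p js) f"
    using assms by (simp add: dunkl_set_def js_def perm_dunkl_list symmetric_poly_def)
  also have "\<dots> = dunkl_set n (set (map p js)) f"
    using assms js permutes_image [OF assms(2)] permutes_inj_on [OF assms(2)]
    by (intro dunkl_set_eq [symmetric]) (auto simp: distinct_map)
  finally show ?thesis using js by simp
qed

lemma ex_permutes_image: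
  assumes "finite S" "A \<subseteq> S" "B \<subseteq> S" "card A = card B"
  shows "\<exists>p. p permutes S \<and> p ` A = B"
proof -
  have fin: "finite A" "finite B" using assms finite_subset by blast+
  obtain f where f: "bij_betw f A B"
    using fin assms(4) by (meson finite_same_card_bij)
  have "card (S - A) = card (S - B)" using assms fin by (simp add: card_Diff_subset)
  then obtain g where g: "bij_betw g (S - A) (S - B)"
    using assms(1) by (meson finite_same_card_bij finite_Diff)
  define p where "p x = (if x \<in> A then f x else if x \<in> S then g x else x)" for x
  have "bij_betw p A B" using f by (simp add: p_def cong: bij_betw_cong)
  moreover have "bij_betw p (S - A) (S - B)"
    using g by (subst bij_betw_cong [where g = g]) (auto simp: p_def)
  ultimately have "bij_betw p (A \<union> (S - A)) (B \<union> (S - B))"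
    by (rule bij_betw_combine) auto
  then have "bij_betw p S S"
    using assms(2,3) by (simp add: Un_absorb1)
  then have "p permutes S"
    using assms(2) by (intro bij_imp_permutes) (auto simp: p_def)
  with \<open>bij_betw p A B\<close> show ?thesis by (auto simp: bij_betw_def)
qed

lemma ex_permutes_image_point:
  assumes "finite S" "A \<subseteq> S" "B \<subseteq> S" "card A = card B" "a \<in> S - A" "b \<in> S - B"
  shows "\<exists>p. p permutes S \<and> p ` A = B \<and> p a = b"
proof -
  obtain p where p: "p permutes S" "p ` A = B"
    using ex_permutes_image [OF assms(1-4)] by blast
  have "p a \<in> S - B"
    using p assms by (metis DiffD1 DiffD2 DiffI image_iff permutes_in_image permutes_inj injD)
  then have "transpose (p a) b ` B = B"
    using assms by (intro transpose_image_same) auto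
  moreover have "transpose (p a) b \<circ> p permutes S"
    using p assms \<open>p a \<in> S - B\<close> by (intro permutes_compose permutes_swap_id) auto
  ultimately show ?thesis
    using p by (intro exI [of _ "transpose (p a) b \<circ> p"]) (auto simp: image_comp [symmetric])
qed

text \<open>The factors applied before D_t use only indices above \<open>t\<close>, so the
  \<open>t\<close> exchanges in xi_t fix their result. Hence xi_t - lo acts as D_t + (t -
  lo).\<close>

lemma dunkl_list_upt_eq_xi_prod:
  assumes "symmetric_poly n f" "lo \<le> t" "t \<le> n"
  shows "dunkl_list n (t - lo) [t..<n] f = xi_prod n lo [t..<n] f"
  using assms(3,2)
proof (induction t rule: inc_induct)
  case (step t)
  let ?g = "dunkl_list n (Suc t - lo) [Suc t..<n] f"
  have "swap a t ?g = ?g" if "a < t" for a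
  proof -
    have "swap a t ?g = dunkl_list n (Suc t - lo) (map (transpose a t) [Suc t..<n]) (swap a t f)"
      using that step by (intro perm_dunkl_list permutes_swap_id) auto
    moreover have "map (transpose a t) [Suc t..<n] = [Suc t..<n]"
      using that by (intro map_idI) auto
    ultimately show ?thesis using that step assms(1) by (simp add: symmetric_poly_swap)
  qed
  then have "xi n t ?g = dunkl n t ?g + of_nat t * ?g"
    by (simp add: xi_def)
  moreover have "xi_prod n lo [t..<n] f = xi n t ?g - of_nat lo * ?g"
    using step by (simp add: upt_conv_Cons)
  moreover have "dunkl_list n (t - lo) [t..<n] f = dunkl n t ?g + of_nat (t - lo) * ?g"
    using step by (simp add: upt_conv_Cons Suc_diff_le)
  moreover obtain d where "t = lo + d" using step le_Suc_ex by blast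
  ultimately show ?case
    using step by (simp add: algebra_simps)
qed simp

text \<open>Exactly \<open>m\<close> indices lie above \<open>lo = n - m - 1\<close>, and the shift
  at \<open>lo\<close> is 0. The vanishing product is thus D_lo applied to g_J for the last
  \<open>m\<close> indices; a permutation carries this case to any \<open>J\<close> and
  \<open>i\<close>.\<close>

lemma dunkl_dunkl_set_eq_0:
  assumes f: "symmetric_poly n f" and m: "m < n" and T: "xi_prod n (n - m - 1) [n - m - 1..<n] f = 0"
    and J: "J \<subseteq> {..<n}" "card J = m" and i: "i < n" "i \<notin> J"
  shows "dunkl n i (dunkl_set n J f) = 0"
proof -
  define lo where "lo = n - m - 1"
  define A where "A = {Suc lo..<n}"
  have "dunkl_list n 0 [lo..<n] f = 0"
    using dunkl_list_upt_eq_xi_prod [OF f, of lo lo] T by (simp add: lo_def)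
  moreover have "[lo..<n] = lo # [Suc lo..<n]" using m by (simp add: lo_def upt_conv_Cons)
  moreover have "dunkl_set n A f = dunkl_list n 1 [Suc lo..<n] f"
    unfolding A_def using dunkl_set_eq [OF f, of "[Suc lo..<n]"] by (simp add: subset_eq)
  ultimately have *: "dunkl n lo (dunkl_set n A f) = 0" by simp
  have "card A = card J" "A \<subseteq> {..<n}" "lo \<in> {..<n} - A"
    using J m by (auto simp: A_def lo_def)
  then obtain p where p: "p permutes {..<n}" "p ` A = J" "p lo = i"
    using ex_permutes_image_point [of "{..<n}" A J lo i] J i by auto
  have "0 = perm p (dunkl n lo (dunkl_set n A f))"
    using * permutes_bij [OF p(1)] by simp
  also have "\<dots> = dunkl n i (dunkl_set n J f)"
    using p f \<open>A \<subseteq> {..<n}\<close> by (simp add: perm_dunkl perm_dunkl_set)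
  finally show ?thesis by simp
qed

section \<open>Moving square-free monomials past Dunkl operators\<close>

lemma prod_X_insert_Diff:
  assumes "finite J" "j \<in> J" "i \<notin> J"
  shows "(\<Prod>l\<in>insert i (J - {j}). X l) = X i * (\<Prod>l\<in>J - {j}. X l)" "(\<Prod>l\<in>J. X l) = X j * (\<Prod>l\<in>J - {j}. X l)"
  using assms by (simp_all add: prod.remove)

lemma perm_prod_X: "bij p \<Longrightarrow> perm p (\<Prod>l\<in>J. X l) = (\<Prod>l\<in>p ` J. X l)"
  by (subst prod.reindex) (auto simp: perm_prod intro: inj_on_subset [OF bij_is_inj])

lemma theta_prod_X: "finite J \<Longrightarrow> theta i (\<Prod>l\<in>J. X l) = (if i \<in> J then (\<Prod>l\<in>J. X l) else 0)"
  by (induction J rule: finite_induct) (auto simp: theta_mult theta_X)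

lemma quot_mult_symmetric:
  assumes "i \<noteq> j" "swap i j h = h"
  shows "quot i j (h * f) = h * quot i j f"
proof (rule quot_eqI [OF assms(1)])
  have "(X i - X j) * (h * quot i j f) = h * (X i * (f - swap i j f))"
    by (metis mult.left_commute quot_eq assms(1))
  then show "(X i - X j) * (h * quot i j f) = X i * (h * f - swap i j (h * f))"
    using assms by (simp add: perm_mult algebra_simps)
qed

text \<open>Write x_J = x_j h with \<open>h\<close> symmetric in x_i and x_j; the asymmetry of x_j
  alone causes the correction terms.\<close>

lemma quot_prod_X_mult:
  assumes "finite J" "i \<notin> J" "j \<in> J"
  shows "quot i j ((\<Prod>l\<in>J. X l) * f) = (\<Prod>l\<in>J. X l) * quot i j f - (\<Prod>l\<in>insert i (J - {j}). X l) * swap i j f"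
    and "quot j i ((\<Prod>l\<in>J. X l) * f) = (\<Prod>l\<in>J. X l) * (quot j i f + swap i j f)"
proof -
  have ij: "i \<noteq> j" using assms by auto
  define h where "h = (\<Prod>l\<in>J - {j}. X l)"
  have J: "(\<Prod>l\<in>J. X l) = X j * h" "(\<Prod>l\<in>insert i (J - {j}). X l) = X i * h"
    using assms by (simp_all add: prod_X_insert_Diff h_def)
  have h: "swap i j h = h"
    using assms ij unfolding h_def by (simp add: perm_prod_X transpose_image_same)
  show "quot i j ((\<Prod>l\<in>J. X l) * f) = (\<Prod>l\<in>J. X l) * quot i j f - (\<Prod>l\<in>insert i (J - {j}). X l) * swap i j f"
  proof (rule quot_eqI [OF ij])
    have "(X i - X j) * ((\<Prod>l\<in>J. X l) * quot i j f - (\<Prod>l\<in>insert i (J - {j}). X l) * swap i j f)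
       = X j * h * ((X i - X j) * quot i j f) - (X i - X j) * (X i * h) * swap i j f"
      by (simp only: J) (simp add: algebra_simps)
    also have "\<dots> = X i * (X j * h * f - X i * h * swap i j f)"
      by (simp only: quot_eq [OF ij]) (simp add: algebra_simps)
    finally show "(X i - X j) * ((\<Prod>l\<in>J. X l) * quot i j f - (\<Prod>l\<in>insert i (J - {j}). X l) * swap i j f)
       = X i * ((\<Prod>l\<in>J. X l) * f - swap i j ((\<Prod>l\<in>J. X l) * f))"
      by (simp add: J perm_mult h)
  qed
  then show "quot j i ((\<Prod>l\<in>J. X l) * f) = (\<Prod>l\<in>J. X l) * (quot j i f + swap i j f)"
    using ij by (simp only: quot_flip [OF ij]) (simp add: J perm_mult h algebra_simps)
qed

text \<open>If D_i kills \<open>f\<close>, only the sum of corrections remains; this is the sum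
  occurring in \<open>layered\<close>.\<close>

lemma dunkl_prod_X_mult_notin:
  assumes "J \<subseteq> {..<n}" "i < n" "i \<notin> J"
  shows "dunkl n i ((\<Prod>l\<in>J. X l) * f) = (\<Prod>l\<in>J. X l) * dunkl n i f
    - (\<Sum>j\<in>J. (\<Prod>l\<in>insert i (J - {j}). X l) * swap i j f)"
proof -
  let ?x = "\<Prod>l\<in>J. X l" and ?R = "{..<n} - {i} - J"
  have fin: "finite J" using assms finite_subset by blast
  have s: "{..<n} - {i} = J \<union> ?R" using assms by auto
  have split: "(\<Sum>j\<in>{..<n} - {i}. g j) = (\<Sum>j\<in>J. g j) + (\<Sum>j\<in>?R. g j)" for g :: "nat \<Rightarrow> mpol"
    by (subst s, subst sum.union_disjoint) (use fin in auto)
  have "(\<Sum>j\<in>?R. quot i j (?x * f)) = (\<Sum>j\<in>?R. ?x * quot i j f)"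
    using assms by (intro sum.cong refl quot_mult_symmetric) (auto simp: perm_prod_X transpose_image_same)
  moreover have "(\<Sum>j\<in>J. quot i j (?x * f)) = (\<Sum>j\<in>J. ?x * quot i j f - (\<Prod>l\<in>insert i (J - {j}). X l) * swap i j f)"
    using assms fin by (intro sum.cong refl quot_prod_X_mult)
  ultimately show ?thesis
    unfolding dunkl_eq split using fin assms
    by (simp add: theta_mult theta_prod_X sum_subtractf sum_distrib_left algebra_simps)
qed

lemma dunkl_prod_X_mult_in:
  assumes "J \<subseteq> {..<n}" "i \<in> J"
  shows "dunkl n i ((\<Prod>l\<in>J. X l) * f) = (\<Prod>l\<in>J. X l) * (dunkl n i f + const alpha * f + (\<Sum>j\<in>{..<n} - J. swap j i f))"
proof -
  let ?x = "\<Prod>l\<in>J. X l" and ?R = "{..<n} - J"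
  have fin: "finite J" using assms finite_subset by blast
  have s: "{..<n} - {i} = (J - {i}) \<union> ?R" using assms by auto
  have split: "(\<Sum>j\<in>{..<n} - {i}. g j) = (\<Sum>j\<in>J - {i}. g j) + (\<Sum>j\<in>?R. g j)" for g :: "nat \<Rightarrow> mpol"
    by (subst s, subst sum.union_disjoint) (use fin in auto)
  have "(\<Sum>j\<in>J - {i}. quot i j (?x * f)) = (\<Sum>j\<in>J - {i}. ?x * quot i j f)"
    using assms by (intro sum.cong refl quot_mult_symmetric) (auto simp: perm_prod_X transpose_image_same)
  moreover have "(\<Sum>j\<in>?R. quot i j (?x * f)) = (\<Sum>j\<in>?R. ?x * (quot i j f + swap j i f))"
    using assms fin by (intro sum.cong refl quot_prod_X_mult(2)) auto
  ultimately show ?thesis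
    unfolding dunkl_eq split using fin assms
    by (simp add: theta_mult theta_prod_X sum.distrib sum_distrib_left algebra_simps)
qed

definition creation_summand :: "nat \<Rightarrow> mpol \<Rightarrow> nat set \<Rightarrow> mpol" where
  "creation_summand n f J = (\<Prod>j\<in>J. X j) * dunkl_set n J f"

lemma creation_eq: "creation n m f = (\<Sum>J | J \<subseteq> {..<n} \<and> card J = m. creation_summand n f J)"
  by (simp add: creation_def creation_summand_def)

lemma perm_creation_summand:
  assumes "symmetric_poly n f" "p permutes {..<n}" "J \<subseteq> {..<n}"
  shows "perm p (creation_summand n f J) = creation_summand n f (p ` J)"
  using assms permutes_bij [OF assms(2)]
  by (simp add: creation_summand_def perm_mult perm_prod_X perm_dunkl_set)

text \<open>The vanishing of \<open>xi_prod\<close> turns into D_i g_J = 0, and K_ij carries g_J to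
  g of the set in which \<open>j\<close> is replaced by \<open>i\<close>.\<close>

lemma layered_creation_summand:
  assumes f: "symmetric_poly n f" and T: "m < n \<Longrightarrow> xi_prod n (n - m - 1) [n - m - 1..<n] f = 0"
  shows "layered n m (creation_summand n f)"
  unfolding layered_def
proof (intro conjI allI impI)
  fix J i assume J: "J \<subseteq> {..<n}" "card J = m" and i: "i < n" "i \<notin> J"
  have "card J < card {..<n}"
    using J i by (intro psubset_card_mono) auto
  then have 0: "dunkl n i (dunkl_set n J f) = 0"
    using J i by (intro dunkl_dunkl_set_eq_0 [OF f _ T]) auto
  have "swap i j (dunkl_set n J f) = dunkl_set n (insert i (J - {j})) f" if "j \<in> J" for j
  proof -
    have "j < n" using that J by auto
    then show ?thesis
      using J i that by (simp add: perm_dunkl_set [OF f] permutes_swap_id transpose_image_insert)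
  qed
  then show "dunkl n i (creation_summand n f J) = - (\<Sum>j\<in>J. creation_summand n f (insert i (J - {j})))"
    using J i by (simp add: creation_summand_def dunkl_prod_X_mult_notin 0)
qed (use perm_creation_summand [OF f] in auto)

lemma symmetric_creation:
  assumes f: "symmetric_poly n f"
  shows "symmetric_poly n (creation n m f)"
  unfolding symmetric_poly_def
proof (intro allI impI)
  fix p assume p: "p permutes {..<n}"
  let ?A = "{J. J \<subseteq> {..<n} \<and> card J = m}"
  have inj: "inj_on ((`) p) ?A"
    using permutes_inj [OF p] by (auto simp: inj_on_def inj_image_eq_iff)
  have "(`) p ` ?A \<subseteq> ?A"
    using permutes_image [OF p] permutes_inj [OF p] by (auto simp: card_image inj_on_subset)
  then have "(`) p ` ?A = ?A"
    using inj by (intro card_subset_eq) (auto simp: card_image)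
  have "perm p (creation n m f) = (\<Sum>J\<in>?A. creation_summand n f (p ` J))"
    unfolding creation_eq using permutes_bij [OF p]
    by (simp add: perm_sum) (intro sum.cong refl, auto simp: perm_creation_summand [OF f p])
  also have "\<dots> = (\<Sum>J\<in>(`) p ` ?A. creation_summand n f J)"
    using inj by (simp add: sum.reindex)
  also have "\<dots> = creation n m f"
    unfolding \<open>(`) p ` ?A = ?A\<close> creation_eq ..
  finally show "perm p (creation n m f) = creation n m f" .
qed

section \<open>Degree operator and raising operator\<close>

definition euler :: "nat \<Rightarrow> mpol \<Rightarrow> mpol" where
  "euler n f = (\<Sum>i<n. theta i f)"

lemma linear_op_euler: "linear_op (euler n)"
  unfolding euler_def [abs_def] by (intro linear_op_Sum linear_op_theta)

lemma euler_quot: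
  assumes "i < n" "j < n" "i \<noteq> j"
  shows "euler n (quot i j f) = quot i j (euler n f)"
proof -
  have split: "euler n g = (theta i g + theta j g) + (\<Sum>k\<in>{..<n} - {i, j}. theta k g)" for g
  proof -
    have "{..<n} = insert i (insert j ({..<n} - {i, j}))" using assms by auto
    then show ?thesis
      unfolding euler_def using assms
      by (metis (no_types, lifting) Diff_iff add.assoc finite_Diff finite_lessThan finite_insert insert_iff sum.insert)
  qed
  have "(\<Sum>k\<in>{..<n} - {i, j}. theta k (quot i j f)) = (\<Sum>k\<in>{..<n} - {i, j}. quot i j (theta k f))"
    using assms by (intro sum.cong refl theta_quot) auto
  then show ?thesis
    unfolding split
    by (simp add: theta_plus_quot assms linear_op_add [OF linear_op_quot] linear_op_sum [OF linear_op_quot])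
qed

lemma euler_dunkl:
  assumes "i < n"
  shows "euler n (dunkl n i f) = dunkl n i (euler n f)"
proof -
  have "euler n (theta i f) = theta i (euler n f)"
    by (simp add: euler_def linear_op_sum [OF linear_op_theta] theta_commute [of i])
  moreover have "(\<Sum>j\<in>{..<n} - {i}. euler n (quot i j f)) = (\<Sum>j\<in>{..<n} - {i}. quot i j (euler n f))"
    using assms by (intro sum.cong refl euler_quot) auto
  ultimately show ?thesis
    unfolding dunkl_eq
    by (simp add: linear_op_add [OF linear_op_euler] linear_op_const [OF linear_op_euler] linear_op_sum [OF linear_op_euler])
qed

lemma dunkl_list_commutes:
  assumes "linear_op L" "set js \<subseteq> {..<n}" "\<And>i f. i < n \<Longrightarrow> L (dunkl n i f) = dunkl n i (L f)"
  shows "L (dunkl_list n k js f) = dunkl_list n k js (L f)"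
  using assms(2)
  by (induction js arbitrary: k)
     (simp_all add: assms(3) linear_op_add [OF assms(1)] linear_op_of_nat [OF assms(1)] del: of_nat_Suc)

lemma dunkl_set_commutes:
  assumes "linear_op L" "J \<subseteq> {..<n}" "\<And>i f. i < n \<Longrightarrow> L (dunkl n i f) = dunkl n i (L f)"
  shows "L (dunkl_set n J f) = dunkl_set n J (L f)"
proof -
  have "finite J" using assms(2) finite_subset by blast
  then show ?thesis
    unfolding dunkl_set_def using assms by (intro dunkl_list_commutes) auto
qed

lemma linear_op_dunkl_set: "linear_op (dunkl_set n J)"
  unfolding dunkl_set_def by (rule linear_op_dunkl_list)

lemma sum_off_diagonal:
  fixes g :: "nat \<Rightarrow> nat \<Rightarrow> 'a::comm_monoid_add"
  shows "(\<Sum>i<n. \<Sum>j\<in>{..<n} - {i}. g i j) = (\<Sum>i<n. \<Sum>j<i. g i j + g j i)"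
proof (induction n)
  case (Suc n)
  have "(\<Sum>j\<in>{..<Suc n} - {i}. g i j) = g i n + (\<Sum>j\<in>{..<n} - {i}. g i j)" if "i < n" for i
  proof -
    have "{..<Suc n} - {i} = insert n ({..<n} - {i})" using that by auto
    then show ?thesis by simp
  qed
  then have "(\<Sum>i<n. \<Sum>j\<in>{..<Suc n} - {i}. g i j) = (\<Sum>i<n. g i n + (\<Sum>j\<in>{..<n} - {i}. g i j))"
    by (intro sum.cong refl) auto
  moreover have "{..<Suc n} - {n} = {..<n}" by auto
  ultimately have "(\<Sum>i<Suc n. \<Sum>j\<in>{..<Suc n} - {i}. g i j)
      = (\<Sum>i<n. g i n + (\<Sum>j\<in>{..<n} - {i}. g i j)) + (\<Sum>j<n. g n j)"
    by (simp only: sum.lessThan_Suc)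
  also have "\<dots> = (\<Sum>i<n. \<Sum>j<i. g i j + g j i) + (\<Sum>j<n. g n j + g j n)"
    by (simp only: sum.distrib [of "\<lambda>i. g i n"] Suc) (simp only: sum.distrib add_ac)
  finally show ?case by (simp only: sum.lessThan_Suc)
qed simp

text \<open>The two divided differences of a pair add up to 1 - K_ij, and K_ij is cancelled by the
  exchange in the larger xi. Each pair contributes 1 to the constant.\<close>

lemma sum_xi: "(\<Sum>i<n. xi n i f) = const alpha * euler n f + of_nat (\<Sum>i<n. i) * f"
proof -
  have "(\<Sum>i<n. \<Sum>j\<in>{..<n} - {i}. quot i j f) = (\<Sum>i<n. \<Sum>j<i. f - swap j i f)"
    unfolding sum_off_diagonal
  proof (intro sum.cong refl)
    fix i j :: nat assume "j \<in> {..<i}"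
    then show "quot i j f + quot j i f = f - swap j i f"
      using quot_flip [of j i f] by simp
  qed
  then show ?thesis
    by (simp add: xi_def dunkl_eq euler_def sum.distrib sum_distrib_left sum_subtractf sum_distrib_right)
qed

text \<open>Addition of \<open>m\<close> modulo \<open>n\<close>, by which the last \<open>m\<close>
  indices come first.\<close>

definition rotation :: "nat \<Rightarrow> nat \<Rightarrow> nat \<Rightarrow> nat" where
  "rotation n m i = (if i < n - m then i + m else if i < n then i - (n - m) else i)"

lemma rotation_permutes:
  assumes "m \<le> n"
  shows "rotation n m permutes {..<n}"
proof (rule bij_imp_permutes)
  show "bij_betw (rotation n m) {..<n} {..<n}"
    by (rule bij_betwI [where g = "rotation n (n - m)"]) (use assms in \<open>auto simp: rotation_def\<close>)
qed (auto simp: rotation_def)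

text \<open>Knop and Sahi's raising operator, which intertwines the operators \<open>xi\<close> up to a shift by
  \<open>alpha\<close>, applied \<open>m\<close> times.\<close>

definition raising :: "nat \<Rightarrow> nat \<Rightarrow> mpol \<Rightarrow> mpol" where
  "raising n m f = (\<Prod>j<m. X j) * perm (rotation n m) f"

lemma linear_op_raising: "m \<le> n \<Longrightarrow> linear_op (raising n m)"
  unfolding raising_def [abs_def]
  by (intro linear_op_mult linear_op_perm permutes_bij [OF rotation_permutes])

text \<open>Commuting x_0 ... x_{m-1} past D_i yields \<open>alpha\<close> and the exchanges with
  indices >= \<open>m\<close>. Together with those below \<open>i\<close> they are the rotated
  exchanges of xi_{n-m+i}.\<close>

lemma xi_raising_low:
  assumes m: "m \<le> n" and i: "i < m"
  shows "xi n i (raising n m f) = raising n m (xi n (n - m + i) f + const alpha * f)"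
proof -
  define r c g x where "r = n - m" and "c = rotation n m" and "g = perm c f" and "x = (\<Prod>j<m. X j)"
  have c: "c permutes {..<n}" unfolding c_def using m by (rule rotation_permutes)
  note b = permutes_bij [OF c]
  have ci: "c (r + i) = i" using assms by (auto simp: c_def r_def rotation_def)
  have "perm c (xi n (r + i) f) = dunkl n i g + (\<Sum>j<r + i. swap (c j) i g)"
    using c by (simp add: xi_def perm_add perm_sum b perm_dunkl perm_swap ci g_def)
  also have "(\<Sum>j<r + i. swap (c j) i g) = (\<Sum>j\<in>c ` {..<r + i}. swap j i g)"
    using b by (subst sum.reindex) (auto intro: inj_on_subset [OF bij_is_inj])
  also have "c ` {..<r + i} = {m..<n} \<union> {..<i}"
  proof
    show "c ` {..<r + i} \<subseteq> {m..<n} \<union> {..<i}"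
      using assms by (auto simp: c_def r_def rotation_def)
    show "{m..<n} \<union> {..<i} \<subseteq> c ` {..<r + i}"
    proof
      fix j assume "j \<in> {m..<n} \<union> {..<i}"
      then have "j = c (if m \<le> j then j - m else j + r)" "(if m \<le> j then j - m else j + r) < r + i"
        using assms by (auto simp: c_def r_def rotation_def)
      then show "j \<in> c ` {..<r + i}" by blast
    qed
  qed
  also have "(\<Sum>j\<in>{m..<n} \<union> {..<i}. swap j i g) = (\<Sum>j\<in>{m..<n}. swap j i g) + (\<Sum>j<i. swap j i g)"
    using i by (intro sum.union_disjoint) auto
  finally have 1: "perm c (xi n (r + i) f) = dunkl n i g + (\<Sum>j\<in>{m..<n}. swap j i g) + (\<Sum>j<i. swap j i g)"
    by (simp add: add_ac)
  have "(\<Sum>j<i. swap j i (x * g)) = (\<Sum>j<i. x * swap j i g)"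
    using i by (intro sum.cong refl) (auto simp: perm_mult x_def perm_prod_X transpose_image_same)
  moreover have "{..<n} - {..<m} = {m..<n}" by auto
  then have "dunkl n i (x * g) = x * (dunkl n i g + const alpha * g + (\<Sum>j\<in>{m..<n}. swap j i g))"
    using dunkl_prod_X_mult_in [of "{..<m}" n i g] assms by (simp add: x_def)
  ultimately have "xi n i (x * g) = x * (perm c (xi n (r + i) f) + const alpha * g)"
    unfolding 1 by (simp add: xi_def sum_distrib_left algebra_simps)
  then show ?thesis
    using b by (simp add: raising_def x_def g_def c_def r_def perm_add perm_mult)
qed

text \<open>The exchanges with the first \<open>m\<close> indices cancel the corrections from
  commuting the monomial past D_{m+i}.\<close>

lemma xi_raising_high:
  assumes m: "m \<le> n" and i: "i < n - m"
  shows "xi n (m + i) (raising n m f) = raising n m (xi n i f)"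
proof -
  define c g x where "c = rotation n m" and "g = perm c f" and "x = (\<Prod>j<m. X j)"
  have c: "c permutes {..<n}" unfolding c_def using m by (rule rotation_permutes)
  note b = permutes_bij [OF c]
  have ci: "c j = m + j" if "j \<le> i" for j using assms that by (auto simp: c_def rotation_def)
  have "perm c (xi n i f) = dunkl n (m + i) g + (\<Sum>j<i. swap (m + j) (m + i) g)"
    using c by (simp add: xi_def perm_add perm_sum b perm_dunkl perm_swap ci g_def)
  also have "(\<Sum>j<i. swap (m + j) (m + i) g) = (\<Sum>j\<in>{m..<m + i}. swap j (m + i) g)"
    by (rule sum.reindex_bij_witness [of _ "\<lambda>j. j - m" "\<lambda>j. m + j"]) auto
  finally have 1: "perm c (xi n i f) = dunkl n (m + i) g + (\<Sum>j\<in>{m..<m + i}. swap j (m + i) g)" .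
  have "(\<Sum>j<m + i. swap j (m + i) (x * g)) = (\<Sum>j<m. swap j (m + i) (x * g)) + (\<Sum>j\<in>{m..<m + i}. swap j (m + i) (x * g))"
    by (subst sum.union_disjoint [symmetric]) (auto intro!: sum.cong)
  also have "(\<Sum>j\<in>{m..<m + i}. swap j (m + i) (x * g)) = (\<Sum>j\<in>{m..<m + i}. x * swap j (m + i) g)"
    by (intro sum.cong refl) (auto simp: perm_mult x_def perm_prod_X transpose_image_same)
  also have "(\<Sum>j<m. swap j (m + i) (x * g)) = (\<Sum>j<m. (\<Prod>l\<in>insert (m + i) ({..<m} - {j}). X l) * swap (m + i) j g)"
    by (intro sum.cong refl) (auto simp: perm_mult x_def perm_prod_X swap_commute [of _ "m + i"]
        transpose_commute [of _ "m + i"] transpose_image_insert)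
  finally have "xi n (m + i) (x * g) = x * perm c (xi n i f)"
    unfolding 1 using dunkl_prod_X_mult_notin [of "{..<m}" n "m + i" g] assms
    by (simp add: xi_def sum_distrib_left algebra_simps flip: x_def)
  then show ?thesis
    by (simp add: raising_def x_def g_def c_def)
qed

text \<open>Only the last \<open>m\<close> operators are shifted by \<open>alpha\<close>; expanding
  their squares brings in their sum.\<close>

lemma xi_squares_raising:
  assumes m: "m \<le> n"
  shows "xi_squares n (raising n m f) = raising n m (xi_squares n f
    + const (2 * alpha) * (\<Sum>i\<in>{n - m..<n}. xi n i f) + const (of_nat m * alpha\<^sup>2) * f)"
proof -
  define r where "r = n - m"
  have n: "n = m + r" "n = r + m" using m by (auto simp: r_def)
  have split: "(\<Sum>i<a + b. g i) = (\<Sum>i<a. g i) + (\<Sum>i<b. g (a + i))" for a b and g :: "nat \<Rightarrow> mpol"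
    by (induction b) (simp_all add: add_ac)
  have high: "(\<Sum>i\<in>{n - m..<n}. xi n i f) = (\<Sum>i<m. xi n (r + i) f)"
    unfolding r_def using m by (intro sum.reindex_bij_witness [of _ "\<lambda>i. n - m + i" "\<lambda>i. i - (n - m)"]) auto
  have "xi_squares n (raising n m f) = (\<Sum>i<m. xi n i (xi n i (raising n m f))) + (\<Sum>i<r. xi n (m + i) (xi n (m + i) (raising n m f)))"
    unfolding xi_squares_def using split [of "\<lambda>i. xi n i (xi n i (raising n m f))" m r] n(1) by simp
  also have "(\<Sum>i<r. xi n (m + i) (xi n (m + i) (raising n m f))) = (\<Sum>i<r. raising n m (xi n i (xi n i f)))"
    using m by (intro sum.cong refl) (auto simp: xi_raising_high r_def)
  also have "(\<Sum>i<m. xi n i (xi n i (raising n m f)))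
      = (\<Sum>i<m. raising n m (xi n (r + i) (xi n (r + i) f) + const (2 * alpha) * xi n (r + i) f + const (alpha\<^sup>2) * f))"
  proof (intro sum.cong refl)
    fix i assume "i \<in> {..<m}"
    then have "xi n i (xi n i (raising n m f)) = raising n m
       (xi n (r + i) (xi n (r + i) f + const alpha * f) + const alpha * (xi n (r + i) f + const alpha * f))"
      using m by (simp add: xi_raising_low r_def)
    also have "xi n (r + i) (xi n (r + i) f + const alpha * f) + const alpha * (xi n (r + i) f + const alpha * f)
        = xi n (r + i) (xi n (r + i) f) + const (2 * alpha) * xi n (r + i) f + const (alpha\<^sup>2) * f"
      by (simp only: xi_add xi_const power2_eq_square mult_2 const_add const_mult distrib_left distrib_right mult.assoc add_ac)
    finally show "xi n i (xi n i (raising n m f)) = raising n m (xi n (r + i) (xi n (r + i) f)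
      + const (2 * alpha) * xi n (r + i) f + const (alpha\<^sup>2) * f)" .
  qed
  also have "\<dots> + (\<Sum>i<r. raising n m (xi n i (xi n i f))) = raising n m (
     ((\<Sum>i<r. xi n i (xi n i f)) + (\<Sum>i<m. xi n (r + i) (xi n (r + i) f)))
      + const (2 * alpha) * (\<Sum>i<m. xi n (r + i) f) + const (of_nat m * alpha\<^sup>2) * f)"
    by (simp only: linear_op_sum [OF linear_op_raising [OF m], symmetric]
          linear_op_add [OF linear_op_raising [OF m], symmetric] sum.distrib sum_distrib_left [symmetric] sum_constant card_lessThan
          const_mult [of "of_nat m"] const_of_nat mult_ac add_ac)
  also have "(\<Sum>i<r. xi n i (xi n i f)) + (\<Sum>i<m. xi n (r + i) (xi n (r + i) f)) = xi_squares n f"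
    unfolding xi_squares_def using split [of "\<lambda>i. xi n i (xi n i f)" r m] n(2) by simp
  finally show ?thesis by (simp add: high)
qed

text \<open>The additional sum over the last \<open>m\<close> operators xi_i does not act by a
  scalar in general, but it does on g_J for \<open>J\<close> the last \<open>m\<close> indices.
  Raising is applied to that polynomial only.\<close>

lemma xi_squares_creation:
  assumes m: "m \<le> n" and f: "symmetric_poly n f"
    and T: "m < n \<Longrightarrow> xi_prod n (n - m - 1) [n - m - 1..<n] f = 0"
    and e: "xi_squares n f = const e * f" and d: "euler n f = of_nat d * f"
  shows "xi_squares n (creation n m f) = const (e + 2 * alpha * (alpha * of_nat d + of_nat (\<Sum>i\<in>{n - m..<n}. i))
     + of_nat m * alpha\<^sup>2) * creation n m f" (is "_ = const ?e' * _")
proof -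
  define r where "r = n - m"
  define h where "h = dunkl_set n {r..<n} f"
  have r: "{r..<n} \<subseteq> {..<n}" "card {r..<n} = m" using m by (auto simp: r_def)
  have 1: "xi_squares n h = const e * h"
    by (simp add: h_def dunkl_set_commutes [OF linear_op_xi_squares r(1)] xi_squares_dunkl e
          linear_op_const [OF linear_op_dunkl_set])
  have 2: "euler n h = of_nat d * h"
    by (simp add: h_def dunkl_set_commutes [OF linear_op_euler r(1)] euler_dunkl d
          linear_op_of_nat [OF linear_op_dunkl_set])
  \<comment> \<open>D_i annihilates \<open>h\<close>, and each of the \<open>i\<close> exchanges in
    xi_i maps the last \<open>m\<close> indices to themselves.\<close>
  have 3: "xi n i h = of_nat i * h" if "i < r" for i
  proof -
    have "dunkl n i h = 0"
      unfolding h_def using that r by (intro dunkl_dunkl_set_eq_0 [OF f _ T]) (auto simp: r_def)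
    moreover have "swap j i h = h" if "j < i" for j
    proof -
      have "swap j i h = dunkl_set n (transpose j i ` {r..<n}) f"
        unfolding h_def using that \<open>i < r\<close> r by (intro perm_dunkl_set [OF f] permutes_swap_id) (auto simp: r_def)
      also have "transpose j i ` {r..<n} = {r..<n}" using that \<open>i < r\<close> by (intro transpose_image_same) auto
      finally show ?thesis by (simp add: h_def)
    qed
    ultimately show ?thesis by (simp add: xi_def)
  qed
  have low_high: "(\<Sum>i<n. g i) = (\<Sum>i<r. g i) + (\<Sum>i\<in>{r..<n}. g i)" for g :: "nat \<Rightarrow> 'a::comm_monoid_add"
    by (subst sum.union_disjoint [symmetric]) (use m in \<open>auto simp: r_def intro!: sum.cong\<close>)
  \<comment> \<open>The high part is the total, known from the degree, minus the low part just
    computed.\<close>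
  have "(\<Sum>i<r. xi n i h) + (\<Sum>i\<in>{r..<n}. xi n i h) = const alpha * of_nat d * h + of_nat (\<Sum>i<n. i) * h"
    using sum_xi [of n h] by (simp add: 2 low_high mult.assoc)
  then have "(\<Sum>i\<in>{r..<n}. xi n i h) = (const alpha * of_nat d + of_nat (\<Sum>i\<in>{r..<n}. i)) * h"
    by (simp add: 3 low_high algebra_simps sum_distrib_left)
  then have "xi_squares n (raising n m h) = raising n m (const ?e' * h)"
    unfolding xi_squares_raising [OF m] 1
    by (simp add: const_add const_mult const_of_nat const_sum algebra_simps flip: r_def)
  moreover have "raising n m h = creation_summand n f {..<m}"
  proof -
    have "rotation n m ` {r..<n} = {..<m}"
    proof
      show "rotation n m ` {r..<n} \<subseteq> {..<m}" using m by (auto simp: rotation_def r_def)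
      show "{..<m} \<subseteq> rotation n m ` {r..<n}"
      proof
        fix j assume "j \<in> {..<m}"
        then have "j = rotation n m (j + r)" "j + r \<in> {r..<n}" using m by (auto simp: rotation_def r_def)
        then show "j \<in> rotation n m ` {r..<n}" by blast
      qed
    qed
    then show ?thesis
      by (simp add: raising_def h_def creation_summand_def perm_dunkl_set [OF f rotation_permutes [OF m] r(1)])
  qed
  ultimately have 4: "xi_squares n (creation_summand n f {..<m}) = const ?e' * creation_summand n f {..<m}"
    by (metis linear_op_const [OF linear_op_raising [OF m]])
  \<comment> \<open>The other summands are permuted copies of this one, and permutations commute
    with \<open>xi_squares\<close>.\<close>
  have "xi_squares n (creation_summand n f J) = const ?e' * creation_summand n f J" if J: "J \<subseteq> {..<n}" "card J = m" for J
  proof -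
    obtain p where p: "p permutes {..<n}" "p ` {..<m} = J"
      using ex_permutes_image [of "{..<n}" "{..<m}" J] J m by auto
    have "perm p (creation_summand n f {..<m}) = creation_summand n f J"
      using perm_creation_summand [OF f p(1), of "{..<m}"] p m by auto
    then show ?thesis
      using 4 xi_squares_perm [OF p(1), of "creation_summand n f {..<m}"] permutes_bij [OF p(1)]
      by (simp add: perm_mult)
  qed
  then show ?thesis
    by (simp add: creation_eq linear_op_sum [OF linear_op_xi_squares] sum_distrib_left)
qed

section \<open>Dominance and square-free coefficients\<close>

definition indicator_exp :: "nat set \<Rightarrow> exponent" where
  "indicator_exp J = (\<Sum>j\<in>J. single j 1)"

lemma lookup_indicator_exp: "finite J \<Longrightarrow> lookup (indicator_exp J) i = (if i \<in> J then 1 else 0)"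
  by (simp add: indicator_exp_def lookup_sum lookup_single when_def)

lemma prod_X_eq_single: "finite J \<Longrightarrow> (\<Prod>j\<in>J. X j) = single (indicator_exp J) 1"
  by (induction J rule: finite_induct) (simp_all add: indicator_exp_def X_def mult_single)

lemma lookup_single_mult_add: "lookup (single e 1 * (f :: mpol)) (e + a) = lookup f a"
proof -
  have "single e 1 * f = (\<Sum>b\<in>keys f. const (lookup f b) * (single e 1 * single b 1))"
    by (rule linear_op_expand [OF linear_op_multl])
  then have "lookup (single e 1 * f) (e + a) = (\<Sum>b\<in>keys f. if b = a then lookup f b else 0)"
    by (simp add: lookup_sum mult_single lookup_single when_def if_distrib cong: if_cong)
  then show ?thesis by (simp add: in_keys_iff)
qed

lemma keys_single_mult: "b \<in> keys (single e 1 * (f :: mpol)) \<Longrightarrow> \<exists>a\<in>keys f. b = e + a"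
  using keys_mult [of "single e 1" f] by (auto split: if_splits)

text \<open>Satisfied by the monomials \<open>b\<close> of \<open>quot i j\<close> applied to the
  monomial \<open>a\<close>: they lie between \<open>a\<close> and its mirror image under K_ij, and
  the numerator x_i makes them divisible by x_i.\<close>

definition exchange :: "nat \<Rightarrow> nat \<Rightarrow> exponent \<Rightarrow> exponent \<Rightarrow> bool" where
  "exchange i j a b \<longleftrightarrow> (\<forall>k. k \<noteq> i \<longrightarrow> k \<noteq> j \<longrightarrow> lookup b k = lookup a k) \<and>
     lookup b i + lookup b j = lookup a i + lookup a j \<and> 0 < lookup b i \<and>
     lookup b i \<le> max (lookup a i) (lookup a j) \<and> lookup b j \<le> max (lookup a i) (lookup a j)"

lemma keys_sum_subset: "keys (sum f A) \<subseteq> (\<Union>i\<in>A. keys (f i))"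
proof
  fix a assume "a \<in> keys (sum f A)"
  then have "(\<Sum>i\<in>A. lookup (f i) a) \<noteq> 0" by (simp add: in_keys_iff lookup_sum)
  then obtain i where "i \<in> A" "lookup (f i) a \<noteq> 0" by (meson sum.neutral)
  then show "a \<in> (\<Union>i\<in>A. keys (f i))" by (auto simp: in_keys_iff)
qed

lemma exchangeI:
  assumes "i \<noteq> j" "x + y = lookup a i + lookup a j" "0 < x" "x \<le> max (lookup a i) (lookup a j)" "y \<le> max (lookup a i) (lookup a j)"
  shows "exchange i j a (Poly_Mapping.update i 0 (Poly_Mapping.update j 0 a) + single i x + single j y)"
  using assms by (simp add: exchange_def lookup_add lookup_update lookup_single)

lemma keys_quot_exp:
  assumes "i \<noteq> j" "b \<in> keys (quot_exp i j a)"
  shows "exchange i j a b"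
proof -
  define p q c where "p = lookup a i" and "q = lookup a j"
    and "c = Poly_Mapping.update i 0 (Poly_Mapping.update j 0 a)"
  have *: "\<exists>s<m. b = g s" if "b \<in> keys (\<Sum>s<m. single (g s) (1::ratfun))" for g and m :: nat
    using subsetD [OF keys_sum_subset that] by auto
  show ?thesis
  proof (cases "q \<le> p")
    case True
    then have eq: "quot_exp i j a = (\<Sum>s<p - q. single (c + single i (q + 1 + s) + single j (p - 1 - s)) 1)"
      by (simp add: quot_exp_def p_def q_def c_def Let_def)
    have "\<exists>s<p - q. b = c + single i (q + 1 + s) + single j (p - 1 - s)"
      using assms(2) unfolding eq by (rule *)
    then obtain s where "s < p - q" "b = c + single i (q + 1 + s) + single j (p - 1 - s)"
      by blast
    then show ?thesis
      unfolding c_def using assms(1) by (simp only:) (rule exchangeI; simp add: p_def q_def)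
  next
    case False
    then have eq: "- quot_exp i j a = (\<Sum>s<q - p. single (c + single i (p + 1 + s) + single j (q - 1 - s)) 1)"
      by (simp add: quot_exp_def p_def q_def c_def Let_def)
    have "b \<in> keys (- quot_exp i j a)"
      using assms(2) by (simp add: in_keys_iff)
    then have "\<exists>s<q - p. b = c + single i (p + 1 + s) + single j (q - 1 - s)"
      unfolding eq by (rule *)
    then obtain s where "s < q - p" "b = c + single i (p + 1 + s) + single j (q - 1 - s)"
      by blast
    then show ?thesis
      unfolding c_def using assms(1) by (simp only:) (rule exchangeI; simp add: p_def q_def)
  qed
qed

lemma keys_quot:
  assumes "i \<noteq> j" "b \<in> keys (quot i j f)"
  shows "\<exists>a\<in>keys f. exchange i j a b"
proof -
  have "b \<in> (\<Union>a\<in>keys f. keys (const (lookup f a) * quot_exp i j a))"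
    using assms(2) unfolding quot_expand [OF assms(1)] by (rule subsetD [OF keys_sum_subset])
  then obtain a where a: "a \<in> keys f" "b \<in> keys (const (lookup f a) * quot_exp i j a)"
    by blast
  then have "b \<in> keys (quot_exp i j a)" by (simp add: in_keys_iff)
  with a(1) show ?thesis using keys_quot_exp [OF assms(1)] by blast
qed

lemma keys_dunkl:
  assumes "b \<in> keys (dunkl n i f)"
  shows "0 < lookup b i" "b \<in> keys f \<or> (\<exists>j<n. j \<noteq> i \<and> (\<exists>a\<in>keys f. exchange i j a b))"
proof -
  have "lookup (const alpha * theta i f) b \<noteq> 0 \<or> lookup (\<Sum>j\<in>{..<n} - {i}. quot i j f) b \<noteq> 0"
    using assms unfolding in_keys_iff dunkl_eq lookup_add by (metis add_0)
  then have "0 < lookup b i \<and> (b \<in> keys f \<or> (\<exists>j<n. j \<noteq> i \<and> (\<exists>a\<in>keys f. exchange i j a b)))"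
  proof
    assume "lookup (const alpha * theta i f) b \<noteq> 0"
    then show ?thesis by (simp add: lookup_theta in_keys_iff)
  next
    assume "lookup (\<Sum>j\<in>{..<n} - {i}. quot i j f) b \<noteq> 0"
    then have "b \<in> (\<Union>j\<in>{..<n} - {i}. keys (quot i j f))"
      unfolding in_keys_iff [symmetric] by (rule subsetD [OF keys_sum_subset])
    then obtain j where j: "j < n" "j \<noteq> i" "b \<in> keys (quot i j f)" by blast
    then obtain a where "a \<in> keys f" "exchange i j a b" using keys_quot [OF j(2) [symmetric] j(3)] by blast
    then show ?thesis using j by (auto simp: exchange_def)
  qed
  then show "0 < lookup b i" "b \<in> keys f \<or> (\<exists>j<n. j \<noteq> i \<and> (\<exists>a\<in>keys f. exchange i j a b))"
    by blast+
qed

text \<open>For nonincreasing \<open>u\<close>, dominance of the decreasing rearrangement of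
  \<open>a\<close>. Quantifying over all subsets avoids sorting, since the largest entries give the
  largest sums.\<close>

definition dominated_exp :: "nat \<Rightarrow> (nat \<Rightarrow> nat) \<Rightarrow> exponent \<Rightarrow> bool" where
  "dominated_exp n u a \<longleftrightarrow> keys a \<subseteq> {..<n} \<and> (\<Sum>i<n. lookup a i) = (\<Sum>i<n. u i) \<and>
     (\<forall>S\<subseteq>{..<n}. (\<Sum>i\<in>S. lookup a i) \<le> (\<Sum>i<card S. u i))"

lemma dominated_exp_exchange:
  assumes a: "dominated_exp n u a" and e: "exchange i j a b" and ij: "i < n" "j < n" "i \<noteq> j"
  shows "dominated_exp n u b"
  unfolding dominated_exp_def
proof (intro conjI allI impI)
  have eq: "lookup b k = lookup a k" if "k \<notin> {i, j}" for k using e that by (auto simp: exchange_def)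
  show "keys b \<subseteq> {..<n}"
  proof
    fix k assume "k \<in> keys b"
    show "k \<in> {..<n}"
    proof (cases "k \<in> {i, j}")
      case True
      then show ?thesis using ij by auto
    next
      case False
      then have "k \<in> keys a" using eq [OF False] \<open>k \<in> keys b\<close> by (simp add: in_keys_iff)
      then show ?thesis using a unfolding dominated_exp_def by blast
    qed
  qed
  have split: "(\<Sum>k\<in>T. lookup d k) = lookup d i + lookup d j + (\<Sum>k\<in>T - {i, j}. lookup d k)"
    if "finite T" "i \<in> T" "j \<in> T" for T and d :: exponent
  proof -
    have "T - {i, j} = T - {i} - {j}" by auto
    then show ?thesis using that ij by (simp add: sum.remove [of T i] sum.remove [of "T - {i}" j])
  qed
  have both: "(\<Sum>k\<in>T. lookup b k) = (\<Sum>k\<in>T. lookup a k)" if "finite T" "i \<in> T \<longleftrightarrow> j \<in> T" for T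
  proof (cases "i \<in> T")
    case True
    have "(\<Sum>k\<in>T - {i, j}. lookup b k) = (\<Sum>k\<in>T - {i, j}. lookup a k)"
      by (intro sum.cong) (auto simp: eq)
    then show ?thesis using that True e by (simp add: split exchange_def)
  next
    case False
    then show ?thesis using that by (intro sum.cong refl eq) auto
  qed
  show "(\<Sum>i<n. lookup b i) = (\<Sum>i<n. u i)"
    using both [of "{..<n}"] ij a by (simp add: dominated_exp_def)
  fix S assume S: "S \<subseteq> {..<n}"
  then have fin: "finite S" using finite_subset by blast
  show "(\<Sum>i\<in>S. lookup b i) \<le> (\<Sum>i<card S. u i)"
  proof (cases "i \<in> S \<longleftrightarrow> j \<in> S")
    case True
    then show ?thesis using both [OF fin] a S by (simp add: dominated_exp_def)
  next
    case False
    \<comment> \<open>Exactly one of the two indices lies in \<open>S\<close>. Its new exponent is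
      at most one of the two old ones, so the sum is bounded by the old sum over \<open>S\<close> or
      over \<open>S\<close> with the index replaced.\<close>
    then obtain x y where xy: "x \<in> S" "y \<notin> S" "{x, y} = {i, j}" by auto
    let ?T = "insert y (S - {x})"
    have T: "?T \<subseteq> {..<n}" "card ?T = card S"
      using S xy ij fin card_Suc_Diff1 [OF fin xy(1)] by (auto simp: doubleton_eq_iff)
    have "lookup b x \<le> max (lookup a x) (lookup a y)"
      using e xy by (auto simp: exchange_def doubleton_eq_iff max.commute)
    moreover have "(\<Sum>k\<in>S - {x}. lookup b k) = (\<Sum>k\<in>S - {x}. lookup a k)"
      using xy by (intro sum.cong refl eq) auto
    moreover have "(\<Sum>k\<in>S. lookup a k) = lookup a x + (\<Sum>k\<in>S - {x}. lookup a k)"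
      "(\<Sum>k\<in>S. lookup b k) = lookup b x + (\<Sum>k\<in>S - {x}. lookup b k)"
      using xy fin by (simp_all add: sum.remove)
    moreover have "(\<Sum>k\<in>?T. lookup a k) = lookup a y + (\<Sum>k\<in>S - {x}. lookup a k)"
      using xy fin by simp
    moreover have "(\<Sum>k\<in>S. lookup a k) \<le> (\<Sum>i<card S. u i)" "(\<Sum>k\<in>?T. lookup a k) \<le> (\<Sum>i<card S. u i)"
      using a S T unfolding dominated_exp_def by metis+
    ultimately show ?thesis by linarith
  qed
qed

definition dominated_poly :: "nat \<Rightarrow> (nat \<Rightarrow> nat) \<Rightarrow> mpol \<Rightarrow> bool" where
  "dominated_poly n u f \<longleftrightarrow> (\<forall>a\<in>keys f. dominated_exp n u a)"

lemma dominated_poly_dunkl: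
  assumes "dominated_poly n u f" "i < n"
  shows "dominated_poly n u (dunkl n i f)"
  unfolding dominated_poly_def
proof
  fix b assume "b \<in> keys (dunkl n i f)"
  from keys_dunkl(2) [OF this] show "dominated_exp n u b"
    using assms dominated_exp_exchange by (auto simp: dominated_poly_def)
qed

lemma dominated_poly_add: "dominated_poly n u f \<Longrightarrow> dominated_poly n u g \<Longrightarrow> dominated_poly n u (f + g)"
  using keys_add [of f g] by (auto simp: dominated_poly_def)

lemma dominated_poly_const: "dominated_poly n u f \<Longrightarrow> dominated_poly n u (const c * f)"
  by (auto simp: dominated_poly_def in_keys_iff)

lemma dominated_poly_sum: "(\<And>i. i \<in> A \<Longrightarrow> dominated_poly n u (f i)) \<Longrightarrow> dominated_poly n u (sum f A)"
  using keys_sum_subset [of f A] by (auto simp: dominated_poly_def)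

lemma dominated_poly_dunkl_list:
  assumes "dominated_poly n u f" "set js \<subseteq> {..<n}"
  shows "dominated_poly n u (dunkl_list n k js f)"
  using assms
proof (induction js arbitrary: k)
  case (Cons j js)
  then have "dominated_poly n u (dunkl_list n (Suc k) js f)" by simp
  with Cons.prems show ?case
    using dominated_poly_const [of n u _ "of_nat k"]
    by (simp add: dominated_poly_add dominated_poly_dunkl const_of_nat del: of_nat_Suc)
qed simp

lemma sum_of_bool_lessThan: "(\<Sum>i<k. of_bool (i < m)) = (min k m :: nat)"
  by (induction k) auto

text \<open>Dunkl operators preserve the bounds, and x_J raises a sum over \<open>S\<close> by the
  size of the intersection of \<open>S\<close> and \<open>J\<close>, hence by at most
  \<open>min (card S) m\<close>.\<close>

lemma dominated_poly_creation:
  assumes f: "dominated_poly n u f" and m: "m \<le> n"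
  shows "dominated_poly n (\<lambda>i. u i + of_bool (i < m)) (creation n m f)"
  unfolding creation_eq
proof (rule dominated_poly_sum)
  fix J assume "J \<in> {J. J \<subseteq> {..<n} \<and> card J = m}"
  then have J: "J \<subseteq> {..<n}" "card J = m" "finite J" using finite_subset by auto
  have g: "dominated_poly n u (dunkl_set n J f)"
    unfolding dunkl_set_def using f J by (intro dominated_poly_dunkl_list) auto
  show "dominated_poly n (\<lambda>i. u i + of_bool (i < m)) (creation_summand n f J)"
    unfolding dominated_poly_def
  proof
    fix b assume "b \<in> keys (creation_summand n f J)"
    then have "b \<in> keys (single (indicator_exp J) 1 * dunkl_set n J f)"
      using J by (simp add: creation_summand_def prod_X_eq_single)
    then obtain a where "a \<in> keys (dunkl_set n J f)" and b: "b = indicator_exp J + a"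
      using keys_single_mult by blast
    then have a: "dominated_exp n u a" using g by (simp add: dominated_poly_def)
    have sum: "(\<Sum>i\<in>S. lookup b i) = card (S \<inter> J) + (\<Sum>i\<in>S. lookup a i)" if "finite S" for S
    proof -
      have "(\<Sum>i\<in>S. lookup (indicator_exp J) i) = card (S \<inter> J)"
        using that J by (simp add: lookup_indicator_exp sum.If_cases)
      then show ?thesis by (simp add: b lookup_add sum.distrib)
    qed
    have "keys b \<subseteq> {..<n}"
    proof
      fix i assume "i \<in> keys b"
      then have "i \<in> J \<or> i \<in> keys a"
        using J by (cases "i \<in> J") (auto simp: b in_keys_iff lookup_add lookup_indicator_exp)
      then show "i \<in> {..<n}" using a J unfolding dominated_exp_def by blast
    qed
    moreover have "(\<Sum>i<n. lookup b i) = (\<Sum>i<n. u i + of_bool (i < m))"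
      using a J m by (simp add: sum sum.distrib sum_of_bool_lessThan dominated_exp_def Int_absorb1)
    moreover have "(\<Sum>i\<in>S. lookup b i) \<le> (\<Sum>i<card S. u i + of_bool (i < m))" if S: "S \<subseteq> {..<n}" for S
    proof -
      have "finite S" using S finite_subset by blast
      then have "card (S \<inter> J) \<le> min (card S) m" using J by (auto intro: card_mono)
      then show ?thesis
        using a S \<open>finite S\<close> by (simp add: sum sum.distrib sum_of_bool_lessThan dominated_exp_def add.commute add_mono del: min.bounded_iff)
    qed
    ultimately show "dominated_exp n (\<lambda>i. u i + of_bool (i < m)) b"
      unfolding dominated_exp_def by blast
  qed
qed

lemma euler_dominated:
  assumes "dominated_poly n u f"
  shows "euler n f = of_nat (\<Sum>i<n. u i) * f"
proof (rule poly_mapping_eqI)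
  fix a
  have "lookup (euler n f) a = of_nat (\<Sum>i<n. lookup a i) * lookup f a"
    by (simp add: euler_def lookup_sum lookup_theta sum_distrib_right)
  also have "\<dots> = of_nat (\<Sum>i<n. u i) * lookup f a"
    using assms by (cases "a \<in> keys f") (auto simp: dominated_poly_def dominated_exp_def in_keys_iff)
  finally show "lookup (euler n f) a = lookup (of_nat (\<Sum>i<n. u i) * f) a"
    by (simp flip: const_of_nat)
qed

section \<open>Coefficients of square-free monomials\<close>

lemma lookup_dunkl_list_squarefree:
  assumes "\<And>j. j \<in> set js \<Longrightarrow> lookup a j = 0"
  shows "lookup (dunkl_list n k js f) a = pochhammer (of_nat k) (length js) * lookup f a"
  using assms
proof (induction js arbitrary: k)
  case (Cons j js)
  then have "lookup (dunkl n j (dunkl_list n (Suc k) js f)) a = 0"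
    using keys_dunkl(1) [of a n j] by (force simp: in_keys_iff)
  then show ?case
    using Cons by (simp add: lookup_add pochhammer_rec add.commute del: of_nat_Suc flip: const_of_nat)
      (simp add: add.commute)
qed simp

text \<open>All subsets of size \<open>N\<close> are recorded because the induction passes from
  \<open>S\<close> to \<open>S - J\<close>. The condition is empty for \<open>N > n\<close>, which
  is why small \<open>n\<close> requires more variables.\<close>

definition squarefree_coeffs :: "nat \<Rightarrow> nat \<Rightarrow> mpol \<Rightarrow> bool" where
  "squarefree_coeffs n N f \<longleftrightarrow> (\<forall>S\<subseteq>{..<n}. card S = N \<longrightarrow> lookup f (indicator_exp S) = fact N)"

text \<open>Each of the (N+m choose m) subsets \<open>J\<close> of \<open>S\<close> contributes m!
  N!, in total (N+m)!.\<close>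

lemma squarefree_coeffs_creation:
  assumes "squarefree_coeffs n N f"
  shows "squarefree_coeffs n (N + m) (creation n m f)"
  unfolding squarefree_coeffs_def
proof (intro allI impI)
  fix S assume S: "S \<subseteq> {..<n}" "card S = N + m"
  have fin: "finite S" using S finite_subset by blast
  have "lookup (creation_summand n f J) (indicator_exp S) = (if J \<subseteq> S then fact m * fact N else 0)"
    if J: "J \<subseteq> {..<n}" "card J = m" for J
  proof -
    have finJ: "finite J" using J finite_subset by blast
    show ?thesis
    proof (cases "J \<subseteq> S")
      case True
      have "indicator_exp S = indicator_exp J + indicator_exp (S - J)"
        using True fin finJ by (intro poly_mapping_eqI) (auto simp: lookup_add lookup_indicator_exp)
      then have "lookup (creation_summand n f J) (indicator_exp S) = lookup (dunkl_set n J f) (indicator_exp (S - J))"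
        using finJ by (simp add: creation_summand_def prod_X_eq_single lookup_single_mult_add)
      also have "\<dots> = pochhammer 1 m * lookup f (indicator_exp (S - J))"
        using finJ fin J lookup_dunkl_list_squarefree [of "sorted_list_of_set J" "indicator_exp (S - J)" n 1 f]
        by (simp add: dunkl_set_def lookup_indicator_exp)
      also have "lookup f (indicator_exp (S - J)) = fact N"
      proof -
        have "S - J \<subseteq> {..<n}" "card (S - J) = N"
          using S J True finJ by (auto simp: card_Diff_subset)
        then show ?thesis using assms by (simp add: squarefree_coeffs_def)
      qed
      finally show ?thesis using True by (simp add: pochhammer_fact)
    next
      case False
      then obtain j where j: "j \<in> J" "j \<notin> S" by auto
      have "indicator_exp S \<notin> keys (creation_summand n f J)"
      proof
        assume "indicator_exp S \<in> keys (creation_summand n f J)"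
        then have "indicator_exp S \<in> keys (single (indicator_exp J) 1 * dunkl_set n J f)"
          using finJ by (simp add: creation_summand_def prod_X_eq_single)
        then obtain a where "indicator_exp S = indicator_exp J + a"
          using keys_single_mult by blast
        then have "lookup (indicator_exp S) j = lookup (indicator_exp J) j + lookup a j"
          by (simp add: lookup_add)
        then show False using j fin finJ by (simp add: lookup_indicator_exp)
      qed
      then show ?thesis using False by (simp add: in_keys_iff)
    qed
  qed
  then have "lookup (creation n m f) (indicator_exp S) = (\<Sum>J | J \<subseteq> {..<n} \<and> card J = m. if J \<subseteq> S then fact m * fact N else 0)"
    by (simp add: creation_eq lookup_sum)
  also have "\<dots> = (\<Sum>J | J \<subseteq> S \<and> card J = m. fact m * fact N)"
    using S by (intro sum.mono_neutral_cong_right) auto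
  also have "\<dots> = of_nat ((N + m choose m) * (fact m * fact N))"
    using fin S by (simp add: n_subsets)
  also have "(N + m choose m) * (fact m * fact N) = fact (N + m)"
    using binomial_fact_lemma [of m "N + m"] by (simp add: mult_ac)
  finally show "lookup (creation n m f) (indicator_exp S) = fact (N + m)" by simp
qed

text \<open>The numbers alpha u_i + n - 1 - i, with \<open>i\<close> counted from 0, are the
  expected joint eigenvalues of the xi_i. For u = 0 they are the eigenvalues \<open>i\<close> of
  xi_i on 1 in reverse order.\<close>

definition eigenvalue :: "nat \<Rightarrow> (nat \<Rightarrow> nat) \<Rightarrow> ratfun" where
  "eigenvalue n u = (\<Sum>i<n. (alpha * of_nat (u i) + of_nat (n - 1 - i))\<^sup>2)"

text \<open>That a polynomial consists of layers of size at most \<open>k\<close> amounts to its Jack expansion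
  involving only partitions of length at most \<open>k\<close>.\<close>

definition created :: "nat \<Rightarrow> nat \<Rightarrow> (nat \<Rightarrow> nat) \<Rightarrow> mpol \<Rightarrow> bool" where
  "created n k u f \<longleftrightarrow> symmetric_poly n f \<and> (\<forall>i\<ge>k. u i = 0) \<and>
     (\<exists>j\<le>k. \<exists>q. layered n j q \<and> f = (\<Sum>J | J \<subseteq> {..<n} \<and> card J = j. q J)) \<and>
     xi_squares n f = const (eigenvalue n u) * f \<and> dominated_poly n u f \<and>
     squarefree_coeffs n (\<Sum>i<n. u i) f"

lemma created_one: "created n 0 (\<lambda>i. 0) 1"
proof -
  have t: "theta i 1 = 0" "quot i j 1 = 0" if "i \<noteq> j" for i j
    using that by (auto intro!: quot_eqI)
  have d: "dunkl n i 1 = 0" for i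
    by (simp add: dunkl_eq) (intro sum.neutral ballI, auto intro!: t(2))
  then have x: "xi n i 1 = of_nat i" for i
    by (simp add: xi_def)
  have "symmetric_poly n 1"
    by (auto simp: symmetric_poly_def permutes_bij)
  moreover have "layered n 0 (\<lambda>J. 1)"
    using d by (auto simp: layered_def permutes_bij dest: finite_subset)
  moreover have "1 = (\<Sum>J | J \<subseteq> {..<n} \<and> card J = 0. (1 :: mpol))"
  proof -
    have "{J. J \<subseteq> {..<n} \<and> card J = 0} = {{}}" by (auto dest: finite_subset)
    then show ?thesis by simp
  qed
  moreover have "xi_squares n 1 = const (eigenvalue n (\<lambda>i. 0)) * 1"
  proof -
    have "xi n i (xi n i 1) = of_nat (i\<^sup>2)" for i
      using x [of i] linear_op_of_nat [OF linear_op_xi, of n i i 1] by (simp add: x power2_eq_square)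
    then have "xi_squares n 1 = of_nat (\<Sum>i<n. i\<^sup>2)" by (simp add: xi_squares_def)
    also have "(\<Sum>i<n. i\<^sup>2) = (\<Sum>i<n. (n - 1 - i)\<^sup>2)"
      by (rule sum.reindex_bij_witness [of _ "\<lambda>i. n - 1 - i" "\<lambda>i. n - 1 - i"]) auto
    also have "of_nat \<dots> = const (eigenvalue n (\<lambda>i. 0))"
      by (simp only: eigenvalue_def of_nat_0 mult_zero_right add_0 flip: of_nat_power of_nat_sum const_of_nat)
    finally show ?thesis by simp
  qed
  moreover have "dominated_poly n (\<lambda>i. 0) 1"
    by (simp add: dominated_poly_def dominated_exp_def)
  moreover have "squarefree_coeffs n 0 1"
    by (auto simp: squarefree_coeffs_def lookup_one indicator_exp_def dest: finite_subset)
  ultimately show ?thesis unfolding created_def by auto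
qed

text \<open>The increment is the one of \<open>xi_squares_creation\<close>: the numbers n - 1 - i
  with i < m are the last \<open>m\<close> indices, and the sum of \<open>u\<close> is the
  degree.\<close>

lemma eigenvalue_step:
  assumes "m \<le> n" "\<And>i. i \<ge> m \<Longrightarrow> u i = 0"
  shows "eigenvalue n (\<lambda>i. u i + of_bool (i < m)) = eigenvalue n u +
    2 * alpha * (alpha * of_nat (\<Sum>i<n. u i) + of_nat (\<Sum>i\<in>{n - m..<n}. i)) + of_nat m * alpha\<^sup>2"
proof -
  have split: "(\<Sum>i<n. g i) = (\<Sum>i<m. g i) + (\<Sum>i\<in>{m..<n}. g i)" for g :: "nat \<Rightarrow> 'a::comm_monoid_add"
    by (subst sum.union_disjoint [symmetric]) (use assms in \<open>auto intro!: sum.cong\<close>)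
  have 1: "(\<Sum>i\<in>{n - m..<n}. i) = (\<Sum>i<m. n - 1 - i)"
    by (rule sum.reindex_bij_witness [of _ "\<lambda>i. n - 1 - i" "\<lambda>i. n - 1 - i"]) (use assms in auto)
  have 2: "(\<Sum>i<n. u i) = (\<Sum>i<m. u i)"
    unfolding split using assms by simp
  have "(\<Sum>i<m. (alpha * of_nat (u i + of_bool (i < m)) + of_nat (n - 1 - i))\<^sup>2)
    = (\<Sum>i<m. (alpha * of_nat (u i) + of_nat (n - 1 - i))\<^sup>2 + (2 * alpha * (alpha * of_nat (u i) + of_nat (n - 1 - i)) + alpha\<^sup>2))"
    by (intro sum.cong refl) (simp add: power2_eq_square algebra_simps)
  moreover have "(\<Sum>i\<in>{m..<n}. (alpha * of_nat (u i + of_bool (i < m)) + of_nat (n - 1 - i))\<^sup>2)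
    = (\<Sum>i\<in>{m..<n}. (alpha * of_nat (u i) + of_nat (n - 1 - i))\<^sup>2)"
    by (intro sum.cong refl) auto
  moreover have "(\<Sum>i<m. 2 * alpha * (alpha * of_nat (u i) + of_nat (n - 1 - i)) + alpha\<^sup>2)
    = 2 * alpha * (alpha * of_nat (\<Sum>i<m. u i) + of_nat (\<Sum>i<m. n - 1 - i)) + of_nat m * alpha\<^sup>2"
    by (simp add: sum.distrib sum_distrib_left algebra_simps)
  ultimately show ?thesis
    unfolding 1 2 unfolding eigenvalue_def split by (simp add: sum.distrib)
qed

lemma created_creation:
  assumes f: "created n k u f" and k: "k \<le> m" and m: "m \<le> n"
  shows "created n m (\<lambda>i. u i + of_bool (i < m)) (creation n m f)"
proof -
  from f have sym: "symmetric_poly n f" and u: "\<And>i. i \<ge> k \<Longrightarrow> u i = 0"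
    and ev: "xi_squares n f = const (eigenvalue n u) * f" and dom: "dominated_poly n u f"
    and sf: "squarefree_coeffs n (\<Sum>i<n. u i) f"
    by (auto simp: created_def)
  from f obtain j q where j: "j \<le> k" and q: "layered n j q" and fq: "f = (\<Sum>J | J \<subseteq> {..<n} \<and> card J = j. q J)"
    by (auto simp: created_def)
  \<comment> \<open>The sets in the decomposition have size j <= k <= m, so j + (n - m - 1) < n, as
    \<open>xi_prod_layered\<close> requires.\<close>
  have T: "xi_prod n (n - m - 1) [n - m - 1..<n] f = 0" if "m < n"
    unfolding fq linear_op_sum [OF linear_op_xi_prod]
    using that j k by (intro sum.neutral ballI xi_prod_layered [OF q]) auto
  have d: "euler n f = of_nat (\<Sum>i<n. u i) * f" by (rule euler_dominated [OF dom])
  have "layered n m (creation_summand n f)"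
    by (rule layered_creation_summand [OF sym T])
  moreover have "xi_squares n (creation n m f) = const (eigenvalue n (\<lambda>i. u i + of_bool (i < m))) * creation n m f"
    using xi_squares_creation [OF m sym T ev d] u k by (simp add: eigenvalue_step [OF m])
  moreover have "(\<Sum>i<n. u i + of_bool (i < m)) = (\<Sum>i<n. u i) + m"
    using m by (simp only: sum.distrib sum_of_bool_lessThan)
  ultimately show ?thesis
    unfolding created_def using u k symmetric_creation [OF sym] dominated_poly_creation [OF dom m]
      squarefree_coeffs_creation [OF sf, of m] by (auto simp: creation_eq)
qed

lemma created_mono:
  assumes "created n k u f" "k \<le> m"
  shows "created n m u f"
proof -
  from assms(1) obtain j q where "j \<le> k" "layered n j q" "f = (\<Sum>J | J \<subseteq> {..<n} \<and> card J = j. q J)"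
    by (auto simp: created_def)
  then have "\<exists>j\<le>m. \<exists>q. layered n j q \<and> f = (\<Sum>J | J \<subseteq> {..<n} \<and> card J = j. q J)"
    using assms(2) order_trans by blast
  then show ?thesis using assms unfolding created_def by simp
qed

text \<open>The Young diagram is built column by column. With columns of height at most
  \<open>k\<close> only, the row with index \<open>i\<close> has reached the difference of the parts
  with indices \<open>i\<close> and \<open>k\<close>.\<close>

lemma created_creation_prod:
  assumes "is_partition l" "k \<le> n"
  shows "created n k (\<lambda>i. if i < k then lookup l i - lookup l k else 0) (creation_prod n l k 1)"
  using assms(2)
proof (induction k)
  case 0
  then show ?case using created_one by simp
next
  case (Suc k)
  \<comment> \<open>The shape after \<open>d\<close> columns of height \<open>Suc k\<close> have
    been added.\<close>
  let ?u = "\<lambda>d i. (if i < k then lookup l i - lookup l k else 0) + (if i < Suc k then d else 0)"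
  have "created n (Suc k) (?u d) ((creation n (Suc k) ^^ d) (creation_prod n l k 1))" for d
  proof (induction d)
    case 0
    show ?case using created_mono [OF Suc.IH, of "Suc k"] Suc.prems by simp
  next
    case (Suc d)
    have "(\<lambda>i. ?u d i + of_bool (i < Suc k)) = ?u (Suc d)" by auto
    then show ?case
      using created_creation [OF Suc order_refl \<open>Suc k \<le> n\<close>] by simp
  qed
  from this [of "lookup l k - lookup l (Suc k)"]
  have "created n (Suc k) (?u (lookup l k - lookup l (Suc k))) (creation_prod n l (Suc k) 1)" by simp
  moreover have "?u (lookup l k - lookup l (Suc k)) = (\<lambda>i. if i < Suc k then lookup l i - lookup l (Suc k) else 0)"
  proof
    fix i
    have "lookup l (Suc k) \<le> lookup l k" "i < k \<Longrightarrow> lookup l k \<le> lookup l i"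
      using assms(1) by (auto simp: is_partition_def)
    then show "?u (lookup l k - lookup l (Suc k)) i = (if i < Suc k then lookup l i - lookup l (Suc k) else 0)"
      by (auto simp: less_Suc_eq)
  qed
  ultimately show ?case by simp
qed

section \<open>Setting a variable to zero\<close>

definition restrict_poly :: "nat \<Rightarrow> mpol \<Rightarrow> mpol" where
  "restrict_poly n f = (\<Sum>a\<in>{a \<in> keys f. keys a \<subseteq> {..<n}}. single a (lookup f a))"

lemma lookup_restrict_poly: "lookup (restrict_poly n f) a = (if keys a \<subseteq> {..<n} then lookup f a else 0)"
proof -
  have "lookup (restrict_poly n f) a = (\<Sum>b\<in>{b \<in> keys f. keys b \<subseteq> {..<n}}. if b = a then lookup f b else 0)"
    by (simp add: restrict_poly_def lookup_sum lookup_single when_def)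
  then show ?thesis by (auto simp: in_keys_iff)
qed

lemma linear_op_restrict_poly: "linear_op (restrict_poly n)"
  by (rule linear_opI; rule poly_mapping_eqI) (simp_all add: lookup_restrict_poly lookup_add)

lemma restrict_poly_single: "restrict_poly n (single a c) = (if keys a \<subseteq> {..<n} then single a c else 0)"
  by (rule poly_mapping_eqI) (auto simp: lookup_restrict_poly lookup_single when_def)

lemma keys_add_exponent: "keys (a + b :: exponent) = keys a \<union> keys b"
  by (auto simp: in_keys_iff lookup_add)

lemma restrict_poly_mult: "restrict_poly n (f * g) = restrict_poly n f * restrict_poly n g"
proof -
  note L = linear_op_restrict_poly [of n]
  have "restrict_poly n (f * single b 1) = restrict_poly n f * restrict_poly n (single b 1)" for b
    by (rule linear_op_eqI [OF linear_op_comp [OF L linear_op_multr [of "single b 1"]]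
        linear_op_mult_right [OF L, of "restrict_poly n (single b 1)"]])
      (simp add: mult_single restrict_poly_single keys_add_exponent)
  then show ?thesis
    by (rule linear_op_eqI [OF linear_op_comp [OF L linear_op_multl [of f]] linear_op_mult [OF L, of "restrict_poly n f"]])
qed

lemma restrict_poly_diff: "restrict_poly n (f - g) = restrict_poly n f - restrict_poly n g"
  by (rule linear_op_diff [OF linear_op_restrict_poly])

lemma restrict_poly_X: "restrict_poly n (X i) = (if i < n then X i else 0)"
  by (simp add: X_def restrict_poly_single)

lemma restrict_poly_theta: "restrict_poly n (theta i f) = theta i (restrict_poly n f)"
  by (rule poly_mapping_eqI) (simp add: lookup_restrict_poly lookup_theta)

lemma restrict_poly_perm:
  assumes "p permutes {..<n}"
  shows "restrict_poly n (perm p f) = perm p (restrict_poly n f)"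
proof (rule poly_mapping_eqI)
  fix a :: exponent
  have b: "bij p" using assms by (rule permutes_bij)
  have "keys (map_key p a) \<subseteq> {..<n} \<longleftrightarrow> keys a \<subseteq> {..<n}"
  proof -
    have "keys (map_key p a) = p -` keys a"
      by (auto simp: in_keys_iff lookup_map_key b)
    moreover have "p -` {..<n} = {..<n}" using assms by (rule permutes_vimage)
    ultimately show ?thesis using b by (metis bij_is_surj surj_image_vimage_eq vimage_mono image_mono)
  qed
  then show "lookup (restrict_poly n (perm p f)) a = lookup (perm p (restrict_poly n f)) a"
    by (simp add: lookup_restrict_poly lookup_perm b)
qed

lemma restrict_poly_quot:
  assumes "i < n" "j < n" "i \<noteq> j"
  shows "restrict_poly n (quot i j f) = quot i j (restrict_poly n f)"
proof (rule quot_eqI [symmetric])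
  have "restrict_poly n ((X i - X j) * quot i j f) = restrict_poly n (X i * (f - swap i j f))"
    by (simp add: quot_eq assms)
  then show "(X i - X j) * restrict_poly n (quot i j f) = X i * (restrict_poly n f - swap i j (restrict_poly n f))"
    using assms by (simp add: restrict_poly_mult restrict_poly_diff restrict_poly_X restrict_poly_perm permutes_swap_id)
qed fact

lemma quot_invariant: "i \<noteq> j \<Longrightarrow> swap i j f = f \<Longrightarrow> quot i j f = 0"
  by (rule quot_eqI) simp_all

text \<open>At x_n = 0 the divided difference for the pair \<open>i\<close>, \<open>n\<close> would
  leave (1 - K_in) f; invariance removes it.\<close>

lemma restrict_poly_dunkl:
  assumes "i < n" "swap i n f = f"
  shows "restrict_poly n (dunkl (Suc n) i f) = dunkl n i (restrict_poly n f)"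
proof -
  have "{..<Suc n} - {i} = insert n ({..<n} - {i})" using assms by auto
  then have "dunkl (Suc n) i f = dunkl n i f"
    using assms by (simp add: dunkl_eq quot_invariant)
  moreover have "(\<Sum>j\<in>{..<n} - {i}. restrict_poly n (quot i j f)) = (\<Sum>j\<in>{..<n} - {i}. quot i j (restrict_poly n f))"
    using assms by (intro sum.cong refl restrict_poly_quot) auto
  ultimately show ?thesis
    by (simp add: dunkl_eq linear_op_add [OF linear_op_restrict_poly] linear_op_const [OF linear_op_restrict_poly]
        linear_op_sum [OF linear_op_restrict_poly] restrict_poly_theta)
qed

text \<open>Before D_j acts, invariance under K_jn has to be known. It persists because the
  operators already applied involve neither \<open>j\<close> nor \<open>n\<close>; this uses
  distinctness.\<close>

lemma restrict_poly_dunkl_list: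
  assumes f: "symmetric_poly (Suc n) f" and js: "set js \<subseteq> {..<n}" "distinct js"
  shows "restrict_poly n (dunkl_list (Suc n) k js f) = dunkl_list n k js (restrict_poly n f)"
  using js
proof (induction js arbitrary: k)
  case (Cons j js)
  let ?g = "dunkl_list (Suc n) (Suc k) js f"
  have "swap j n ?g = dunkl_list (Suc n) (Suc k) (map (transpose j n) js) (swap j n f)"
    using Cons.prems by (intro perm_dunkl_list permutes_swap_id) auto
  moreover have "map (transpose j n) js = js"
    using Cons.prems by (intro map_idI) (auto simp: transpose_def)
  moreover have "swap j n f = f" using Cons.prems by (intro symmetric_poly_swap [OF f]) auto
  ultimately have "swap j n ?g = ?g" by simp
  then show ?case
    using Cons by (simp add: linear_op_add [OF linear_op_restrict_poly] linear_op_of_nat [OF linear_op_restrict_poly]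
        restrict_poly_dunkl del: of_nat_Suc)
qed simp

text \<open>Subsets containing \<open>n\<close> disappear because of the factor x_n.\<close>

lemma restrict_poly_creation:
  assumes f: "symmetric_poly (Suc n) f"
  shows "restrict_poly n (creation (Suc n) m f) = creation n m (restrict_poly n f)"
proof -
  have X: "restrict_poly n (\<Prod>j\<in>J. X j) = (if J \<subseteq> {..<n} then \<Prod>j\<in>J. X j else 0)" if "finite J" for J
    using that by (induction J rule: finite_induct)
      (use restrict_poly_single [of n 0 1] in \<open>auto simp: restrict_poly_mult restrict_poly_X\<close>)
  have "restrict_poly n (creation_summand (Suc n) f J) = (if J \<subseteq> {..<n} then creation_summand n (restrict_poly n f) J else 0)"
    if "J \<subseteq> {..<Suc n}" for J
  proof -
    have "finite J" using that finite_subset by blast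
    then show ?thesis
      by (auto simp: creation_summand_def restrict_poly_mult X dunkl_set_def restrict_poly_dunkl_list [OF f])
  qed
  then have "restrict_poly n (creation (Suc n) m f) =
     (\<Sum>J | J \<subseteq> {..<Suc n} \<and> card J = m. if J \<subseteq> {..<n} then creation_summand n (restrict_poly n f) J else 0)"
    by (simp add: creation_eq linear_op_sum [OF linear_op_restrict_poly])
  also have "\<dots> = (\<Sum>J | J \<subseteq> {..<n} \<and> card J = m. creation_summand n (restrict_poly n f) J)"
    by (intro sum.mono_neutral_cong_right) (auto simp: lessThan_Suc)
  finally show ?thesis by (simp add: creation_eq)
qed

lemma symmetric_creation_prod: "symmetric_poly n (creation_prod n l k 1)"
proof (induction k)
  case 0
  then show ?case by (auto simp: symmetric_poly_def permutes_bij)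
next
  case (Suc k)
  have "symmetric_poly n ((creation n (Suc k) ^^ d) (creation_prod n l k 1))" for d
    by (induction d) (simp_all add: Suc symmetric_creation)
  then show ?case by simp
qed

lemma restrict_poly_creation_prod: "restrict_poly n (creation_prod (Suc n) l k 1) = creation_prod n l k 1"
proof (induction k)
  case 0
  show ?case using restrict_poly_single [of n 0 1] by simp
next
  case (Suc k)
  have "symmetric_poly (Suc n) ((creation (Suc n) (Suc k) ^^ d) (creation_prod (Suc n) l k 1)) \<and>
     restrict_poly n ((creation (Suc n) (Suc k) ^^ d) (creation_prod (Suc n) l k 1))
       = (creation n (Suc k) ^^ d) (creation_prod n l k 1)" for d
    by (induction d) (simp_all add: Suc symmetric_creation symmetric_creation_prod restrict_poly_creation)
  then show ?case by simp
qed

lemma creation_prod_beyond: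
  assumes "\<And>i. i \<ge> k \<Longrightarrow> lookup l i = 0" "k \<le> k'"
  shows "creation_prod n l k' = creation_prod n l k"
  using assms(2) by (induction k' rule: dec_induct) (simp_all add: assms(1))

lemma restrict_poly_restrict_poly: "n \<le> n' \<Longrightarrow> restrict_poly n (restrict_poly n' f) = restrict_poly n f"
  by (rule poly_mapping_eqI) (auto simp: lookup_restrict_poly)

lemma restrict_poly_creation_prod_le:
  assumes "\<And>i. i \<ge> n \<Longrightarrow> lookup l i = 0" "n \<le> n'"
  shows "restrict_poly n (creation_prod n' l n' 1) = creation_prod n l n 1"
  using assms(2)
proof (induction n' rule: dec_induct)
  \<comment> \<open>The product in \<open>n\<close> variables is itself a restriction from
    \<open>Suc n\<close> variables, hence fixed by \<open>restrict_poly n\<close>.\<close>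
  case base
  show ?case
  proof (rule poly_mapping_eqI)
    fix a
    have "restrict_poly n (restrict_poly n (creation_prod (Suc n) l n 1)) = restrict_poly n (creation_prod (Suc n) l n 1)"
      by (rule restrict_poly_restrict_poly) simp
    then show "lookup (restrict_poly n (creation_prod n l n 1)) a = lookup (creation_prod n l n 1) a"
      by (simp only: restrict_poly_creation_prod)
  qed
next
  case (step n')
  \<comment> \<open>The parts with index at least \<open>n\<close> vanish, so the additional
    operator occurs with exponent 0.\<close>
  have "creation_prod (Suc n') l (Suc n') = creation_prod (Suc n') l n'"
    using step assms(1) by (intro creation_prod_beyond) auto
  then have "restrict_poly n' (creation_prod (Suc n') l (Suc n') 1) = creation_prod n' l n' 1"
    by (simp only: restrict_poly_creation_prod)
  then show ?case using step restrict_poly_restrict_poly [of n n'] by metis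
qed

section \<open>Exponents, partitions and power sums\<close>

lemma psize_eq_sum: "finite A \<Longrightarrow> keys a \<subseteq> A \<Longrightarrow> psize a = (\<Sum>i\<in>A. lookup a i)"
  unfolding psize_def by (rule sum.mono_neutral_left) (auto simp: in_keys_iff)

lemma psize_add: "psize (a + b) = psize a + psize b"
proof -
  have "psize c = (\<Sum>i\<in>keys a \<union> keys b. lookup c i)" if "keys c \<subseteq> keys a \<union> keys b" for c
    using that by (intro psize_eq_sum) auto
  then show ?thesis by (simp add: keys_add_exponent lookup_add sum.distrib)
qed

lemma psize_single [simp]: "psize (single i k) = k"
  by (simp add: psize_def)

lemma psize_zero [simp]: "psize 0 = 0"
  by (simp add: psize_def)

lemma psize_eq_0_iff [simp]: "psize b = 0 \<longleftrightarrow> b = 0"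
  by (auto simp: psize_def in_keys_iff intro!: poly_mapping_eqI)

lemma exponent_decompose: "lookup b r \<noteq> 0 \<Longrightarrow> b = single r 1 + (b - single r (1::nat))"
  by (rule poly_mapping_eqI) (auto simp: lookup_add lookup_minus lookup_single when_def)

lemma exponent_induct [case_names zero add]:
  assumes "P 0" "\<And>r b. P b \<Longrightarrow> P (single r 1 + b)"
  shows "P (b :: exponent)"
proof (induction "psize b" arbitrary: b)
  case 0
  then show ?case using assms(1) by simp
next
  case (Suc k)
  then obtain r where "lookup b r \<noteq> 0" by (metis lookup_zero nat.distinct(1) poly_mapping_eqI psize_zero)
  from exponent_decompose [OF this] have b: "b = single r 1 + (b - single r 1)" .
  have "Suc k = 1 + psize (b - single r 1)"
    unfolding Suc(2) by (subst b) (simp only: psize_add psize_single)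
  then have "P (b - single r 1)" by (intro Suc.hyps(1)) simp
  then show ?case using assms(2) b by metis
qed

lemma finite_bounded_exponents: "finite {a :: exponent. keys a \<subseteq> {..<n} \<and> psize a \<le> N}"
proof -
  let ?A = "{a :: exponent. keys a \<subseteq> {..<n} \<and> psize a \<le> N}"
  let ?f = "\<lambda>a. restrict (lookup a) {..<n}"
  have "?f ` ?A \<subseteq> PiE {..<n} (\<lambda>_. {..N})"
  proof
    fix g assume "g \<in> ?f ` ?A"
    then obtain a where a: "g = ?f a" "keys a \<subseteq> {..<n}" "psize a \<le> N" by blast
    have "lookup a i \<le> N" if "i < n" for i
    proof -
      have "lookup a i \<le> (\<Sum>i<n. lookup a i)" using that by (intro member_le_sum) auto
      then show ?thesis using a psize_eq_sum [of "{..<n}" a] by simp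
    qed
    then show "g \<in> PiE {..<n} (\<lambda>_. {..N})" by (auto simp: a(1))
  qed
  moreover have "finite (PiE {..<n} (\<lambda>_. {..N}))" by (intro finite_PiE) auto
  ultimately have "finite (?f ` ?A)" by (rule finite_subset)
  moreover have "inj_on ?f ?A"
  proof (rule inj_onI)
    fix a b assume ab: "a \<in> ?A" "b \<in> ?A" "?f a = ?f b"
    show "a = b"
    proof (rule poly_mapping_eqI)
      fix i
      show "lookup a i = lookup b i"
      proof (cases "i < n")
        case True
        then show ?thesis using fun_cong [OF ab(3), of i] by simp
      next
        case False
        then have "i \<notin> keys a" "i \<notin> keys b" using ab by auto
        then show ?thesis by (simp add: in_keys_iff)
      qed
    qed
  qed
  ultimately show ?thesis by (rule finite_imageD)
qed

text \<open>The multiplicities of the nonzero entries, read as the exponent of a monomial in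
  variables standing for p_1, p_2, and so on. Its \<open>psize\<close> is the number of nonzero
  entries of \<open>a\<close>, its \<open>weight\<close> is the size of \<open>a\<close>.\<close>

definition part_counts :: "exponent \<Rightarrow> exponent" where
  "part_counts a = (\<Sum>i\<in>keys a. single (lookup a i) 1)"

lemma lookup_part_counts: "lookup (part_counts a) r = card {i \<in> keys a. lookup a i = r}"
  by (simp add: part_counts_def lookup_sum lookup_single when_def sum.If_cases Int_def)

lemma lookup_part_counts_zero [simp]: "lookup (part_counts a) 0 = 0"
  by (auto simp: lookup_part_counts in_keys_iff)

lemma psize_sum: "finite A \<Longrightarrow> psize (\<Sum>i\<in>A. f i) = (\<Sum>i\<in>A. psize (f i))"
  by (induction A rule: finite_induct) (simp_all add: psize_add)

lemma psize_part_counts: "psize (part_counts a) = card (keys a)"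
  by (simp add: part_counts_def psize_sum)

lemma part_counts_zero [simp]: "part_counts 0 = 0"
  by (simp add: part_counts_def)

lemma part_counts_add_single:
  assumes "k \<notin> keys a" "r \<noteq> 0"
  shows "part_counts (single k r + a) = single r 1 + part_counts a"
proof -
  have "keys (single k r + a) = insert k (keys a)" using assms by (auto simp: keys_add_exponent)
  moreover have "lookup (single k r + a) k = r" using assms by (simp add: lookup_add in_keys_iff)
  moreover have "(\<Sum>i\<in>keys a. single (lookup (single k r + a) i) 1) = (\<Sum>i\<in>keys a. single (lookup a i) (1::nat))"
    using assms by (intro sum.cong refl) (auto simp: lookup_add lookup_single when_def)
  ultimately show ?thesis using assms by (simp add: part_counts_def)
qed

lemma keys_map_key_bij: "bij p \<Longrightarrow> keys (map_key p a) = p -` keys a"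
  by (auto simp: in_keys_iff lookup_map_key)

lemma part_counts_map_key:
  assumes "bij p"
  shows "part_counts (map_key p a) = part_counts a"
proof -
  have "bij_betw p (p -` keys a) (keys a)"
    using assms by (metis bij_betw_subset bij_is_surj subset_UNIV surj_image_vimage_eq)
  then have "(\<Sum>i\<in>p -` keys a. single (lookup a (p i)) (1::nat)) = (\<Sum>i\<in>keys a. single (lookup a i) 1)"
    by (rule sum.reindex_bij_betw)
  then show ?thesis
    by (simp add: part_counts_def keys_map_key_bij assms lookup_map_key)
qed

lemma psize_map_key:
  assumes "bij p"
  shows "psize (map_key p a) = psize a"
proof -
  have "bij_betw p (p -` keys a) (keys a)"
    using assms by (metis bij_betw_subset bij_is_surj subset_UNIV surj_image_vimage_eq)
  then have "(\<Sum>i\<in>p -` keys a. lookup a (p i)) = psize a"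
    unfolding psize_def by (rule sum.reindex_bij_betw)
  then show ?thesis
    by (simp add: psize_def keys_map_key_bij assms lookup_map_key)
qed

lemma card_level_set_eq:
  assumes "keys a \<subseteq> {..<n}" "keys b \<subseteq> {..<n}" "part_counts a = part_counts b"
  shows "card {i \<in> {..<n}. lookup a i = r} = card {i \<in> {..<n}. lookup b i = r}"
proof (cases "r = 0")
  \<comment> \<open>\<open>part_counts\<close> ignores zeros; their number is determined by the
    number of nonzero entries.\<close>
  case True
  have "{i \<in> {..<n}. lookup c i = 0} = {..<n} - keys c" for c :: exponent
    by (auto simp: in_keys_iff)
  moreover have "card (keys a) = card (keys b)" using assms by (metis psize_part_counts)
  ultimately show ?thesis using True assms by (simp add: card_Diff_subset)
next
  case False
  have "{i \<in> {..<n}. lookup c i = r} = {i \<in> keys c. lookup c i = r}" if "keys c \<subseteq> {..<n}" for c :: exponent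
    using that False unfolding subset_iff in_keys_iff by auto
  then show ?thesis using assms by (simp flip: lookup_part_counts)
qed

lemma image_mset_lookup_eq:
  assumes "keys a \<subseteq> {..<n}" "keys b \<subseteq> {..<n}" "part_counts a = part_counts b"
  shows "image_mset (lookup a) (mset_set {..<n}) = image_mset (lookup b) (mset_set {..<n})"
  by (rule multiset_eqI)
     (use card_level_set_eq [OF assms] in \<open>simp add: count_image_mset vimage_def Int_def conj_commute\<close>)

lemma part_counts_eq_imp_permutes:
  assumes "keys a \<subseteq> {..<n}" "keys b \<subseteq> {..<n}" "part_counts a = part_counts b"
  shows "\<exists>p. p permutes {..<n} \<and> a = map_key p b"
proof -
  obtain p where p: "p permutes {..<n}" "\<forall>i\<in>{..<n}. lookup a i = lookup b (p i)"
    using image_mset_eq_implies_permutes [OF finite_lessThan image_mset_lookup_eq [OF assms]] by blast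
  have "lookup a i = lookup b (p i)" for i
  proof (cases "i < n")
    case False
    then have "p i = i" "i \<notin> keys a" "i \<notin> keys b" using p(1) assms by (auto simp: permutes_not_in)
    then show ?thesis by (simp add: in_keys_iff)
  qed (use p in auto)
  then have "a = map_key p b"
    using permutes_bij [OF p(1)] by (intro poly_mapping_eqI) (simp add: lookup_map_key)
  with p(1) show ?thesis by blast
qed

lemma mset_map_lookup: "mset (map (lookup a) [0..<n]) = image_mset (lookup a) (mset_set {..<n})"
  by (simp add: lessThan_atLeast0)

lemma ex_partition_map_key:
  assumes "keys a \<subseteq> {..<n}"
  shows "\<exists>p. p permutes {..<n} \<and> is_partition (map_key p a)"
proof -
  define ys where "ys = rev (sort (map (lookup a) [0..<n]))"
  have ys: "length ys = n" "mset ys = image_mset (lookup a) (mset_set {..<n})" "sorted (rev ys)"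
    unfolding ys_def by (simp_all flip: mset_map_lookup)
  have "map ((!) ys) [0..<n] = ys" using ys(1) by (metis map_nth)
  then have "image_mset ((!) ys) (mset_set {..<n}) = mset ys"
    by (metis lessThan_atLeast0 mset_map mset_upt)
  then obtain p where p: "p permutes {..<n}" "\<forall>i\<in>{..<n}. ys ! i = lookup a (p i)"
    using image_mset_eq_implies_permutes [of "{..<n}" "(!) ys" "lookup a"] ys by auto
  have "is_partition (map_key p a)"
    unfolding is_partition_def
  proof (intro allI impI)
    fix i j :: nat assume ij: "i \<le> j"
    show "lookup (map_key p a) j \<le> lookup (map_key p a) i"
    proof (cases "j < n")
      case True
      then have "ys ! j \<le> ys ! i" using ys ij by (intro sorted_rev_nth_mono) auto
      then show ?thesis using True ij p by (simp add: lookup_map_key permutes_bij)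
    next
      case False
      then have "p j = j" "j \<notin> keys a" using p(1) assms by (auto simp: permutes_not_in)
      then show ?thesis using p(1) by (simp add: lookup_map_key permutes_bij in_keys_iff)
    qed
  qed
  with p(1) show ?thesis by blast
qed

lemma exponent_bound: "\<exists>n. keys (a :: exponent) \<subseteq> {..<n}"
proof -
  obtain n where "\<forall>i\<in>keys a. i < n" using finite_nat_set_iff_bounded finite_keys by blast
  then show ?thesis by auto
qed

lemma partition_eqI:
  assumes "is_partition a" "is_partition b" "part_counts a = part_counts b"
  shows "a = b"
proof -
  obtain na nb where "keys a \<subseteq> {..<na}" "keys b \<subseteq> {..<nb}" using exponent_bound by metis
  then obtain n where n: "keys a \<subseteq> {..<n}" "keys b \<subseteq> {..<n}"
    using that [of "max na nb"] by fastforce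
  define xs where "xs c = map (lookup c) [0..<n]" for c :: exponent
  have s: "sorted (rev (xs c))" if "is_partition c" for c
    using that unfolding xs_def by (intro sorted_rev_iff_nth_mono [THEN iffD2]) (auto simp: is_partition_def)
  have "mset (xs a) = mset (xs b)"
    unfolding xs_def mset_map_lookup by (rule image_mset_lookup_eq [OF n assms(3)])
  then have "rev (xs a) = rev (xs b)"
    using s assms by (metis mset_rev properties_for_sort)
  then have "xs a = xs b" by simp
  then have "lookup a i = lookup b i" if "i < n" for i
    using that by (simp add: xs_def)
  moreover have "lookup c i = 0" if "\<not> i < n" "keys c \<subseteq> {..<n}" for c :: exponent and i
    using that by (auto simp: in_keys_iff)
  ultimately show ?thesis
    using n by (intro poly_mapping_eqI) metis
qed

lemma ex_part_counts:
  assumes "lookup b 0 = 0"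
  shows "\<exists>a. keys a \<subseteq> {..<psize b} \<and> part_counts a = b"
  using assms
proof (induction b rule: exponent_induct)
  case zero
  show ?case by (intro exI [of _ 0]) simp
next
  case (add r b)
  then have r: "r \<noteq> 0" "lookup b 0 = 0" by (auto simp: lookup_add lookup_single when_def split: if_splits)
  with add obtain a where a: "keys a \<subseteq> {..<psize b}" "part_counts a = b" by auto
  \<comment> \<open>All entries of \<open>a\<close> have smaller indices, so \<open>psize b\<close>
    is a free place for the new part.\<close>
  then have "part_counts (single (psize b) r + a) = single r 1 + b"
    using r by (subst part_counts_add_single) auto
  moreover have "keys (single (psize b) r + a) \<subseteq> {..<psize (single r 1 + b)}"
    using a by (auto simp: keys_add_exponent psize_add)
  ultimately show ?case by blast
qed

lemma ex_partition_part_counts: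
  assumes "lookup b 0 = 0"
  shows "\<exists>l. is_partition l \<and> part_counts l = b"
proof -
  obtain a where a: "keys a \<subseteq> {..<psize b}" "part_counts a = b" using ex_part_counts [OF assms] by blast
  obtain p where "p permutes {..<psize b}" "is_partition (map_key p a)"
    using ex_partition_map_key [OF a(1)] by blast
  then show ?thesis using a by (metis part_counts_map_key permutes_bij)
qed

text \<open>The degree of a monomial in the power sums when p_r has degree \<open>r\<close>.\<close>

definition weight :: "exponent \<Rightarrow> nat" where
  "weight b = (\<Sum>r\<in>keys b. r * lookup b r)"

lemma weight_eq_sum: "finite A \<Longrightarrow> keys a \<subseteq> A \<Longrightarrow> weight a = (\<Sum>i\<in>A. i * lookup a i)"
  unfolding weight_def by (rule sum.mono_neutral_left) (auto simp: in_keys_iff)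

lemma weight_add: "weight (a + b) = weight a + weight b"
proof -
  have "weight c = (\<Sum>i\<in>keys a \<union> keys b. i * lookup c i)" if "keys c \<subseteq> keys a \<union> keys b" for c
    using that by (intro weight_eq_sum) auto
  then show ?thesis by (simp add: keys_add_exponent lookup_add sum.distrib distrib_left)
qed

lemma weight_single [simp]: "weight (single r k) = r * k"
  by (simp add: weight_def)

lemma weight_zero [simp]: "weight 0 = 0"
  by (simp add: weight_def)

lemma weight_sum: "finite A \<Longrightarrow> weight (\<Sum>i\<in>A. f i) = (\<Sum>i\<in>A. weight (f i))"
  by (induction A rule: finite_induct) (simp_all add: weight_add)

lemma weight_part_counts: "weight (part_counts a) = psize a"
  by (simp add: part_counts_def weight_sum psize_def)

lemma psize_le_weight:
  assumes "lookup b 0 = 0"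
  shows "psize b \<le> weight b"
  unfolding psize_def weight_def
proof (rule sum_mono)
  fix r assume "r \<in> keys b"
  then have "1 \<le> r" using assms by (cases r) (auto simp: in_keys_iff)
  then show "lookup b r \<le> r * lookup b r" by simp
qed

lemma card_keys_le_psize: "card (keys a) \<le> psize (a :: exponent)"
  using psize_le_weight [of "part_counts a"] by (simp add: psize_part_counts weight_part_counts)

section \<open>Power sums as generators of the symmetric polynomials\<close>

definition power_sum_poly :: "nat \<Rightarrow> nat \<Rightarrow> mpol" where
  "power_sum_poly n r = (\<Sum>k<n. X k ^ r)"

definition power_sum_monom :: "nat \<Rightarrow> exponent \<Rightarrow> mpol" where
  "power_sum_monom n b = (\<Prod>r\<in>keys b. power_sum_poly n r ^ lookup b r)"

lemma power_sum_monom_eq_prod: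
  "finite A \<Longrightarrow> keys b \<subseteq> A \<Longrightarrow> power_sum_monom n b = (\<Prod>r\<in>A. power_sum_poly n r ^ lookup b r)"
  unfolding power_sum_monom_def by (rule prod.mono_neutral_left) (auto simp: in_keys_iff)

lemma power_sum_monom_add: "power_sum_monom n (a + b) = power_sum_monom n a * power_sum_monom n b"
proof -
  have "power_sum_monom n c = (\<Prod>r\<in>keys a \<union> keys b. power_sum_poly n r ^ lookup c r)"
    if "keys c \<subseteq> keys a \<union> keys b" for c
    using that by (intro power_sum_monom_eq_prod) auto
  then show ?thesis by (simp add: keys_add_exponent lookup_add prod.distrib power_add)
qed

lemma power_sum_monom_zero [simp]: "power_sum_monom n 0 = 1"
  by (simp add: power_sum_monom_def)

lemma power_sum_monom_single:
  "power_sum_monom n (single r 1) = power_sum_poly n r"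
  "power_sum_monom n (single r (Suc 0)) = power_sum_poly n r"
  by (simp_all add: power_sum_monom_def)

lemma symmetric_power_sum_monom: "symmetric_poly n (power_sum_monom n b)"
  unfolding symmetric_poly_def
proof (intro allI impI)
  fix p assume p: "p permutes {..<n}"
  note bij = permutes_bij [OF p]
  have pow: "perm p (f ^ k) = perm p f ^ k" for f k
    by (induction k) (simp_all add: bij perm_mult)
  have "perm p (power_sum_poly n r) = power_sum_poly n r" for r
  proof -
    have "(\<Sum>k<n. X (p k) ^ r) = power_sum_poly n r"
      unfolding power_sum_poly_def using p by (rule sum.permute [symmetric, unfolded comp_def])
    then show ?thesis by (simp add: power_sum_poly_def perm_sum bij pow)
  qed
  then show "perm p (power_sum_monom n b) = power_sum_monom n b"
    by (simp add: power_sum_monom_def perm_prod bij pow)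
qed

lemma lookup_power_sum_mult: "lookup (power_sum_poly n r * f) a = (\<Sum>k<n. lookup (single (single k r) 1 * f) a)"
  by (simp add: power_sum_poly_def sum_distrib_right lookup_sum flip: single_power)

lemma lookup_single_mult_nonneg:
  assumes "\<And>a. 0 \<le> lookup f a"
  shows "0 \<le> lookup (single e 1 * (f :: mpol)) a"
proof (cases "a \<in> keys (single e 1 * f)")
  case True
  then obtain a' where "a = e + a'" using keys_single_mult by blast
  then show ?thesis using assms by (simp add: lookup_single_mult_add)
qed (simp add: in_keys_iff)

text \<open>The order on Q(alpha) serves here to exclude cancellation.\<close>

lemma lookup_power_sum_monom_nonneg: "0 \<le> lookup (power_sum_monom n b) a"
proof (induction b arbitrary: a rule: exponent_induct)
  case zero
  show ?case by (simp add: lookup_one when_def)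
next
  case (add r b)
  then show ?case
    unfolding power_sum_monom_add power_sum_monom_single lookup_power_sum_mult
    by (intro sum_nonneg lookup_single_mult_nonneg)
qed

text \<open>Each factor p_r places \<open>r\<close> on one variable, and factors placed on the same
  variable merge. The maximal number of variables occurs only without merging, and then the
  multiplicities are those of \<open>b\<close>.\<close>

lemma keys_power_sum_monom:
  assumes "lookup b 0 = 0" "a \<in> keys (power_sum_monom n b)"
  shows "keys a \<subseteq> {..<n} \<and> psize a = weight b \<and> card (keys a) \<le> psize b \<and> (card (keys a) = psize b \<longrightarrow> part_counts a = b)"
  using assms
proof (induction b arbitrary: a rule: exponent_induct)
  case zero
  then show ?case by simp
next
  case (add r b)
  then have r: "r \<noteq> 0" "lookup b 0 = 0" by (auto simp: lookup_add lookup_single when_def split: if_splits)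
  have "lookup (power_sum_poly n r * power_sum_monom n b) a \<noteq> 0"
    using add.prems by (simp add: in_keys_iff power_sum_monom_add power_sum_monom_single)
  then obtain k where k: "k < n" "a \<in> keys (single (single k r) 1 * power_sum_monom n b)"
    unfolding lookup_power_sum_mult by (meson in_keys_iff lessThan_iff sum.not_neutral_contains_not_neutral)
  then obtain a' where a': "a' \<in> keys (power_sum_monom n b)" and a: "a = single k r + a'"
    using keys_single_mult by blast
  note IH = add.IH [OF r(2) a']
  have keys: "keys a = insert k (keys a')" using r by (simp add: a keys_add_exponent)
  have "keys a \<subseteq> {..<n}" using IH k by (simp add: keys)
  moreover have "psize a = weight (single r 1 + b)" using IH by (simp add: a psize_add weight_add)
  moreover have "card (keys a) \<le> Suc (card (keys a'))" by (simp add: keys card_insert_if)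
  moreover have "part_counts a = single r 1 + b" if "card (keys a) = psize (single r 1 + b)"
  proof -
    have "card (keys a) = Suc (psize b)" using that by (simp add: psize_add)
    then have "k \<notin> keys a'" "card (keys a') = psize b"
      using IH by (auto simp: keys card_insert_if split: if_splits)
    then show ?thesis using IH r by (simp add: a part_counts_add_single)
  qed
  ultimately show ?case using IH by (simp add: psize_add)
qed

text \<open>Placing one factor on each variable reaches \<open>a\<close>, and all other
  contributions are nonnegative.\<close>

lemma lookup_power_sum_monom_pos:
  assumes "keys a \<subseteq> {..<n}"
  shows "0 < lookup (power_sum_monom n (part_counts a)) a"
  using assms
proof (induction "card (keys a)" arbitrary: a)
  case 0
  then have "a = 0" by simp
  then show ?case by simp
next
  case (Suc c)
  then obtain k where k: "k \<in> keys a" by fastforce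
  define r where "r = lookup a k"
  define a' where "a' = Poly_Mapping.update k 0 a"
  have r: "r \<noteq> 0" using k by (simp add: r_def in_keys_iff)
  have a: "a = single k r + a'"
    by (rule poly_mapping_eqI) (simp add: a'_def r_def lookup_add lookup_update lookup_single when_def)
  have k': "k \<notin> keys a'" by (simp add: a'_def in_keys_iff lookup_update)
  have keys: "keys a = insert k (keys a')" using r by (simp add: a keys_add_exponent)
  have "0 < lookup (power_sum_monom n (part_counts a')) a'"
    using Suc k' by (intro Suc.hyps(1)) (auto simp: keys)
  then have "0 < lookup (single (single k r) 1 * power_sum_monom n (part_counts a')) a"
    by (simp add: a lookup_single_mult_add)
  moreover have "k < n" using Suc.prems k by auto
  ultimately have "0 < lookup (power_sum_poly n r * power_sum_monom n (part_counts a')) a"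
    unfolding lookup_power_sum_mult
    by (intro sum_pos2 [where i = k] lookup_single_mult_nonneg lookup_power_sum_monom_nonneg) auto
  then show ?case
    using a part_counts_add_single [OF k' r] by (simp add: power_sum_monom_add power_sum_monom_single)
qed

text \<open>A polynomial \<open>g\<close> in variables \<open>X 1, X 2, \<dots>\<close> standing for the power sums is
  evaluated at the power sums of the first \<open>n\<close> variables.\<close>

definition eval_power_sums :: "nat \<Rightarrow> mpol \<Rightarrow> mpol" where
  "eval_power_sums n g = (\<Sum>b\<in>keys g. const (lookup g b) * power_sum_monom n b)"

lemma eval_power_sums_eq_sum:
  "finite A \<Longrightarrow> keys g \<subseteq> A \<Longrightarrow> eval_power_sums n g = (\<Sum>b\<in>A. const (lookup g b) * power_sum_monom n b)"
  unfolding eval_power_sums_def by (rule sum.mono_neutral_left) (auto simp: in_keys_iff)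

lemma linear_op_eval_power_sums: "linear_op (eval_power_sums n)"
proof (rule linear_opI)
  fix f g :: mpol
  have "eval_power_sums n h = (\<Sum>b\<in>keys f \<union> keys g. const (lookup h b) * power_sum_monom n b)"
    if "keys h \<subseteq> keys f \<union> keys g" for h
    using that by (intro eval_power_sums_eq_sum) auto
  then show "eval_power_sums n (f + g) = eval_power_sums n f + eval_power_sums n g"
    using keys_add [of f g] by (simp add: lookup_add const_add distrib_right sum.distrib)
next
  fix c f
  have "eval_power_sums n (const c * f) = (\<Sum>b\<in>keys f. const (lookup (const c * f) b) * power_sum_monom n b)"
    by (intro eval_power_sums_eq_sum) (auto simp: in_keys_iff)
  then show "eval_power_sums n (const c * f) = const c * eval_power_sums n f"
    by (simp add: eval_power_sums_def const_mult sum_distrib_left mult.assoc)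
qed

lemma eval_power_sums_single: "eval_power_sums n (single b 1) = power_sum_monom n b"
  by (simp add: eval_power_sums_def)

definition weight_homogeneous :: "nat \<Rightarrow> mpol \<Rightarrow> bool" where
  "weight_homogeneous N g \<longleftrightarrow> (\<forall>b\<in>keys g. lookup b 0 = 0 \<and> weight b = N)"

text \<open>Independence of the power sums. For \<open>b\<close> of maximal length in
  \<open>g\<close>, a monomial with multiplicities \<open>b\<close> arises from no other product in
  \<open>g\<close>; it fits into \<open>n\<close> variables as \<open>psize b <= n\<close>.\<close>

lemma eval_power_sums_eq_0:
  assumes g: "\<And>b. b \<in> keys g \<Longrightarrow> lookup b 0 = 0 \<and> psize b \<le> n" and eval: "eval_power_sums n g = 0"
  shows "g = 0"
proof (rule ccontr)
  assume "g \<noteq> 0"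
  then have ne: "keys g \<noteq> {}" by simp
  have "Max (psize ` keys g) \<in> psize ` keys g" using ne by (intro Max_in) auto
  then obtain b where "b \<in> keys g" "psize b = Max (psize ` keys g)" by auto
  then have b: "b \<in> keys g" "\<And>b'. b' \<in> keys g \<Longrightarrow> psize b' \<le> psize b" by auto
  have b0: "lookup b 0 = 0" "psize b \<le> n" using g b by auto
  obtain a where a: "keys a \<subseteq> {..<psize b}" "part_counts a = b" using ex_part_counts [OF b0(1)] by blast
  have an: "keys a \<subseteq> {..<n}" using a b0(2) by auto
  have "lookup g b' * lookup (power_sum_monom n b') a = 0" if "b' \<in> keys g" "b' \<noteq> b" for b'
  proof -
    have "a \<notin> keys (power_sum_monom n b')"
    proof
      assume "a \<in> keys (power_sum_monom n b')"
      moreover have "lookup b' 0 = 0" using g that by auto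
      moreover have "card (keys a) = psize b" using a by (metis psize_part_counts)
      ultimately show False
        using keys_power_sum_monom [of b' a n] b(2) [OF that(1)] that(2) a(2) by auto
    qed
    then show ?thesis by (simp add: in_keys_iff)
  qed
  then have "(\<Sum>b'\<in>keys g - {b}. lookup g b' * lookup (power_sum_monom n b') a) = 0"
    by (intro sum.neutral) auto
  then have "lookup (eval_power_sums n g) a = lookup g b * lookup (power_sum_monom n b) a"
    using b(1) by (simp add: eval_power_sums_def lookup_sum lookup_add sum.remove)
  then have "lookup g b = 0"
    using eval lookup_power_sum_monom_pos [OF an] a(2) by simp
  then show False using b(1) by (simp add: in_keys_iff)
qed

lemma eval_power_sums_inject:
  assumes "weight_homogeneous N g" "weight_homogeneous N h" "N \<le> n" "eval_power_sums n g = eval_power_sums n h"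
  shows "g = h"
proof -
  have "eval_power_sums n (g - h) = 0"
    using assms(4) by (simp add: linear_op_diff [OF linear_op_eval_power_sums])
  moreover have "lookup b 0 = 0 \<and> psize b \<le> n" if "b \<in> keys (g - h)" for b
  proof -
    have "b \<in> keys g \<or> b \<in> keys h" using that by (auto simp: in_keys_iff lookup_minus)
    then have "lookup b 0 = 0" "weight b = N" using assms(1,2) by (auto simp: weight_homogeneous_def)
    then show ?thesis using psize_le_weight [of b] assms(3) by simp
  qed
  ultimately have "g - h = 0" using eval_power_sums_eq_0 [of "g - h" n] by blast
  then show ?thesis by simp
qed

lemma weight_homogeneous_add: "weight_homogeneous N f \<Longrightarrow> weight_homogeneous N g \<Longrightarrow> weight_homogeneous N (f + g)"
  using keys_add [of f g] by (auto simp: weight_homogeneous_def)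

lemma weight_homogeneous_const: "weight_homogeneous N f \<Longrightarrow> weight_homogeneous N (const c * f)"
  by (auto simp: weight_homogeneous_def in_keys_iff)

lemma weight_homogeneous_sum:
  "(\<And>i. i \<in> A \<Longrightarrow> weight_homogeneous N (f i)) \<Longrightarrow> weight_homogeneous N (sum f A)"
  using keys_sum_subset [of f A] by (auto simp: weight_homogeneous_def)

lemma symmetric_poly_add: "symmetric_poly n f \<Longrightarrow> symmetric_poly n g \<Longrightarrow> symmetric_poly n (f + g)"
  by (simp add: symmetric_poly_def perm_add permutes_bij)

lemma symmetric_poly_const: "symmetric_poly n f \<Longrightarrow> symmetric_poly n (const c * f)"
  by (simp add: symmetric_poly_def perm_mult permutes_bij)

lemma symmetric_poly_sum: "(\<And>i. i \<in> A \<Longrightarrow> symmetric_poly n (f i)) \<Longrightarrow> symmetric_poly n (sum f A)"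
  by (simp add: symmetric_poly_def perm_sum permutes_bij)

lemma symmetric_eval_power_sums: "symmetric_poly n (eval_power_sums n g)"
  unfolding eval_power_sums_def
  by (intro symmetric_poly_sum symmetric_poly_const symmetric_power_sum_monom)

lemma symmetric_poly_lookup:
  assumes "symmetric_poly n f" "p permutes {..<n}"
  shows "lookup f (map_key p a) = lookup f a"
  using assms lookup_perm [OF permutes_bij [OF assms(2)], of f a] by (simp add: symmetric_poly_def)

text \<open>Lexicographic induction on a bound \<open>L\<close> for the number of variables in a
  monomial and on the number of monomials attaining it. A multiple of a power sum product removes
  one of the latter.\<close>

lemma ex_eval_power_sums_aux:
  assumes "symmetric_poly n f" "\<And>a. a \<in> keys f \<Longrightarrow> keys a \<subseteq> {..<n} \<and> psize a = N \<and> card (keys a) \<le> L"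
  shows "\<exists>g. weight_homogeneous N g \<and> f = eval_power_sums n g"
  using assms
proof (induction "(L, card {a \<in> keys f. card (keys a) = L})" arbitrary: L f rule: wf_induct_rule [OF wf_lex_prod [OF wf_less_than wf_less_than]])
  case (1 L f)
  let ?top = "\<lambda>f. {a \<in> keys f. card (keys a) = L}"
  have fin: "finite (?top h)" for h :: mpol by simp
  show ?case
  proof (cases "?top f = {}")
    case True
    show ?thesis
    proof (cases L)
      case 0
      then have "keys f = {}" using True 1(3) by fastforce
      then have "f = 0" by simp
      then show ?thesis
        by (intro exI [of _ 0]) (simp add: weight_homogeneous_def eval_power_sums_def)
    next
      case (Suc L')
      then have *: "card (keys a) \<le> L'" if "a \<in> keys f" for a
        using 1(3) [OF that] True that by (auto simp: le_Suc_eq)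
      show ?thesis
        by (rule 1(1) [of L' f]) (use Suc 1(2,3) * in auto)
    qed
  next
    case False
    then obtain a where a: "a \<in> keys f" "card (keys a) = L" by blast
    note an = 1(3) [OF a(1)]
    let ?P = "power_sum_monom n (part_counts a)"
    have P: "0 < lookup ?P a" using an by (intro lookup_power_sum_monom_pos) auto
    define c where "c = - (lookup f a / lookup ?P a)"
    define f' where "f' = f + const c * ?P"
    have keysP: "keys a' \<subseteq> {..<n} \<and> psize a' = N \<and> card (keys a') \<le> L \<and> (card (keys a') = L \<longrightarrow> part_counts a' = part_counts a)"
      if "a' \<in> keys ?P" for a'
      using keys_power_sum_monom [OF _ that] an a(2) by (simp add: psize_part_counts weight_part_counts)
    have keys': "a' \<in> keys f \<or> a' \<in> keys ?P" if "a' \<in> keys f'" for a'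
      using that by (auto simp: f'_def in_keys_iff lookup_add)
    have sym: "symmetric_poly n f'"
      unfolding f'_def by (intro symmetric_poly_add symmetric_poly_const symmetric_power_sum_monom 1)
    have "?top f' \<subseteq> ?top f - {a}"
    proof
      fix a' assume a': "a' \<in> ?top f'"
      have "a' \<noteq> a"
        using a' P by (auto simp: f'_def in_keys_iff lookup_add c_def)
      \<comment> \<open>A monomial of length \<open>L\<close> in the product has the multiplicities
        of \<open>a\<close>; it is a permuted \<open>a\<close> and occurs in the symmetric
        \<open>f\<close> already.\<close>
      moreover have "a' \<in> keys f"
      proof (cases "a' \<in> keys f")
        case False
        then have "a' \<in> keys ?P" using a' keys' by auto
        then obtain p where "p permutes {..<n}" "a' = map_key p a"
          using keysP a' an part_counts_eq_imp_permutes by blast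
        then show ?thesis
          using symmetric_poly_lookup [OF 1(2)] a(1) by (simp add: in_keys_iff)
      qed
      ultimately show "a' \<in> ?top f - {a}" using a' by auto
    qed
    then have "card (?top f') < card (?top f)"
      using a by (intro psubset_card_mono) auto
    moreover have "keys a' \<subseteq> {..<n} \<and> psize a' = N \<and> card (keys a') \<le> L" if "a' \<in> keys f'" for a'
      using keys' [OF that] keysP 1(3) by blast
    ultimately have "\<exists>g. weight_homogeneous N g \<and> f' = eval_power_sums n g"
      using sym by (intro 1(1) [of L f']) auto
    then obtain g where g: "weight_homogeneous N g" "f' = eval_power_sums n g" by blast
    have "f = f' + const (- c) * ?P" by (simp add: f'_def const_uminus)
    also have "\<dots> = eval_power_sums n (g + const (- c) * single (part_counts a) 1)"
      by (simp only: g(2) linear_op_add [OF linear_op_eval_power_sums] linear_op_const [OF linear_op_eval_power_sums]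
          eval_power_sums_single)
    finally have "f = eval_power_sums n (g + const (- c) * single (part_counts a) 1)" .
    moreover have "weight_homogeneous N (single (part_counts a) 1)"
      using an by (simp add: weight_homogeneous_def weight_part_counts)
    ultimately show ?thesis
      using g(1) weight_homogeneous_add weight_homogeneous_const by blast
  qed
qed

lemma ex_eval_power_sums:
  assumes "symmetric_poly n f" "\<And>a. a \<in> keys f \<Longrightarrow> keys a \<subseteq> {..<n} \<and> psize a = N"
  shows "\<exists>g. weight_homogeneous N g \<and> f = eval_power_sums n g"
  using ex_eval_power_sums_aux [OF assms(1), of N N] assms(2) card_keys_le_psize by metis

section \<open>The scalar product\<close>

lemma lookup_pdiff: "lookup (pdiff r g) b = of_nat (lookup b r + 1) * lookup g (single r 1 + b)"
proof -
  have "lookup (pdiff r g) b = (\<Sum>a\<in>keys g. if a - single r 1 = b then of_nat (lookup a r) * lookup g a else 0)"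
    by (simp add: pdiff_def lookup_sum lookup_single when_def)
  also have "\<dots> = (\<Sum>a\<in>keys g. if a = single r 1 + b then of_nat (lookup b r + 1) * lookup g a else 0)"
  proof (intro sum.cong refl)
    fix a
    show "(if a - single r 1 = b then of_nat (lookup a r) * lookup g a else 0)
      = (if a = single r 1 + b then of_nat (lookup b r + 1) * lookup g a else 0)"
    proof (cases "a = single r 1 + b")
      case True
      then have "a - single r 1 = b" by simp
      then show ?thesis using True by (simp add: lookup_add)
    next
      case False
      then have "a - single r 1 = b \<Longrightarrow> lookup a r = 0"
        using exponent_decompose [of a r] by auto
      then show ?thesis using False by auto
    qed
  qed
  also have "\<dots> = of_nat (lookup b r + 1) * lookup g (single r 1 + b)"
    by (simp add: in_keys_iff)
  finally show ?thesis .
qed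

lemma linear_op_pdiff: "linear_op (pdiff r)"
  by (rule linear_opI; rule poly_mapping_eqI) (simp_all add: lookup_pdiff lookup_add distrib_left mult.left_commute)

lemma const_mult_single: "const k * single a c = single a (k * c)"
  by (simp add: const_def mult_single)

lemma pdiff_single: "pdiff r (single b c) = const (of_nat (lookup b r)) * single (b - single r 1) c"
  by (cases "c = 0") (simp_all add: pdiff_def const_mult_single)

text \<open>z_lambda alpha^l(lambda) for the partition lambda with multiplicities
  \<open>b\<close>.\<close>

definition norm_weight :: "exponent \<Rightarrow> ratfun" where
  "norm_weight b = of_nat (\<Prod>r\<in>keys b. r ^ lookup b r * fact (lookup b r)) * alpha ^ psize b"

text \<open>The scalar product of the Jack functions, carried over to polynomials in the power
  sums.\<close>

definition form :: "mpol \<Rightarrow> mpol \<Rightarrow> ratfun" where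
  "form g h = (\<Sum>b\<in>keys g. lookup g b * lookup h b * norm_weight b)"

lemma form_eq_sum: "finite A \<Longrightarrow> keys g \<subseteq> A \<Longrightarrow> form g h = (\<Sum>b\<in>A. lookup g b * lookup h b * norm_weight b)"
  unfolding form_def by (rule sum.mono_neutral_left) (auto simp: in_keys_iff)

lemma form_commute: "form g h = form h g"
proof -
  have "form g h = (\<Sum>b\<in>keys g \<union> keys h. lookup g b * lookup h b * norm_weight b)"
    by (rule form_eq_sum) auto
  also have "\<dots> = (\<Sum>b\<in>keys g \<union> keys h. lookup h b * lookup g b * norm_weight b)"
    by (simp add: mult.commute)
  also have "\<dots> = form h g"
    by (rule form_eq_sum [symmetric]) auto
  finally show ?thesis .
qed

lemma form_add_left: "form (f + g) h = form f h + form g h"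
proof -
  have "form u h = (\<Sum>b\<in>keys f \<union> keys g. lookup u b * lookup h b * norm_weight b)" if "keys u \<subseteq> keys f \<union> keys g" for u
    by (rule form_eq_sum) (use that in auto)
  then show ?thesis
    using keys_add [of f g] by (simp add: lookup_add distrib_right sum.distrib)
qed

lemma form_const_left: "form (const c * f) h = c * form f h"
proof -
  have "form (const c * f) h = (\<Sum>b\<in>keys f. lookup (const c * f) b * lookup h b * norm_weight b)"
    by (rule form_eq_sum) (auto simp: in_keys_iff)
  then show ?thesis
    by (simp add: form_def sum_distrib_left mult.assoc)
qed

lemma form_zero_left [simp]: "form 0 h = 0"
  by (simp add: form_def)

lemma form_sum_left: "form (sum f A) h = (\<Sum>i\<in>A. form (f i) h)"
  by (induction A rule: infinite_finite_induct) (simp_all add: form_add_left)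

lemma form_add_right: "form h (f + g) = form h f + form h g"
  and form_const_right: "form h (const c * f) = c * form h f"
  and form_sum_right: "form h (sum F A) = (\<Sum>i\<in>A. form h (F i))"
  by (simp_all add: form_commute [of h] form_add_left form_const_left form_sum_left)

lemma form_single_left: "form (single b 1) h = lookup h b * norm_weight b"
  by (simp add: form_def)

text \<open>By this ratio, multiplication by p_r is adjoint to alpha r d/dp_r.\<close>

lemma norm_weight_add_single:
  "norm_weight (single r 1 + b) = norm_weight b * (alpha * of_nat (r * (lookup b r + 1)))"
proof -
  let ?A = "insert r (keys b)"
  let ?w = "\<lambda>b r. r ^ lookup b r * fact (lookup b r) :: nat"
  have w: "(\<Prod>s\<in>keys c. ?w c s) = ?w c r * (\<Prod>s\<in>keys b - {r}. ?w b s)"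
    if "keys c \<subseteq> ?A" "\<And>s. s \<noteq> r \<Longrightarrow> lookup c s = lookup b s" for c
  proof -
    have "(\<Prod>s\<in>keys c. ?w c s) = (\<Prod>s\<in>?A. ?w c s)"
      using that by (intro prod.mono_neutral_left) (auto simp: in_keys_iff)
    also have "\<dots> = ?w c r * (\<Prod>s\<in>keys b - {r}. ?w c s)"
      by (subst prod.insert_remove) auto
    also have "(\<Prod>s\<in>keys b - {r}. ?w c s) = (\<Prod>s\<in>keys b - {r}. ?w b s)"
      using that by (intro prod.cong) auto
    finally show ?thesis .
  qed
  have "(\<Prod>s\<in>keys (single r 1 + b). ?w (single r 1 + b) s) = ?w (single r 1 + b) r * (\<Prod>s\<in>keys b - {r}. ?w b s)"
    by (rule w) (auto simp: keys_add_exponent lookup_add lookup_single when_def)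
  also have "?w (single r 1 + b) r = (r * (lookup b r + 1)) * ?w b r"
    by (simp add: lookup_add algebra_simps)
  also have "\<dots> * (\<Prod>s\<in>keys b - {r}. ?w b s) = (r * (lookup b r + 1)) * (\<Prod>s\<in>keys b. ?w b s)"
    by (subst w [of b]) auto
  finally show ?thesis
    by (simp only: norm_weight_def psize_add psize_single power_add power_one_right of_nat_mult mult_ac)
qed

lemma norm_weight_pos:
  assumes "0 < alpha" "lookup b 0 = 0"
  shows "0 < norm_weight b"
proof -
  have "0 < (\<Prod>r\<in>keys b. r ^ lookup b r * fact (lookup b r) :: nat)"
    using assms(2) by (intro prod_pos) (auto simp: in_keys_iff intro!: mult_pos_pos zero_less_power gr0I)
  then show ?thesis using assms(1) by (simp add: norm_weight_def del: of_nat_prod)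
qed

text \<open>Polynomials are ordered by the sign of their leading coefficient.\<close>

lemma alpha_pos: "0 < alpha"
proof -
  have "0 < [:0, 1 :: rat:]" by (simp add: less_poly_def pos_poly_pCons)
  then show ?thesis by (simp add: alpha_def zero_less_Fract_iff)
qed

lemma form_self_pos:
  assumes "weight_homogeneous N g" "g \<noteq> 0"
  shows "0 < form g g"
  unfolding form_def
proof (rule sum_pos)
  show "keys g \<noteq> {}" using assms by simp
  fix b assume b: "b \<in> keys g"
  then have "0 < norm_weight b"
    using assms by (intro norm_weight_pos alpha_pos) (auto simp: weight_homogeneous_def)
  moreover have "0 < lookup g b * lookup g b"
    using b by (auto simp: in_keys_iff zero_less_mult_iff linorder_neq_iff)
  ultimately show "0 < lookup g b * lookup g b * norm_weight b" by simp
qed simp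

lemma form_eqI_left:
  assumes "linear_op L" "linear_op M" "\<And>b. form (L (single b 1)) h = form (M (single b 1)) h'"
  shows "form (L g) h = form (M g) h'"
  unfolding linear_op_expand [OF assms(1), of g] linear_op_expand [OF assms(2), of g]
  by (simp add: form_sum_left form_const_left assms(3))

lemma form_X_mult: "form (X r * g) h = form g (const (alpha * of_nat r) * pdiff r h)"
proof (rule form_eqI_left [OF linear_op_multl linear_op_id])
  fix b
  have "X r * single b 1 = single (single r 1 + b) 1" by (simp add: X_def mult_single)
  then show "form (X r * single b 1) h = form (single b 1) (const (alpha * of_nat r) * pdiff r h)"
    by (simp only: form_single_left lookup_const_mult lookup_pdiff norm_weight_add_single) (simp add: algebra_simps)
qed

lemma form_pdiff: "form (const (alpha * of_nat r) * pdiff r g) h = form g (X r * h)"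
  by (metis form_X_mult form_commute)

text \<open>The operator induced by \<open>xi_squares\<close> on polynomials in the power sums of weight at most \<open>M\<close>.
  The two summands of \<open>join_cut\<close> are adjoint to each other.\<close>

definition join_cut :: "nat \<Rightarrow> nat \<Rightarrow> mpol \<Rightarrow> mpol" where
  "join_cut r s g = const (alpha\<^sup>2 * of_nat (r * s)) * (X (r + s) * pdiff r (pdiff s g))
     + const (alpha * of_nat (r + s)) * (X r * (X s * pdiff (r + s) g))"

text \<open>The coefficient of p_r d/dp_r. Its three terms come from the squared derivations, the
  divided differences and the degree operator; the subtraction is taken in the field since
  \<open>r\<close> may exceed \<open>n\<close>.\<close>

definition diagonal_coeff :: "nat \<Rightarrow> nat \<Rightarrow> ratfun" where
  "diagonal_coeff n r = alpha\<^sup>2 * of_nat (r * r)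
     + alpha * of_nat r * (of_nat n - of_nat r) + of_nat (n - 1) * alpha * of_nat r"

definition power_sum_op :: "nat \<Rightarrow> nat \<Rightarrow> mpol \<Rightarrow> mpol" where
  "power_sum_op n M g = (\<Sum>(r, s)\<in>{(r, s). 1 \<le> r \<and> 1 \<le> s \<and> r + s \<le> M}. join_cut r s g)
     + (\<Sum>r\<in>{1..M}. const (diagonal_coeff n r) * (X r * pdiff r g))
     + of_nat (\<Sum>i<n. i\<^sup>2) * g"

lemma linear_op_join_cut: "linear_op (join_cut r s)"
  unfolding join_cut_def [abs_def]
  by (intro linear_op_plus linear_op_mult linear_op_comp [OF linear_op_pdiff] linear_op_pdiff)

lemma linear_op_power_sum_op: "linear_op (power_sum_op n M)"
  unfolding power_sum_op_def [abs_def] case_prod_beta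
  by (intro linear_op_plus linear_op_Sum linear_op_mult linear_op_join_cut linear_op_pdiff linear_op_id)

lemma form_join_cut:
  assumes "1 \<le> r" "1 \<le> s"
  shows "form (join_cut r s g) h = form g (join_cut s r h)"
proof -
  have a: "alpha \<noteq> 0" using alpha_pos by simp
  have "form (const (alpha\<^sup>2 * of_nat (r * s)) * (X (r + s) * pdiff r (pdiff s g))) h
     = form (pdiff r (pdiff s g)) (const (alpha\<^sup>2 * of_nat (r * s)) * (const (alpha * of_nat (r + s)) * pdiff (r + s) h))"
    by (simp only: form_const_left form_const_right form_X_mult)
  also have "\<dots> = form (const (alpha * of_nat r) * pdiff r (const (alpha * of_nat s) * pdiff s g))
      (const (alpha * of_nat (r + s)) * pdiff (r + s) h)"
    by (simp add: form_const_left form_const_right linear_op_const [OF linear_op_pdiff] power2_eq_square)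
  also have "\<dots> = form g (const (alpha * of_nat (s + r)) * (X s * (X r * pdiff (s + r) h)))"
    unfolding form_pdiff by (simp add: form_const_right mult.left_commute [of "X t" "const c" for c t] add.commute)
  finally have 1: "form (const (alpha\<^sup>2 * of_nat (r * s)) * (X (r + s) * pdiff r (pdiff s g))) h
     = form g (const (alpha * of_nat (s + r)) * (X s * (X r * pdiff (s + r) h)))" .
  have "form (const (alpha * of_nat (r + s)) * (X r * (X s * pdiff (r + s) g))) h
     = form (const (alpha * of_nat (r + s)) * pdiff (r + s) g) (const (alpha * of_nat s) * pdiff s (const (alpha * of_nat r) * pdiff r h))"
    by (simp only: form_const_left form_X_mult)
  also have "\<dots> = form g (const (alpha\<^sup>2 * of_nat (s * r)) * (X (s + r) * pdiff s (pdiff r h)))"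
    unfolding form_pdiff by (simp add: form_const_right linear_op_const [OF linear_op_pdiff]
        mult.left_commute [of "X t" "const c" for c t] power2_eq_square add.commute)
  finally show ?thesis using 1 by (simp only: join_cut_def form_add_left form_add_right add.commute)
qed

lemma form_power_sum_op: "form (power_sum_op n M g) h = form g (power_sum_op n M h)"
proof -
  let ?I = "{(r, s). 1 \<le> r \<and> 1 \<le> s \<and> r + s \<le> M}"
  \<comment> \<open>Taking adjoints swaps \<open>r\<close> and \<open>s\<close>, and the index set
    is symmetric.\<close>
  have "(\<Sum>x\<in>?I. form (case x of (r, s) \<Rightarrow> join_cut r s g) h) = (\<Sum>x\<in>?I. form g (case x of (r, s) \<Rightarrow> join_cut r s h))"
    by (rule sum.reindex_bij_witness [of _ prod.swap prod.swap]) (auto simp: form_join_cut)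
  moreover have "form (X r * pdiff r g) h = form g (X r * pdiff r h)" if "r \<in> {1..M}" for r
  proof -
    have "alpha * of_nat r * form (X r * pdiff r g) h = form (const (alpha * of_nat r) * pdiff r g) (const (alpha * of_nat r) * pdiff r h)"
      by (simp only: form_X_mult form_const_left)
    also have "\<dots> = alpha * of_nat r * form g (X r * pdiff r h)"
      by (simp only: form_pdiff mult.left_commute [of "X r"] form_const_right)
    finally show ?thesis using that alpha_pos by simp
  qed
  then have "(\<Sum>r\<in>{1..M}. diagonal_coeff n r * form (X r * pdiff r g) h)
      = (\<Sum>r\<in>{1..M}. diagonal_coeff n r * form g (X r * pdiff r h))"
    by (intro sum.cong refl) auto
  moreover have "form (of_nat k * g) h = form g (of_nat k * h)" for k
    by (simp add: form_const_left form_const_right flip: const_of_nat)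
  ultimately show ?thesis
    by (simp add: power_sum_op_def form_add_left form_add_right form_sum_left form_sum_right form_const_left form_const_right
        del: of_nat_sum cong: sum.cong)
qed

lemma weight_homogeneous_power_sum_op:
  assumes g: "weight_homogeneous N g"
  shows "weight_homogeneous N (power_sum_op n M g)"
proof -
  \<comment> \<open>Homogeneity of weight \<open>N - t\<close>, stated additively to avoid
    truncation: d/dp_r raises the deficit by \<open>r\<close> and multiplication by p_r lowers it
    again.\<close>
  define deficit where "deficit t h \<longleftrightarrow> (\<forall>b\<in>keys h. lookup b 0 = 0 \<and> weight b + t = N)" for t and h :: mpol
  have pd: "deficit (t + r) (pdiff r h)" if "deficit t h" "1 \<le> r" for t r h
    unfolding deficit_def
  proof
    fix b assume "b \<in> keys (pdiff r h)"
    then have "single r 1 + b \<in> keys h" by (auto simp: in_keys_iff lookup_pdiff)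
    then have "lookup (single r 1 + b) 0 = 0 \<and> weight (single r 1 + b) + t = N"
      using that(1) unfolding deficit_def by blast
    then show "lookup b 0 = 0 \<and> weight b + (t + r) = N"
      using that(2) by (simp add: lookup_add weight_add)
  qed
  have x: "deficit t (X r * h)" if "deficit (t + r) h" "1 \<le> r" for t r h
    unfolding deficit_def
  proof
    fix b assume "b \<in> keys (X r * h)"
    then obtain c where "c \<in> keys h" "b = single r 1 + c" using keys_single_mult unfolding X_def by blast
    then show "lookup b 0 = 0 \<and> weight b + t = N"
      using that unfolding deficit_def by (auto simp: lookup_add weight_add lookup_single)
  qed
  have eq: "weight_homogeneous N h \<longleftrightarrow> deficit 0 h" for h
    by (simp add: weight_homogeneous_def deficit_def)
  have "weight_homogeneous N (join_cut r s g)" if "1 \<le> r" "1 \<le> s" for r s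
  proof -
    have "deficit 0 (X (r + s) * pdiff r (pdiff s g))"
      using pd [OF pd [of 0 g s], of r] that g eq by (intro x) (auto simp: add.commute)
    moreover have "deficit 0 (X r * (X s * pdiff (r + s) g))"
      using pd [of 0 g "r + s"] that g eq by (intro x) auto
    ultimately show ?thesis
      unfolding join_cut_def by (intro weight_homogeneous_add weight_homogeneous_const) (simp_all add: eq)
  qed
  moreover have "weight_homogeneous N (X r * pdiff r g)" if "1 \<le> r" for r
    using pd [of 0 g r] x [of 0 r "pdiff r g"] that g by (simp add: eq)
  moreover have "weight_homogeneous N (of_nat k * g)" for k
    using weight_homogeneous_const [OF g, of "of_nat k"] by (simp add: const_of_nat)
  ultimately show ?thesis
    unfolding power_sum_op_def
    by (intro weight_homogeneous_add weight_homogeneous_sum weight_homogeneous_const) (auto simp del: of_nat_sum)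
qed

text \<open>For symmetric \<open>f\<close> the divided differences of \<open>f\<close> vanish and
  K_ij D_i f = D_j f, so only one layer of divided differences is left. Up to degree terms the
  result is the Laplace-Beltrami (Calogero-Sutherland) operator.\<close>

lemma xi_squares_symmetric:
  assumes f: "symmetric_poly n f"
  shows "xi_squares n f = const (alpha\<^sup>2) * (\<Sum>i<n. theta i (theta i f))
    + const alpha * (\<Sum>i<n. \<Sum>j\<in>{..<n} - {i}. quot i j (theta i f))
    + const (of_nat (n - 1) * alpha) * euler n f + of_nat (\<Sum>i<n. i\<^sup>2) * f"
proof -
  have q0: "quot i j f = 0" if "i < n" "j < n" "i \<noteq> j" for i j
    using that symmetric_poly_swap [OF f] by (intro quot_invariant) auto
  have D: "dunkl n i f = const alpha * theta i f" if "i < n" for i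
    using that q0 by (simp add: dunkl_eq)
  have swap: "swap j i f = f" if "i < n" "j < i" for i j
    using that by (intro symmetric_poly_swap [OF f]) auto
  have "xi n i (xi n i f) = dunkl n i (dunkl n i f) + (\<Sum>j<i. dunkl n j f) + of_nat i * dunkl n i f + of_nat (i\<^sup>2) * f"
    if i: "i < n" for i
  proof -
    have 1: "xi n i f = dunkl n i f + of_nat i * f"
      using i swap by (simp add: xi_def)
    have "(\<Sum>j<i. swap j i (dunkl n i f)) = (\<Sum>j<i. dunkl n j f)"
      using i by (intro sum.cong refl) (simp add: swap_dunkl swap)
    then have "xi n i (dunkl n i f) = dunkl n i (dunkl n i f) + (\<Sum>j<i. dunkl n j f)"
      by (simp add: xi_def)
    then have "xi n i (xi n i f) = dunkl n i (dunkl n i f) + (\<Sum>j<i. dunkl n j f) + of_nat i * (dunkl n i f + of_nat i * f)"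
      by (simp only: 1 xi_add xi_of_nat)
    then show ?thesis
      by (simp add: power2_eq_square algebra_simps)
  qed
  then have "xi_squares n f = (\<Sum>i<n. dunkl n i (dunkl n i f)) + ((\<Sum>i<n. \<Sum>j<i. dunkl n j f) + (\<Sum>i<n. of_nat i * dunkl n i f))
      + of_nat (\<Sum>i<n. i\<^sup>2) * f"
    by (simp add: xi_squares_def sum.distrib sum_distrib_left algebra_simps)
  \<comment> \<open>Every ordered pair of distinct indices contributes one D_i f, whence the factor
    n - 1.\<close>
  also have "(\<Sum>i<n. \<Sum>j<i. dunkl n j f) + (\<Sum>i<n. of_nat i * dunkl n i f) = (\<Sum>i<n. \<Sum>j\<in>{..<n} - {i}. dunkl n i f)"
    unfolding sum_off_diagonal by (simp add: sum.distrib add.commute)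
  also have "\<dots> = const (of_nat (n - 1) * alpha) * euler n f"
    by (simp add: D euler_def sum_distrib_left const_mult const_of_nat mult.assoc)
  also have "(\<Sum>i<n. dunkl n i (dunkl n i f)) = const (alpha\<^sup>2) * (\<Sum>i<n. theta i (theta i f))
    + const alpha * (\<Sum>i<n. \<Sum>j\<in>{..<n} - {i}. quot i j (theta i f))"
  proof -
    have "dunkl n i (dunkl n i f) = const (alpha\<^sup>2) * theta i (theta i f) + const alpha * (\<Sum>j\<in>{..<n} - {i}. quot i j (theta i f))"
      if "i < n" for i
      unfolding D [OF that] dunkl_const by (simp add: dunkl_eq const_mult power2_eq_square distrib_left mult.assoc)
    then show ?thesis by (simp add: sum.distrib sum_distrib_left)
  qed
  finally show ?thesis by (simp add: add_ac)
qed

section \<open>The operator Z in terms of power sums\<close>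

lemma quot_power:
  assumes "i \<noteq> j"
  shows "quot i j (X i ^ r) = (\<Sum>s\<in>{1..r}. X i ^ s * X j ^ (r - s))"
proof (rule quot_eqI [OF assms])
  have pow: "swap i j (X i ^ r) = X j ^ r"
    by (induction r) (simp_all add: perm_mult)
  have "(\<Sum>s\<in>{1..r}. X i ^ s * X j ^ (r - s)) = (\<Sum>c<r. X i * (X j ^ (r - Suc c) * X i ^ c))"
    by (rule sum.reindex_bij_witness [of _ Suc "\<lambda>s. s - 1"]) (auto simp flip: power_Suc)
  then have "(X i - X j) * (\<Sum>s\<in>{1..r}. X i ^ s * X j ^ (r - s)) = X i * ((X i - X j) * (\<Sum>c<r. X j ^ (r - Suc c) * X i ^ c))"
    by (simp add: sum_distrib_left mult.left_commute)
  then show "(X i - X j) * (\<Sum>s\<in>{1..r}. X i ^ s * X j ^ (r - s)) = X i * (X i ^ r - swap i j (X i ^ r))"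
    unfolding pow power_diff_sumr2 [symmetric] by (simp add: power_diff_sumr2 mult.commute)
qed

text \<open>The summand s = r contains p_0 = n, and the missing diagonal i = j costs p_r for each of
  the \<open>r\<close> values of \<open>s\<close>; together they give (n - r) p_r.\<close>

lemma sum_quot_power:
  assumes "1 \<le> r"
  shows "(\<Sum>i<n. \<Sum>j\<in>{..<n} - {i}. quot i j (X i ^ r)) = (of_nat n - of_nat r) * power_sum_poly n r
    + (\<Sum>s\<in>{1..<r}. power_sum_poly n s * power_sum_poly n (r - s))"
proof -
  have off: "(\<Sum>i<n. \<Sum>j\<in>{..<n} - {i}. g i j) = (\<Sum>i<n. \<Sum>j<n. g i j) - (\<Sum>i<n. g i i)" for g :: "nat \<Rightarrow> nat \<Rightarrow> mpol"
    unfolding sum_subtractf [symmetric] by (intro sum.cong refl) (simp add: sum_diff1)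
  have "(\<Sum>i<n. \<Sum>j\<in>{..<n} - {i}. quot i j (X i ^ r)) = (\<Sum>i<n. \<Sum>j\<in>{..<n} - {i}. \<Sum>s\<in>{1..r}. X i ^ s * X j ^ (r - s))"
    by (intro sum.cong refl) (auto simp: quot_power)
  also have "\<dots> = (\<Sum>s\<in>{1..r}. \<Sum>i<n. \<Sum>j\<in>{..<n} - {i}. X i ^ s * X j ^ (r - s))"
    by (simp only: sum.swap [of _ "{1..r}"])
  also have "\<dots> = (\<Sum>s\<in>{1..r}. power_sum_poly n s * power_sum_poly n (r - s) - power_sum_poly n r)"
  proof (intro sum.cong refl)
    fix s assume "s \<in> {1..r}"
    then have "(\<Sum>i<n. X i ^ s * X i ^ (r - s)) = power_sum_poly n r"
      by (simp add: power_sum_poly_def flip: power_add)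
    then show "(\<Sum>i<n. \<Sum>j\<in>{..<n} - {i}. X i ^ s * X j ^ (r - s)) = power_sum_poly n s * power_sum_poly n (r - s) - power_sum_poly n r"
      unfolding off by (simp add: power_sum_poly_def sum_product)
  qed
  also have "{1..r} = insert r {1..<r}" using assms by auto
  finally show ?thesis
    by (simp add: sum_subtractf power_sum_poly_def [of n 0] algebra_simps) (use assms in \<open>simp add: of_nat_diff algebra_simps\<close>)
qed

text \<open>The exponent of the derivative by p_r. If p_r does not occur, the factor
  \<open>lookup b r\<close> in front is zero.\<close>

definition lower :: "nat \<Rightarrow> exponent \<Rightarrow> exponent" where
  "lower r b = b - single r 1"

lemma theta_power: "theta i (f ^ k) = of_nat k * (f ^ (k - 1) * theta i f)"
proof (induction k)
  case (Suc k)
  then show ?case by (cases k) (simp_all add: theta_mult algebra_simps)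
qed simp

lemma theta_power_sum_poly: "i < n \<Longrightarrow> theta i (power_sum_poly n r) = of_nat r * X i ^ r"
proof -
  assume i: "i < n"
  have "theta i (X k ^ r) = (if k = i then of_nat r * X i ^ r else 0)" for k
    unfolding theta_power theta_X by (cases r) (auto simp: mult_ac)
  then show ?thesis
    using i by (simp add: power_sum_poly_def linear_op_sum [OF linear_op_theta])
qed

lemma theta_power_sum_monom_aux:
  assumes "i < n" "finite A"
  shows "theta i (\<Prod>r\<in>A. power_sum_poly n r ^ lookup b r)
    = (\<Sum>r\<in>A. of_nat (lookup b r * r) * (X i ^ r * (power_sum_poly n r ^ (lookup b r - 1) * (\<Prod>s\<in>A - {r}. power_sum_poly n s ^ lookup b s))))"
  using assms(2)
proof (induction A rule: finite_induct)
  case (insert t A)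
  let ?p = "\<lambda>s. power_sum_poly n s ^ lookup b s"
  have "(\<Prod>s\<in>insert t A - {r}. ?p s) = ?p t * (\<Prod>s\<in>A - {r}. ?p s)" if "r \<in> A" for r
  proof -
    have "insert t A - {r} = insert t (A - {r})" using insert that by auto
    then show ?thesis using insert by simp
  qed
  then have "(\<Sum>r\<in>A. of_nat (lookup b r * r) * (X i ^ r * (power_sum_poly n r ^ (lookup b r - 1) * (\<Prod>s\<in>insert t A - {r}. ?p s))))
    = ?p t * (\<Sum>r\<in>A. of_nat (lookup b r * r) * (X i ^ r * (power_sum_poly n r ^ (lookup b r - 1) * (\<Prod>s\<in>A - {r}. ?p s))))"
    unfolding sum_distrib_left by (intro sum.cong refl) (simp add: mult_ac)
  moreover have "insert t A - {t} = A" using insert by auto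
  moreover have "theta i (?p t) = of_nat (lookup b t * t) * (X i ^ t * power_sum_poly n t ^ (lookup b t - 1))"
    using assms(1) by (simp add: theta_power theta_power_sum_poly mult_ac)
  ultimately show ?case
    using insert by (simp add: theta_mult mult_ac)
qed simp

text \<open>The chain rule with theta_i p_r = r x_i^r.\<close>

lemma theta_power_sum_monom:
  assumes "i < n" "finite A" "keys b \<subseteq> A"
  shows "theta i (power_sum_monom n b)
    = (\<Sum>r\<in>A. const (of_nat (lookup b r) * of_nat r) * (X i ^ r * power_sum_monom n (lower r b)))"
  unfolding power_sum_monom_eq_prod [OF assms(2,3)] theta_power_sum_monom_aux [OF assms(1,2)]
proof (intro sum.cong refl)
  fix r assume r: "r \<in> A"
  have "keys (lower r b) \<subseteq> A"
    using assms(3) by (auto simp: lower_def in_keys_iff lookup_minus subset_eq)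
  then have "power_sum_monom n (lower r b) = (\<Prod>s\<in>A. power_sum_poly n s ^ lookup (lower r b) s)"
    by (rule power_sum_monom_eq_prod [OF assms(2)])
  also have "\<dots> = power_sum_poly n r ^ lookup (lower r b) r * (\<Prod>s\<in>A - {r}. power_sum_poly n s ^ lookup (lower r b) s)"
    by (rule prod.remove [OF assms(2) r])
  also have "(\<Prod>s\<in>A - {r}. power_sum_poly n s ^ lookup (lower r b) s) = (\<Prod>s\<in>A - {r}. power_sum_poly n s ^ lookup b s)"
    by (intro prod.cong) (auto simp: lower_def lookup_minus lookup_single)
  also have "lookup (lower r b) r = lookup b r - 1" by (simp add: lower_def lookup_minus)
  finally show "of_nat (lookup b r * r) * (X i ^ r * (power_sum_poly n r ^ (lookup b r - 1) * (\<Prod>s\<in>A - {r}. power_sum_poly n s ^ lookup b s)))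
     = const (of_nat (lookup b r) * of_nat r) * (X i ^ r * power_sum_monom n (lower r b))"
    by (simp flip: const_of_nat)
qed

lemma eval_power_sums_add: "eval_power_sums n (f + g) = eval_power_sums n f + eval_power_sums n g"
  and eval_power_sums_const: "eval_power_sums n (const c * f) = const c * eval_power_sums n f"
  and eval_power_sums_sum: "eval_power_sums n (sum F A) = (\<Sum>i\<in>A. eval_power_sums n (F i))"
  and eval_power_sums_of_nat: "eval_power_sums n (of_nat k * f) = of_nat k * eval_power_sums n f"
  using linear_op_add [OF linear_op_eval_power_sums] linear_op_const [OF linear_op_eval_power_sums]
    linear_op_sum [OF linear_op_eval_power_sums] linear_op_of_nat [OF linear_op_eval_power_sums] by blast+

lemma eval_power_sums_X: "eval_power_sums n (X r * g) = power_sum_poly n r * eval_power_sums n g"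
proof (rule linear_op_eqI [OF linear_op_comp [OF linear_op_eval_power_sums linear_op_multl [of "X r"]]
     linear_op_mult [OF linear_op_eval_power_sums, of "power_sum_poly n r"]])
  fix b
  have "X r * single b 1 = single (single r 1 + b) 1" by (simp add: X_def mult_single)
  then show "eval_power_sums n (X r * single b 1) = power_sum_poly n r * eval_power_sums n (single b 1)"
    by (simp only: eval_power_sums_single power_sum_monom_add power_sum_monom_single)
qed

lemma eval_power_sums_pdiff:
  "eval_power_sums n (pdiff r (single b 1)) = const (of_nat (lookup b r)) * power_sum_monom n (lower r b)"
  by (simp only: pdiff_single eval_power_sums_const eval_power_sums_single lower_def)

lemma eval_power_sums_pdiff_pdiff:
  "eval_power_sums n (pdiff r (pdiff s (single b 1)))
    = const (of_nat (lookup b s) * of_nat (lookup (lower s b) r)) * power_sum_monom n (lower r (lower s b))"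
  by (simp only: pdiff_single linear_op_const [OF linear_op_pdiff] eval_power_sums_const eval_power_sums_single
      lower_def const_mult mult.assoc)

text \<open>Second derivatives join two power sums, since x_i^r x_i^s sums to p_{r+s}; divided
  differences cut p_r into p_s p_{r-s}. The bound \<open>M\<close> on the weight captures every
  index that can occur.\<close>

lemma xi_squares_power_sum_monom:
  assumes b: "lookup b 0 = 0" "weight b \<le> M"
  shows "xi_squares n (power_sum_monom n b) = eval_power_sums n (power_sum_op n M (single b 1))"
proof -
  let ?P = "power_sum_monom n" and ?p = "power_sum_poly n"
  let ?c = "\<lambda>r. of_nat (lookup b r) * of_nat r :: ratfun"
  let ?d = "\<lambda>r s. of_nat (lookup (lower r b) s) * of_nat s :: ratfun"
  let ?A = "{1..M}"
  have le_weight: "r * lookup c r \<le> weight c" for r and c :: exponent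
  proof (cases "r \<in> keys c")
    case True
    then show ?thesis unfolding weight_def by (intro member_le_sum) auto
  qed (simp add: in_keys_iff)
  have A: "keys b \<subseteq> ?A"
  proof
    fix r assume r: "r \<in> keys b"
    then have "r \<noteq> 0" "1 \<le> lookup b r" using b(1) by (auto simp: in_keys_iff intro: gr0I)
    then have "r * 1 \<le> r * lookup b r" by (intro mult_le_mono) auto
    then have "r \<le> M" using le_weight [of r b] b(2) by linarith
    then show "r \<in> ?A" using \<open>r \<noteq> 0\<close> by simp
  qed
  have A': "keys (lower r b) \<subseteq> ?A" for r
    using A by (auto simp: lower_def in_keys_iff lookup_minus subset_eq)
  note th = theta_power_sum_monom [OF _ _ A]
  have sum1: "(\<Sum>i<n. X i ^ r) = ?p r" for r by (simp add: power_sum_poly_def)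
  have euler: "euler n (?P b) = (\<Sum>r\<in>?A. const (?c r) * (?p r * ?P (lower r b)))"
  proof -
    have "euler n (?P b) = (\<Sum>i<n. \<Sum>r\<in>?A. const (?c r) * (X i ^ r * ?P (lower r b)))"
      unfolding euler_def by (intro sum.cong refl th) auto
    also have "\<dots> = (\<Sum>r\<in>?A. const (?c r) * ((\<Sum>i<n. X i ^ r) * ?P (lower r b)))"
      by (subst sum.swap) (simp add: sum_distrib_left sum_distrib_right)
    finally show ?thesis by (simp add: sum1)
  qed
  have "(\<Sum>i<n. \<Sum>j\<in>{..<n} - {i}. quot i j (theta i (?P b)))
      = (\<Sum>i<n. \<Sum>j\<in>{..<n} - {i}. \<Sum>r\<in>?A. const (?c r) * (?P (lower r b) * quot i j (X i ^ r)))"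
  proof (intro sum.cong refl)
    fix i j assume ij: "i \<in> {..<n}" "j \<in> {..<n} - {i}"
    have "quot i j (?P c * g) = ?P c * quot i j g" for c g
      using ij by (intro quot_mult_symmetric symmetric_poly_swap [OF symmetric_power_sum_monom]) auto
    then show "quot i j (theta i (?P b)) = (\<Sum>r\<in>?A. const (?c r) * (?P (lower r b) * quot i j (X i ^ r)))"
      using ij by (simp add: th linear_op_sum [OF linear_op_quot] linear_op_const [OF linear_op_quot] mult.commute [of _ "?P _"])
  qed
  also have "\<dots> = (\<Sum>r\<in>?A. \<Sum>i<n. \<Sum>j\<in>{..<n} - {i}. const (?c r) * (?P (lower r b) * quot i j (X i ^ r)))"
    by (simp only: sum.swap [of _ ?A])
  also have "\<dots> = (\<Sum>r\<in>?A. const (?c r) * (?P (lower r b) * (\<Sum>i<n. \<Sum>j\<in>{..<n} - {i}. quot i j (X i ^ r))))"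
    by (simp add: sum_distrib_left)
  also have "\<dots> = (\<Sum>r\<in>?A. const (?c r * (of_nat n - of_nat r)) * (?p r * ?P (lower r b))
      + (\<Sum>s\<in>{1..<r}. const (?c r) * (?p s * (?p (r - s) * ?P (lower r b)))))"
  proof (intro sum.cong refl)
    fix r assume "r \<in> ?A"
    then have "1 \<le> r" by simp
    have *: "const (of_nat n - of_nat r) = (of_nat n - of_nat r :: mpol)"
      by (simp add: const_diff const_of_nat)
    show "const (?c r) * (?P (lower r b) * (\<Sum>i<n. \<Sum>j\<in>{..<n} - {i}. quot i j (X i ^ r)))
      = const (?c r * (of_nat n - of_nat r)) * (?p r * ?P (lower r b))
      + (\<Sum>s\<in>{1..<r}. const (?c r) * (?p s * (?p (r - s) * ?P (lower r b))))"
      unfolding sum_quot_power [OF \<open>1 \<le> r\<close>] const_mult [of "?c r"] * distrib_left sum_distrib_left by (simp only: mult_ac)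
  qed
  finally have cut: "(\<Sum>i<n. \<Sum>j\<in>{..<n} - {i}. quot i j (theta i (?P b))) =
      (\<Sum>r\<in>?A. const (?c r * (of_nat n - of_nat r)) * (?p r * ?P (lower r b)))
      + (\<Sum>r\<in>?A. \<Sum>s\<in>{1..<r}. const (?c r) * (?p s * (?p (r - s) * ?P (lower r b))))"
    by (simp add: sum.distrib)
  have th_pow: "theta i (X i ^ r) = const (of_nat r) * X i ^ r" for i r
    unfolding theta_power theta_X const_of_nat by (cases r) (auto simp: mult_ac)
  have "(\<Sum>i<n. theta i (theta i (?P b))) = (\<Sum>i<n. \<Sum>r\<in>?A. const (?c r * of_nat r) * (X i ^ r * ?P (lower r b))
      + (\<Sum>s\<in>?A. const (?c r * ?d r s) * (X i ^ (r + s) * ?P (lower s (lower r b)))))"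
  proof (intro sum.cong refl)
    fix i assume "i \<in> {..<n}"
    then have i: "i < n" by simp
    have "theta i (const (?c r) * (X i ^ r * ?P (lower r b))) = const (?c r * of_nat r) * (X i ^ r * ?P (lower r b))
      + (\<Sum>s\<in>?A. const (?c r * ?d r s) * (X i ^ (r + s) * ?P (lower s (lower r b))))" for r
    proof -
      have "theta i (const (?c r) * (X i ^ r * ?P (lower r b)))
         = const (?c r) * (const (of_nat r) * X i ^ r * ?P (lower r b) + X i ^ r *
             (\<Sum>s\<in>?A. const (?d r s) * (X i ^ s * ?P (lower s (lower r b)))))"
        by (simp only: linear_op_const [OF linear_op_theta] theta_mult theta_const mult_zero_left add_0 th_pow theta_power_sum_monom [OF i _ A'] finite_atLeastAtMost)
      then show ?thesis
        by (simp only: distrib_left sum_distrib_left const_mult power_add mult_ac)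
    qed
    then show "theta i (theta i (?P b)) = (\<Sum>r\<in>?A. const (?c r * of_nat r) * (X i ^ r * ?P (lower r b))
      + (\<Sum>s\<in>?A. const (?c r * ?d r s) * (X i ^ (r + s) * ?P (lower s (lower r b)))))"
      using i by (simp only: th finite_atLeastAtMost linear_op_sum [OF linear_op_theta])
  qed
  also have "\<dots> = (\<Sum>r\<in>?A. \<Sum>i<n. const (?c r * of_nat r) * (X i ^ r * ?P (lower r b)))
      + (\<Sum>r\<in>?A. \<Sum>s\<in>?A. \<Sum>i<n. const (?c r * ?d r s) * (X i ^ (r + s) * ?P (lower s (lower r b))))"
    by (simp only: sum.distrib sum.swap [of _ _ "{..<n}"])
  also have "\<dots> = (\<Sum>r\<in>?A. const (?c r * of_nat r) * (?p r * ?P (lower r b)))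
      + (\<Sum>r\<in>?A. \<Sum>s\<in>?A. const (?c r * ?d r s) * (?p (r + s) * ?P (lower s (lower r b))))"
    by (simp only: sum_distrib_left [symmetric] sum_distrib_right [symmetric] sum1)
  finally have join: "(\<Sum>i<n. theta i (theta i (?P b))) =
      (\<Sum>r\<in>?A. const (?c r * of_nat r) * (?p r * ?P (lower r b)))
      + (\<Sum>r\<in>?A. \<Sum>s\<in>?A. const (?c r * ?d r s) * (?p (r + s) * ?P (lower s (lower r b))))" .
  let ?I = "{(r, s). 1 \<le> r \<and> 1 \<le> s \<and> r + s \<le> M}"
  have joinI: "(\<Sum>r\<in>?A. \<Sum>s\<in>?A. const (?c r * ?d r s) * (?p (r + s) * ?P (lower s (lower r b))))
     = (\<Sum>(r, s)\<in>?I. const (?c s * ?d s r) * (?p (r + s) * ?P (lower r (lower s b))))"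
  proof -
    \<comment> \<open>Removing p_r and then p_s from \<open>b\<close> is only possible if r + s is
      at most the weight of \<open>b\<close>.\<close>
    have z: "?c r * ?d r s = 0" if "\<not> r + s \<le> M" for r s
    proof (rule ccontr)
      assume "?c r * ?d r s \<noteq> 0"
      then have *: "lookup b r \<noteq> 0" "lookup (lower r b) s \<noteq> 0" by auto
      have "weight b = r + weight (lower r b)"
        using exponent_decompose [OF *(1)] weight_add [of "single r 1" "lower r b"] by (simp add: lower_def)
      moreover have "s * 1 \<le> s * lookup (lower r b) s" using *(2) by (intro mult_le_mono) auto
      ultimately have "r + s \<le> weight b" using le_weight [of s "lower r b"] by linarith
      then show False using that b(2) by simp
    qed
    have "(\<Sum>(r, s)\<in>?A \<times> ?A. const (?c r * ?d r s) * (?p (r + s) * ?P (lower s (lower r b))))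
      = (\<Sum>(r, s)\<in>?I. const (?c r * ?d r s) * (?p (r + s) * ?P (lower s (lower r b))))"
    proof (rule sum.mono_neutral_right)
      show "\<forall>x\<in>?A \<times> ?A - ?I. (case x of (r, s) \<Rightarrow> const (?c r * ?d r s) * (?p (r + s) * ?P (lower s (lower r b)))) = 0"
      proof
        fix x assume "x \<in> ?A \<times> ?A - ?I"
        then obtain r s where x: "x = (r, s)" "\<not> r + s \<le> M" by auto
        show "(case x of (r, s) \<Rightarrow> const (?c r * ?d r s) * (?p (r + s) * ?P (lower s (lower r b)))) = 0"
          unfolding x(1) prod.case z [OF x(2)] by simp
      qed
    qed auto
    also have "\<dots> = (\<Sum>(r, s)\<in>?I. const (?c s * ?d s r) * (?p (r + s) * ?P (lower r (lower s b))))"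
      by (rule sum.reindex_bij_witness [of _ prod.swap prod.swap]) (auto simp: add.commute)
    finally show ?thesis by (simp add: sum.cartesian_product)
  qed
  \<comment> \<open>The cut of p_t into p_s and p_{t-s} is indexed by its two pieces.\<close>
  have cutI: "(\<Sum>r\<in>?A. \<Sum>s\<in>{1..<r}. const (?c r) * (?p s * (?p (r - s) * ?P (lower r b))))
     = (\<Sum>(r, s)\<in>?I. const (?c (r + s)) * (?p r * (?p s * ?P (lower (r + s) b))))"
    unfolding sum.Sigma [OF finite_atLeastAtMost ballI, OF finite_atLeastLessThan]
    by (rule sum.reindex_bij_witness [of _ "\<lambda>(r, s). (r + s, r)" "\<lambda>(t, s). (s, t - s)"]) auto
  have "eval_power_sums n (power_sum_op n M (single b 1)) =
    (\<Sum>(r, s)\<in>?I. const (alpha\<^sup>2) * (const (?c s * ?d s r) * (?p (r + s) * ?P (lower r (lower s b))))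
        + const alpha * (const (?c (r + s)) * (?p r * (?p s * ?P (lower (r + s) b)))))
    + (\<Sum>r\<in>?A. const (diagonal_coeff n r * of_nat (lookup b r)) * (?p r * ?P (lower r b))) + of_nat (\<Sum>i<n. i\<^sup>2) * ?P b"
  proof -
    have "eval_power_sums n (join_cut r s (single b 1)) =
       const (alpha\<^sup>2) * (const (?c s * ?d s r) * (?p (r + s) * ?P (lower r (lower s b))))
        + const alpha * (const (?c (r + s)) * (?p r * (?p s * ?P (lower (r + s) b))))" for r s
      by (simp only: join_cut_def eval_power_sums_add eval_power_sums_const eval_power_sums_X eval_power_sums_pdiff
          eval_power_sums_pdiff_pdiff const_mult of_nat_mult mult_ac)
    moreover have "eval_power_sums n (const (diagonal_coeff n r) * (X r * pdiff r (single b 1)))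
       = const (diagonal_coeff n r * of_nat (lookup b r)) * (?p r * ?P (lower r b))" for r
      by (simp only: eval_power_sums_const eval_power_sums_X eval_power_sums_pdiff const_mult mult_ac)
    ultimately show ?thesis
      unfolding power_sum_op_def
      by (simp only: eval_power_sums_add eval_power_sums_sum eval_power_sums_of_nat eval_power_sums_single split_def)
  qed
  also have "(\<Sum>r\<in>?A. const (diagonal_coeff n r * of_nat (lookup b r)) * (?p r * ?P (lower r b)))
     = const (alpha\<^sup>2) * (\<Sum>r\<in>?A. const (?c r * of_nat r) * (?p r * ?P (lower r b)))
     + const alpha * (\<Sum>r\<in>?A. const (?c r * (of_nat n - of_nat r)) * (?p r * ?P (lower r b)))
     + const (of_nat (n - 1) * alpha) * (\<Sum>r\<in>?A. const (?c r) * (?p r * ?P (lower r b)))"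
  proof -
    have "diagonal_coeff n r * of_nat (lookup b r) = alpha\<^sup>2 * (?c r * of_nat r) + alpha * (?c r * (of_nat n - of_nat r))
        + of_nat (n - 1) * alpha * ?c r" for r
      by (simp add: diagonal_coeff_def algebra_simps)
    then show ?thesis
      by (simp only: const_add distrib_right sum.distrib sum_distrib_left const_mult mult.assoc)
  qed
  also have "(\<Sum>(r, s)\<in>?I. const (alpha\<^sup>2) * (const (?c s * ?d s r) * (?p (r + s) * ?P (lower r (lower s b))))
        + const alpha * (const (?c (r + s)) * (?p r * (?p s * ?P (lower (r + s) b)))))
    = const (alpha\<^sup>2) * (\<Sum>(r, s)\<in>?I. const (?c s * ?d s r) * (?p (r + s) * ?P (lower r (lower s b))))
      + const alpha * (\<Sum>(r, s)\<in>?I. const (?c (r + s)) * (?p r * (?p s * ?P (lower (r + s) b))))"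
    by (simp only: split_def sum.distrib sum_distrib_left)
  finally show ?thesis
    unfolding xi_squares_symmetric [OF symmetric_power_sum_monom] join cut euler joinI cutI
    by (simp only: distrib_left add_ac)
qed

lemma xi_squares_eval_power_sums:
  assumes "weight_homogeneous N g" "N \<le> M"
  shows "xi_squares n (eval_power_sums n g) = eval_power_sums n (power_sum_op n M g)"
  by (rule linear_op_eqI [OF linear_op_comp [OF linear_op_xi_squares linear_op_eval_power_sums]
     linear_op_comp [OF linear_op_eval_power_sums linear_op_power_sum_op]])
    (use assms in \<open>auto simp: eval_power_sums_single weight_homogeneous_def intro!: xi_squares_power_sum_monom\<close>)

section \<open>Jack symmetric functions\<close>

text \<open>A series may have infinite support, so it is compared with a polynomial only on
  monomials in the first \<open>n\<close> variables.\<close>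

definition agrees :: "nat \<Rightarrow> series \<Rightarrow> mpol \<Rightarrow> bool" where
  "agrees n f F \<longleftrightarrow> (\<forall>a. keys a \<subseteq> {..<n} \<longrightarrow> f a = lookup F a)"

lemma agrees_series_one: "agrees n series_one 1"
  by (simp add: agrees_def series_one_def lookup_one when_def)

text \<open>For r = 0 the constant coefficients would be 1 and \<open>n\<close>.\<close>

lemma agrees_power_sum:
  assumes "1 \<le> r"
  shows "agrees n (power_sum r) (power_sum_poly n r)"
  unfolding agrees_def
proof (intro allI impI)
  fix a :: exponent assume a: "keys a \<subseteq> {..<n}"
  have "lookup (power_sum_poly n r) a = (\<Sum>k<n. if single k r = a then 1 else 0)"
    by (simp add: power_sum_poly_def lookup_sum lookup_single when_def flip: single_power)
  also have "\<dots> = power_sum r a"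
  proof (cases "\<exists>k. a = single k r")
    case True
    then obtain k where k: "a = single k r" by blast
    then have "k < n" using a assms by simp
    have "single j r = a \<longleftrightarrow> j = k" for j
    proof
      assume "single j r = a"
      then have "keys (single j r) = keys (single k r)" by (simp add: k)
      then show "j = k" using assms by simp
    qed (simp add: k)
    then show ?thesis using \<open>k < n\<close> True by (simp add: power_sum_def)
  next
    case False
    then show ?thesis by (auto simp: power_sum_def intro!: sum.neutral)
  qed
  finally show "power_sum r a = lookup (power_sum_poly n r) a" ..
qed

lemma agrees_series_mult:
  assumes "agrees n f F" "agrees n g G"
  shows "agrees n (series_mult f g) (F * G)"
  unfolding agrees_def
proof (intro allI impI)
  fix a :: exponent assume a: "keys a \<subseteq> {..<n}"
  define T where "T = {b. \<exists>c. b + c = a}"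
  have T: "keys b \<subseteq> {..<n} \<and> psize b \<le> psize a" "b + (a - b) = a" "keys (a - b) \<subseteq> {..<n}" if "b \<in> T" for b
  proof -
    obtain c where c: "b + c = a" using \<open>b \<in> T\<close> by (auto simp: T_def)
    then show "keys b \<subseteq> {..<n} \<and> psize b \<le> psize a" "b + (a - b) = a" "keys (a - b) \<subseteq> {..<n}"
      using a by (auto simp: keys_add_exponent psize_add simp flip: c)
  qed
  have fin: "finite T"
    by (rule finite_subset [OF _ finite_bounded_exponents [of n "psize a"]]) (use T in auto)
  have "series_mult f g a = (\<Sum>b\<in>T. f b * g (a - b))"
    unfolding series_mult_def
    by (rule sum.reindex_bij_witness [of _ "\<lambda>b. (b, a - b)" fst]) (use T in \<open>auto simp: T_def\<close>)
  also have "\<dots> = (\<Sum>b\<in>T. lookup F b * lookup G (a - b))"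
    using T assms by (intro sum.cong refl) (simp add: agrees_def)
  also have "\<dots> = (\<Sum>b\<in>T. lookup F b * lookup (single b 1 * G) a)"
  proof (intro sum.cong refl)
    fix b assume "b \<in> T"
    then show "lookup F b * lookup G (a - b) = lookup F b * lookup (single b 1 * G) a"
      using lookup_single_mult_add [of b G "a - b"] T(2) by simp
  qed
  also have "\<dots> = (\<Sum>b\<in>T \<inter> keys F. lookup F b * lookup (single b 1 * G) a)"
    using fin by (intro sum.mono_neutral_right) (auto simp: in_keys_iff)
  also have "\<dots> = (\<Sum>b\<in>keys F. lookup F b * lookup (single b 1 * G) a)"
  proof (intro sum.mono_neutral_left ballI)
    fix b assume "b \<in> keys F - T \<inter> keys F"
    then have "b \<notin> T" by blast
    then have "a \<notin> keys (single b 1 * G)" using keys_single_mult [of a b G] by (auto simp: T_def)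
    then show "lookup F b * lookup (single b 1 * G) a = 0" by (simp add: in_keys_iff)
  qed auto
  also have "\<dots> = lookup (F * G) a"
    by (subst linear_op_expand [OF linear_op_multr [of G], of F]) (simp add: lookup_sum)
  finally show "series_mult f g a = lookup (F * G) a" .
qed

lemma partition_keys:
  assumes "is_partition l"
  shows "keys l = {..<plength l}"
proof -
  have "keys l \<subseteq> {..<card (keys l)}"
  proof
    fix i assume "i \<in> keys l"
    then have "{..i} \<subseteq> keys l" using assms by (force simp: is_partition_def in_keys_iff)
    then have "card {..i} \<le> card (keys l)" by (intro card_mono) auto
    then show "i \<in> {..<card (keys l)}" by simp
  qed
  then show ?thesis unfolding plength_def by (intro card_subset_eq) auto
qed

lemma power_sum_monom_sum: "finite A \<Longrightarrow> power_sum_monom n (\<Sum>i\<in>A. f i) = (\<Prod>i\<in>A. power_sum_monom n (f i))"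
  by (induction A rule: finite_induct) (simp_all add: power_sum_monom_add)

lemma agrees_p_sym:
  assumes "is_partition l"
  shows "agrees n (p_sym l) (power_sum_monom n (part_counts l))"
proof -
  have "agrees n (foldr (\<lambda>i. series_mult (power_sum (lookup l i))) is series_one) (\<Prod>i\<leftarrow>is. power_sum_poly n (lookup l i))"
    if "set is \<subseteq> keys l" for "is"
    using that
  proof (induction "is")
    case (Cons i "is")
    then have "1 \<le> lookup l i" by (auto simp: in_keys_iff)
    then show ?case using Cons by (simp add: agrees_series_mult agrees_power_sum)
  qed (simp add: agrees_series_one)
  from this [of "[0..<plength l]"] have "agrees n (p_sym l) (\<Prod>i\<leftarrow>[0..<plength l]. power_sum_poly n (lookup l i))"
    unfolding p_sym_def using partition_keys [OF assms] by (simp add: subset_eq)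
  also have "(\<Prod>i\<leftarrow>[0..<plength l]. power_sum_poly n (lookup l i)) = (\<Prod>i\<in>keys l. power_sum_poly n (lookup l i))"
    using partition_keys [OF assms] prod.distinct_set_conv_list [of "[0..<plength l]" "\<lambda>i. power_sum_poly n (lookup l i)"]
    by (simp add: lessThan_atLeast0)
  also have "\<dots> = power_sum_monom n (part_counts l)"
    by (simp add: part_counts_def power_sum_monom_sum power_sum_monom_single)
  finally show ?thesis .
qed

definition homogeneous_series :: "nat \<Rightarrow> series \<Rightarrow> bool" where
  "homogeneous_series N f \<longleftrightarrow> (\<forall>p a. bij p \<longrightarrow> f (map_key p a) = f a) \<and> (\<forall>a. f a \<noteq> 0 \<longrightarrow> psize a = N)"

lemma lookup_restrict_vars:
  assumes "homogeneous_series N f"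
  shows "lookup (restrict_vars n f) a = (if keys a \<subseteq> {..<n} then f a else 0)"
proof -
  have "finite {a. (if keys a \<subseteq> {..<n} then f a else 0) \<noteq> 0}"
    by (rule finite_subset [OF _ finite_bounded_exponents [of n N]])
       (use assms in \<open>auto simp: homogeneous_series_def split: if_splits\<close>)
  then show ?thesis by (simp add: restrict_vars_def)
qed

lemma keys_restrict_vars:
  assumes "homogeneous_series N f" "a \<in> keys (restrict_vars n f)"
  shows "keys a \<subseteq> {..<n} \<and> psize a = N"
proof -
  have "(if keys a \<subseteq> {..<n} then f a else 0) \<noteq> 0"
    using assms(2) unfolding in_keys_iff lookup_restrict_vars [OF assms(1)] .
  then show ?thesis using assms(1) by (simp add: homogeneous_series_def split: if_splits)
qed

lemma permutes_keys_map_key: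
  assumes "p permutes {..<n}"
  shows "keys (map_key p a) \<subseteq> {..<n} \<longleftrightarrow> keys a \<subseteq> {..<n}"
proof -
  have b: "bij p" using assms by (rule permutes_bij)
  have "p -` {..<n} = {..<n}" using assms by (rule permutes_vimage)
  then show ?thesis
    unfolding keys_map_key_bij [OF b] using b by (metis bij_is_surj surj_image_vimage_eq vimage_mono image_mono)
qed

lemma symmetric_restrict_vars:
  assumes "homogeneous_series N f"
  shows "symmetric_poly n (restrict_vars n f)"
  unfolding symmetric_poly_def
proof (intro allI impI)
  fix p assume p: "p permutes {..<n}"
  show "perm p (restrict_vars n f) = restrict_vars n f"
    by (rule poly_mapping_eqI)
      (use assms p lookup_restrict_vars [OF assms] in
        \<open>simp add: lookup_perm permutes_bij permutes_keys_map_key homogeneous_series_def\<close>)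
qed

lemma homogeneous_m_sym: "homogeneous_series (psize l) (m_sym l)"
  unfolding homogeneous_series_def
proof (intro conjI allI impI)
  fix p :: "nat \<Rightarrow> nat" and a :: exponent assume p: "bij p"
  have "(\<exists>\<pi>. bij \<pi> \<and> map_key p a = map_key \<pi> l) \<longleftrightarrow> (\<exists>\<pi>. bij \<pi> \<and> a = map_key \<pi> l)"
  proof
    assume "\<exists>\<pi>. bij \<pi> \<and> map_key p a = map_key \<pi> l"
    then obtain q where q: "bij q" "map_key p a = map_key q l" by blast
    then have "a = map_key (q \<circ> inv p) l"
      using p map_key_inv(2) [OF p, of a] by (simp add: map_key_comp bij_imp_bij_inv)
    then show "\<exists>\<pi>. bij \<pi> \<and> a = map_key \<pi> l"
      using p q by (auto intro: bij_comp bij_imp_bij_inv)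
  next
    assume "\<exists>\<pi>. bij \<pi> \<and> a = map_key \<pi> l"
    then obtain q where "bij q" "a = map_key q l" by blast
    then show "\<exists>\<pi>. bij \<pi> \<and> map_key p a = map_key \<pi> l"
      using p by (auto simp: map_key_comp intro: bij_comp)
  qed
  then show "m_sym l (map_key p a) = m_sym l a" by (simp add: m_sym_def)
next
  fix a assume "m_sym l a \<noteq> 0"
  then show "psize a = psize l" by (auto simp: m_sym_def psize_map_key split: if_splits)
qed

lemma m_sym_partition:
  assumes "is_partition l" "is_partition m"
  shows "m_sym l m = (if m = l then 1 else 0)"
proof -
  have "m = l" if "bij p" "m = map_key p l" for p
    by (rule partition_eqI) (use that assms part_counts_map_key [of p l] in simp_all)
  moreover have "\<exists>p. bij p \<and> l = map_key p l"
    by (intro exI [of _ "\<lambda>x. x"]) (simp add: map_key_id bij_id [unfolded id_def])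
  ultimately show ?thesis by (auto simp: m_sym_def)
qed

text \<open>The inverse of \<open>part_counts\<close> on partitions.\<close>

definition part_of :: "exponent \<Rightarrow> exponent" where
  "part_of b = (SOME l. is_partition l \<and> part_counts l = b)"

lemma part_of: "lookup b 0 = 0 \<Longrightarrow> is_partition (part_of b)" "lookup b 0 = 0 \<Longrightarrow> part_counts (part_of b) = b"
  using someI_ex [OF ex_partition_part_counts, of b] by (auto simp: part_of_def)

lemma part_of_part_counts: "is_partition l \<Longrightarrow> part_of (part_counts l) = l"
  by (rule partition_eqI) (simp_all add: part_of)

text \<open>A monomial of degree \<open>N\<close> involves at most \<open>N\<close> variables, so by
  symmetry the image in \<open>n >= N\<close> variables determines the coefficients for every number
  of variables.\<close>

lemma homogeneous_series_eq_eval: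
  assumes f: "homogeneous_series N f" and g: "weight_homogeneous N g" and n: "N \<le> n"
    and fg: "restrict_vars n f = eval_power_sums n g"
  shows "agrees n' f (eval_power_sums n' g)"
proof -
  have pol: "(\<Sum>b\<in>keys g. lookup g b * p_sym (part_of b) a) = lookup (eval_power_sums m g) a" if "keys a \<subseteq> {..<m}" for a m
  proof -
    have "lookup g b * p_sym (part_of b) a = lookup g b * lookup (power_sum_monom m b) a" if "b \<in> keys g" for b
    proof -
      have "lookup b 0 = 0" using g that by (auto simp: weight_homogeneous_def)
      then have "p_sym (part_of b) a = lookup (power_sum_monom m b) a"
        using agrees_p_sym [OF part_of(1), of b m] \<open>keys a \<subseteq> {..<m}\<close> by (simp add: agrees_def part_of)
      then show ?thesis by simp
    qed
    then have "(\<Sum>b\<in>keys g. lookup g b * p_sym (part_of b) a) = (\<Sum>b\<in>keys g. lookup g b * lookup (power_sum_monom m b) a)"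
      by (rule sum.cong [OF refl])
    then show ?thesis by (simp add: eval_power_sums_def lookup_sum)
  qed
  have "f a = lookup (eval_power_sums n' g) a" if a: "keys a \<subseteq> {..<n'}" for a
  proof (cases "psize a = N")
    case False
    have "a \<notin> keys (power_sum_monom n' b)" if "b \<in> keys g" for b
      using keys_power_sum_monom [of b a n'] False g that by (auto simp: weight_homogeneous_def)
    then have "lookup (eval_power_sums n' g) a = 0"
      by (simp add: eval_power_sums_def lookup_sum in_keys_iff)
    then show ?thesis using f False by (auto simp: homogeneous_series_def)
  next
    case True
    \<comment> \<open>Enough variables both to contain \<open>a\<close> and to permute it into the
      first \<open>n\<close>.\<close>
    define m where "m = max n n'"
    have am: "keys a \<subseteq> {..<m}" using a by (auto simp: m_def)
    have c: "card (keys a) \<le> n" using card_keys_le_psize [of a] True n by simp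
    then have "{..<card (keys a)} \<subseteq> {..<m}" by (auto simp: m_def)
    then obtain p where p: "p permutes {..<m}" "p ` {..<card (keys a)} = keys a"
      using ex_permutes_image [of "{..<m}" "{..<card (keys a)}" "keys a"] am by auto
    note bij = permutes_bij [OF p(1)]
    have "keys (map_key p a) = p -` p ` {..<card (keys a)}"
      using bij p(2) by (simp add: keys_map_key_bij)
    also have "\<dots> = {..<card (keys a)}" using bij by (simp add: bij_is_inj inj_vimage_image_eq)
    finally have k: "keys (map_key p a) \<subseteq> {..<n}" using c by auto
    then have km: "keys (map_key p a) \<subseteq> {..<m}" by (auto simp: m_def)
    have "f a = f (map_key p a)" using f bij by (simp add: homogeneous_series_def)
    also have "\<dots> = lookup (eval_power_sums n g) (map_key p a)"
      using lookup_restrict_vars [OF f, of n "map_key p a"] k fg by simp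
    also have "\<dots> = lookup (eval_power_sums m g) (map_key p a)"
      using pol [OF k] pol [OF km] by simp
    also have "\<dots> = lookup (eval_power_sums m g) a"
      by (rule symmetric_poly_lookup [OF symmetric_eval_power_sums p(1)])
    also have "\<dots> = lookup (eval_power_sums n' g) a"
      using pol [OF am] pol [OF a] by simp
    finally show ?thesis .
  qed
  then show ?thesis by (simp add: agrees_def)
qed

lemma p_coords_eq:
  assumes f: "homogeneous_series N f" and g: "weight_homogeneous N g" and n: "N \<le> n"
    and fg: "restrict_vars n f = eval_power_sums n g"
  shows "p_coords f = (\<Sum>b\<in>keys g. single (part_of b) (lookup g b))"
proof -
  define c where "c = (\<Sum>b\<in>keys g. single (part_of b) (lookup g b))"
  have g0: "lookup b 0 = 0" if "b \<in> keys g" for b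
    using g that by (auto simp: weight_homogeneous_def)
  note agr = homogeneous_series_eq_eval [OF assms]
  have c_part: "lookup c l = lookup g (part_counts l)" if "is_partition l" for l
  proof -
    have "part_of b = l \<longleftrightarrow> b = part_counts l" if "b \<in> keys g" for b
      using part_of(2) [OF g0 [OF that]] part_of_part_counts [OF \<open>is_partition l\<close>] by auto
    then have "lookup c l = (\<Sum>b\<in>keys g. if b = part_counts l then lookup g b else 0)"
      by (simp add: c_def lookup_sum lookup_single when_def)
    then show ?thesis by (simp add: in_keys_iff)
  qed
  have keys_c: "keys c = part_of ` keys g"
  proof
    show "keys c \<subseteq> part_of ` keys g"
      unfolding c_def using keys_sum_subset [of "\<lambda>b. single (part_of b) (lookup g b)" "keys g"] by (auto split: if_splits)
    show "part_of ` keys g \<subseteq> keys c"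
    proof
      fix l assume "l \<in> part_of ` keys g"
      then obtain b where "l = part_of b" "b \<in> keys g" by blast
      then show "l \<in> keys c" using c_part [of l] g0 by (simp add: in_keys_iff part_of)
    qed
  qed
  have c_partition: "keys c \<subseteq> Collect is_partition" using g0 by (auto simp: keys_c part_of)
  have rep: "(\<Sum>l\<in>keys c'. lookup c' l * p_sym l a)
      = lookup (eval_power_sums m (\<Sum>l\<in>keys c'. single (part_counts l) (lookup c' l))) a"
    if c': "keys c' \<subseteq> Collect is_partition" and a: "keys a \<subseteq> {..<m}" for c' :: "exponent \<Rightarrow>\<^sub>0 ratfun" and a m
  proof -
    have "eval_power_sums m (\<Sum>l\<in>keys c'. single (part_counts l) (lookup c' l))
       = (\<Sum>l\<in>keys c'. const (lookup c' l) * power_sum_monom m (part_counts l))"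
      by (subst eval_power_sums_sum) (intro sum.cong refl, metis single_conv_const eval_power_sums_const eval_power_sums_single)
    moreover have "p_sym l a = lookup (power_sum_monom m (part_counts l)) a" if "l \<in> keys c'" for l
      using agrees_p_sym [of l m] that c' a by (auto simp: agrees_def)
    ultimately show ?thesis by (simp add: lookup_sum)
  qed
  have c_back: "(\<Sum>l\<in>keys c. single (part_counts l) (lookup c l)) = g"
  proof -
    have "inj_on part_of (keys g)" by (rule inj_on_inverseI [where g = part_counts]) (simp add: g0 part_of)
    then have "(\<Sum>l\<in>keys c. single (part_counts l) (lookup c l)) = (\<Sum>b\<in>keys g. single (part_counts (part_of b)) (lookup c (part_of b)))"
      unfolding keys_c by (simp add: sum.reindex)
    also have "\<dots> = (\<Sum>b\<in>keys g. single b (lookup g b))"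
      using g0 c_part by (intro sum.cong refl) (simp add: part_of)
    finally show ?thesis by (simp flip: poly_mapping_sum_singles)
  qed
  have f_c: "f = (\<lambda>a. \<Sum>l\<in>keys c. lookup c l * p_sym l a)"
  proof
    fix a :: exponent
    obtain m where m: "keys a \<subseteq> {..<m}" using exponent_bound [of a] by blast
    then show "f a = (\<Sum>l\<in>keys c. lookup c l * p_sym l a)"
      using rep [OF c_partition m] agr [of m] by (simp add: c_back agrees_def)
  qed
  have "p_coords f = c"
    unfolding p_coords_def
  proof (rule the_equality)
    show "keys c \<subseteq> Collect is_partition \<and> f = (\<lambda>a. \<Sum>l\<in>keys c. lookup c l * p_sym l a)"
      using c_partition f_c by blast
    fix c' assume c': "keys c' \<subseteq> Collect is_partition \<and> f = (\<lambda>a. \<Sum>l\<in>keys c'. lookup c' l * p_sym l a)"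
    define h where "h = (\<Sum>l\<in>keys c'. single (part_counts l) (lookup c' l))"
    have h0: "lookup b 0 = 0" if "b \<in> keys h" for b
      using that keys_sum_subset [of "\<lambda>l. single (part_counts l) (lookup c' l)" "keys c'"] unfolding h_def
      by (auto split: if_splits)
    have d0: "lookup b 0 = 0" if "b \<in> keys (h - g)" for b
      using that g0 h0 by (cases "b \<in> keys g"; cases "b \<in> keys h") (auto simp: in_keys_iff lookup_minus)
    \<comment> \<open>A competing expansion \<open>c'\<close> is not known to be homogeneous, so the
      number of variables has to bound all lengths in the difference.\<close>
    obtain m where m: "\<And>b. b \<in> keys (h - g) \<Longrightarrow> psize b \<le> m"
      using finite_nat_set_iff_bounded_le [of "psize ` keys (h - g)"] by auto
    have "lookup (eval_power_sums m h) a = lookup (eval_power_sums m g) a" for a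
    proof (cases "keys a \<subseteq> {..<m}")
      case True
      then show ?thesis using rep [of c' a m] c' agr [of m] by (auto simp: h_def agrees_def)
    next
      case False
      have "lookup (eval_power_sums m u) a = 0" if "\<And>b. b \<in> keys u \<Longrightarrow> lookup b 0 = 0" for u
      proof -
        have "a \<notin> keys (power_sum_monom m b)" if "b \<in> keys u" for b
          using keys_power_sum_monom [of b a m] False \<open>\<And>b. b \<in> keys u \<Longrightarrow> lookup b 0 = 0\<close> [OF that] by auto
        then show ?thesis by (simp add: eval_power_sums_def lookup_sum in_keys_iff)
      qed
      then show ?thesis using g0 h0 by simp
    qed
    then have "eval_power_sums m h = eval_power_sums m g" by (rule poly_mapping_eqI)
    then have "eval_power_sums m (h - g) = 0"
      by (simp add: linear_op_diff [OF linear_op_eval_power_sums])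
    then have "h - g = 0" using eval_power_sums_eq_0 [of "h - g" m] d0 m by blast
    then have hg: "h = g" by simp
    have "lookup c' l = lookup c l" for l
    proof (cases "is_partition l")
      case True
      have "part_counts l' = part_counts l \<longleftrightarrow> l' = l" if "l' \<in> keys c'" for l'
        using partition_eqI [of l' l] True c' that by auto
      then have "lookup h (part_counts l) = (\<Sum>l'\<in>keys c'. if l' = l then lookup c' l' else 0)"
        by (simp add: h_def lookup_sum lookup_single when_def)
      then have "lookup h (part_counts l) = lookup c' l" by (simp add: in_keys_iff)
      then show ?thesis using c_part [OF True] hg by simp
    next
      case False
      then have "l \<notin> keys c'" "l \<notin> keys c" using c' c_partition by auto
      then show ?thesis by (simp add: in_keys_iff)
    qed
    then show "c' = c" by (rule poly_mapping_eqI)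
  qed
  then show ?thesis by (simp add: c_def)
qed

lemma zee_norm_weight: "of_nat (zee l) * alpha ^ plength l = norm_weight (part_counts l)"
proof -
  have k: "keys (part_counts l) = Poly_Mapping.range l"
    by (auto simp: in_keys_iff lookup_part_counts Poly_Mapping.range.rep_eq card_eq_0_iff)
  have "part_mult l r = lookup (part_counts l) r" if "r \<in> Poly_Mapping.range l" for r
    using that by (auto simp: part_mult_def lookup_part_counts Poly_Mapping.range.rep_eq in_keys_iff intro!: arg_cong [where f = card])
  then have "zee l = (\<Prod>r\<in>keys (part_counts l). r ^ lookup (part_counts l) r * fact (lookup (part_counts l) r))"
    unfolding zee_def k by (intro prod.cong refl) auto
  then show ?thesis by (simp add: norm_weight_def psize_part_counts plength_def)
qed

text \<open>Makes the abstract scalar product computable in \<open>n\<close> variables;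
  \<open>N <= n\<close> guarantees that the coordinates are faithfully represented there.\<close>

lemma jack_inner_eq_form:
  assumes "homogeneous_series N f" "weight_homogeneous N g" "restrict_vars n f = eval_power_sums n g"
    and "homogeneous_series N f'" "weight_homogeneous N g'" "restrict_vars n f' = eval_power_sums n g'"
    and n: "N \<le> n"
  shows "jack_inner f f' = form g g'"
proof -
  have g0: "lookup b 0 = 0" if "b \<in> keys g \<or> b \<in> keys g'" for b
    using assms(2,5) that by (auto simp: weight_homogeneous_def)
  have inj: "inj_on part_of (keys h)" if "h = g \<or> h = g'" for h
    by (rule inj_on_inverseI [where g = part_counts]) (use that g0 part_of(2) in auto)
  let ?c = "\<lambda>h. \<Sum>b\<in>keys h. single (part_of b) (lookup h b)"
  have c: "lookup (?c h) (part_of b) = lookup h b" if "h = g \<or> h = g'" "lookup b 0 = 0" for h b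
  proof -
    have "part_of b' = part_of b \<longleftrightarrow> b' = b" if "b' \<in> keys h" for b'
      using part_of(2) [of b] part_of(2) [of b'] g0 [of b'] that \<open>h = g \<or> h = g'\<close> \<open>lookup b 0 = 0\<close> by auto
    then have "lookup (?c h) (part_of b) = (\<Sum>b'\<in>keys h. if b' = b then lookup h b' else 0)"
      by (simp add: lookup_sum lookup_single when_def)
    then show ?thesis by (simp add: in_keys_iff)
  qed
  have k: "keys (?c g) = part_of ` keys g"
  proof
    show "keys (?c g) \<subseteq> part_of ` keys g"
      using keys_sum_subset [of "\<lambda>b. single (part_of b) (lookup g b)" "keys g"] by (auto split: if_splits)
    show "part_of ` keys g \<subseteq> keys (?c g)"
    proof
      fix l assume "l \<in> part_of ` keys g"
      then obtain b where b: "l = part_of b" "b \<in> keys g" by blast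
      then have "lookup (?c g) l = lookup g b" using c [of g b] g0 by simp
      then show "l \<in> keys (?c g)" using b by (simp add: in_keys_iff)
    qed
  qed
  have "jack_inner f f' = (\<Sum>l\<in>part_of ` keys g. lookup (?c g) l * lookup (?c g') l * norm_weight (part_counts l))"
    unfolding jack_inner_def p_coords_eq [OF assms(1,2) n assms(3)] p_coords_eq [OF assms(4,5) n assms(6)] k zee_norm_weight ..
  also have "\<dots> = (\<Sum>b\<in>keys g. lookup (?c g) (part_of b) * lookup (?c g') (part_of b) * norm_weight (part_counts (part_of b)))"
    using inj by (simp add: sum.reindex)
  also have "\<dots> = form g g'"
    unfolding form_def using g0 c by (intro sum.cong refl) (simp add: part_of)
  finally show ?thesis .
qed

section \<open>Dominance order and eigenvalues\<close>

lemma abel_nonneg: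
  fixes w d :: "nat \<Rightarrow> int"
  assumes "\<And>i. w (Suc i) \<le> w i" "\<And>i. 0 \<le> w i" "\<And>k. 0 \<le> (\<Sum>i<k. d i)"
  shows "0 \<le> (\<Sum>i<n. w i * d i)"
proof -
  \<comment> \<open>Summation by parts, strengthened to a lower bound by the last partial sum so
    that the induction goes through.\<close>
  have *: "w n * (\<Sum>i<Suc n. d i) \<le> (\<Sum>i<Suc n. w i * d i)" for n
  proof (induction n)
    case (Suc n)
    have "w (Suc n) * (\<Sum>i<Suc n. d i) \<le> w n * (\<Sum>i<Suc n. d i)"
      by (intro mult_right_mono assms)
    then show ?case using Suc by (simp add: distrib_left)
  qed simp
  show ?thesis
  proof (cases n)
    case (Suc k)
    have "0 \<le> w k * (\<Sum>i<Suc k. d i)" using assms by (intro mult_nonneg_nonneg)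
    then show ?thesis using *[of k] Suc by simp
  qed simp
qed

lemma partition_keys_subset:
  assumes "is_partition l" "psize l \<le> n"
  shows "keys l \<subseteq> {..<n}"
proof -
  have "plength l \<le> psize l" unfolding plength_def by (rule card_keys_le_psize)
  then have "{..<plength l} \<subseteq> {..<n}" using assms(2) by auto
  then show ?thesis by (simp only: partition_keys [OF assms(1)])
qed

text \<open>In the difference the constant terms cancel. The coefficient of alpha^2 is the sum of
  the d_i^2 + 2 m_i d_i, which is positive, and that of alpha is nonnegative, both by summation by
  parts.\<close>

lemma eigenvalue_strict_mono:
  assumes l: "is_partition l" "psize l \<le> n" and m: "is_partition m" "dominated_by m l" "m \<noteq> l"
  shows "eigenvalue n (lookup m) < eigenvalue n (lookup l)"
proof -
  have size: "psize m = psize l" using m by (simp add: dominated_by_def)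
  have keys: "keys l \<subseteq> {..<n}" "keys m \<subseteq> {..<n}"
    using partition_keys_subset [OF l] partition_keys_subset [OF m(1), of n] l(2) size by simp_all
  define d where "d i = int (lookup l i) - int (lookup m i)" for i
  have d: "0 \<le> (\<Sum>i<k. d i)" for k
  proof -
    have "(\<Sum>i<k. lookup m i) \<le> (\<Sum>i<k. lookup l i)" using m(2) by (simp add: dominated_by_def)
    then have "int (\<Sum>i<k. lookup m i) \<le> int (\<Sum>i<k. lookup l i)" by (simp only: of_nat_le_iff)
    then show ?thesis by (simp add: d_def sum_subtractf)
  qed
  have 1: "0 \<le> (\<Sum>i<n. int (lookup m i) * d i)"
    using m(1) d by (intro abel_nonneg) (auto simp: is_partition_def)
  have 2: "0 \<le> (\<Sum>i<n. int (n - 1 - i) * d i)"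
    using d by (intro abel_nonneg) auto
  have 3: "0 < (\<Sum>i<n. (d i)\<^sup>2)"
  proof -
    obtain i where i: "lookup m i \<noteq> lookup l i" using m(3) by (meson poly_mapping_eqI)
    then have "i < n" using keys by (metis in_keys_iff lessThan_iff subsetD)
    then show ?thesis using i by (intro sum_pos2 [where i = i]) (auto simp: d_def)
  qed
  have "(\<Sum>i<n. (int (lookup l i))\<^sup>2) - (\<Sum>i<n. (int (lookup m i))\<^sup>2) = (\<Sum>i<n. (d i)\<^sup>2) + 2 * (\<Sum>i<n. int (lookup m i) * d i)"
    unfolding sum_subtractf [symmetric] sum_distrib_left sum.distrib [symmetric]
    by (intro sum.cong refl) (simp add: d_def power2_eq_square algebra_simps)
  then have pos: "0 < (\<Sum>i<n. (int (lookup l i))\<^sup>2) - (\<Sum>i<n. (int (lookup m i))\<^sup>2)"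
    using 1 3 by linarith
  have "eigenvalue n (lookup l) - eigenvalue n (lookup m) =
     (\<Sum>i<n. alpha\<^sup>2 * of_int ((int (lookup l i))\<^sup>2 - (int (lookup m i))\<^sup>2) + 2 * alpha * of_int (int (n - 1 - i) * d i))"
    unfolding eigenvalue_def sum_subtractf [symmetric]
    by (intro sum.cong refl) (simp add: d_def power2_eq_square algebra_simps del: of_nat_diff)
  also have "\<dots> = alpha\<^sup>2 * of_int ((\<Sum>i<n. (int (lookup l i))\<^sup>2) - (\<Sum>i<n. (int (lookup m i))\<^sup>2))
     + 2 * alpha * of_int (\<Sum>i<n. int (n - 1 - i) * d i)"
    by (simp only: sum.distrib sum_distrib_left [symmetric] of_int_sum [symmetric] sum_subtractf)
  also have "\<dots> > 0"
  proof (rule add_pos_nonneg)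
    show "0 < alpha\<^sup>2 * of_int ((\<Sum>i<n. (int (lookup l i))\<^sup>2) - (\<Sum>i<n. (int (lookup m i))\<^sup>2))"
      using pos alpha_pos by (intro mult_pos_pos) (simp_all only: of_int_0_less_iff zero_less_power)
    show "0 \<le> 2 * alpha * of_int (\<Sum>i<n. int (n - 1 - i) * d i)"
    proof -
      have "0 \<le> (of_int (\<Sum>i<n. int (n - 1 - i) * d i) :: ratfun)" using 2 by (simp only: of_int_0_le_iff)
      then show ?thesis using alpha_pos by (intro mult_nonneg_nonneg) simp_all
    qed
  qed
  finally show ?thesis by simp
qed

definition dominated_partitions :: "exponent \<Rightarrow> exponent set" where
  "dominated_partitions l = {m. is_partition m \<and> dominated_by m l}"

lemma finite_dominated_partitions: "finite (dominated_partitions l)"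
proof (rule finite_subset [OF _ finite_bounded_exponents [of "psize l" "psize l"]])
  show "dominated_partitions l \<subseteq> {a. keys a \<subseteq> {..<psize l} \<and> psize a \<le> psize l}"
    by (auto simp: dominated_partitions_def dominated_by_def dest!: partition_keys_subset [where n = "psize l"])
qed

lemma dominated_by_refl: "dominated_by l l"
  by (simp add: dominated_by_def)

lemma dominated_by_trans: "dominated_by k m \<Longrightarrow> dominated_by m l \<Longrightarrow> dominated_by k l"
  unfolding dominated_by_def by (metis order_trans)

lemma dominated_by_antisym:
  assumes "dominated_by m l" "dominated_by l m"
  shows "m = l"
proof (rule poly_mapping_eqI)
  fix i
  have s: "(\<Sum>k<j. lookup m k) = (\<Sum>k<j. lookup l k)" for j
    using assms by (simp add: dominated_by_def order_antisym)
  show "lookup m i = lookup l i" using s [of i] s [of "Suc i"] by simp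
qed

lemma dominated_partitions_psubset:
  assumes "m \<in> dominated_partitions l" "m \<noteq> l" "is_partition l"
  shows "dominated_partitions m \<subseteq> dominated_partitions l - {l}"
    "card (dominated_partitions m) < card (dominated_partitions l)"
proof -
  show 1: "dominated_partitions m \<subseteq> dominated_partitions l - {l}"
    using assms dominated_by_trans dominated_by_antisym unfolding dominated_partitions_def by blast
  have "l \<in> dominated_partitions l" using assms(3) by (simp add: dominated_partitions_def dominated_by_refl)
  then show "card (dominated_partitions m) < card (dominated_partitions l)"
    using 1 by (intro psubset_card_mono finite_dominated_partitions) auto
qed

lemma dominated_exp_partition:
  assumes l: "is_partition l" "keys l \<subseteq> {..<n}" and m: "dominated_exp n (lookup l) m"
  shows "dominated_by m l"
  unfolding dominated_by_def
proof (intro conjI allI)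
  have mk: "keys m \<subseteq> {..<n}" and s: "(\<Sum>i<n. lookup m i) = (\<Sum>i<n. lookup l i)"
    using m by (auto simp: dominated_exp_def)
  then show "psize m = psize l" using l by (simp add: psize_eq_sum [of "{..<n}"])
  fix i
  show "(\<Sum>k<i. lookup m k) \<le> (\<Sum>k<i. lookup l k)"
  proof (cases "i \<le> n")
    case True
    then have "{..<i} \<subseteq> {..<n}" by auto
    then have "(\<Sum>k\<in>{..<i}. lookup m k) \<le> (\<Sum>k<card {..<i}. lookup l k)" using m unfolding dominated_exp_def by blast
    then show ?thesis by simp
  next
    case False
    have "(\<Sum>k<i. lookup a k) = (\<Sum>k<n. lookup a k)" if "keys a \<subseteq> {..<n}" for a :: exponent
      using that False by (intro sum.mono_neutral_right) (auto simp: in_keys_iff subset_iff)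
    then show ?thesis using mk l s by simp
  qed
qed

lemma symmetric_poly_expand:
  assumes l: "is_partition l" "keys l \<subseteq> {..<n}" and f: "symmetric_poly n f" "dominated_poly n (lookup l) f"
  shows "f = (\<Sum>m\<in>dominated_partitions l. const (lookup f m) * restrict_vars n (m_sym m))"
proof (rule poly_mapping_eqI)
  fix a
  have M: "lookup (restrict_vars n (m_sym m)) a = (if keys a \<subseteq> {..<n} then m_sym m a else 0)" for m
    by (rule lookup_restrict_vars [OF homogeneous_m_sym])
  show "lookup f a = lookup (\<Sum>m\<in>dominated_partitions l. const (lookup f m) * restrict_vars n (m_sym m)) a"
  proof (cases "keys a \<subseteq> {..<n}")
    case False
    then have "lookup f a = 0" using f(2) by (auto simp: dominated_poly_def dominated_exp_def in_keys_iff)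
    then show ?thesis using False by (simp add: lookup_sum M)
  next
    case True
    obtain p where p: "p permutes {..<n}" "is_partition (map_key p a)"
      using ex_partition_map_key [OF True] by blast
    define k where "k = map_key p a"
    have fk: "lookup f k = lookup f a" unfolding k_def by (rule symmetric_poly_lookup [OF f(1) p(1)])
    have "m_sym m a = (if m = k then 1 else 0)" if "is_partition m" for m
    proof -
      have "m_sym m a = m_sym m k"
        using homogeneous_m_sym [of m] permutes_bij [OF p(1)] by (simp add: homogeneous_series_def k_def)
      then show ?thesis using m_sym_partition [OF that, of k] p(2) by (auto simp: k_def)
    qed
    then have "lookup (\<Sum>m\<in>dominated_partitions l. const (lookup f m) * restrict_vars n (m_sym m)) a
       = (\<Sum>m\<in>dominated_partitions l. if m = k then lookup f k else 0)"
      using True by (simp add: lookup_sum M) (intro sum.cong refl, auto simp: dominated_partitions_def)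
    also have "\<dots> = (if k \<in> dominated_partitions l then lookup f k else 0)"
      using finite_dominated_partitions by simp
    also have "\<dots> = lookup f k"
    proof (cases "k \<in> keys f")
      case True
      then have "dominated_exp n (lookup l) k" using f(2) by (simp add: dominated_poly_def)
      then show ?thesis
        using dominated_exp_partition [OF l] p(2) by (simp add: dominated_partitions_def k_def)
    qed (simp add: in_keys_iff)
    finally show ?thesis using fk by simp
  qed
qed

lemma ones_eq: "ones N = indicator_exp {..<N}"
  by (simp add: ones_def indicator_exp_def)

lemma lookup_ones: "lookup (ones N) i = (if i < N then 1 else 0)"
  by (simp add: ones_eq lookup_indicator_exp)

lemma keys_ones: "keys (ones N) = {..<N}"
  by (auto simp: in_keys_iff lookup_ones split: if_splits)

lemma ones_in_dominated_partitions:
  assumes "is_partition l"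
  shows "ones (psize l) \<in> dominated_partitions l"
proof -
  have "(\<Sum>k<i. lookup (ones (psize l)) k) \<le> (\<Sum>k<i. lookup l k)" for i
  proof (cases "i \<le> plength l")
    case True
    have "lookup (ones (psize l)) k \<le> lookup l k" if "k < i" for k
    proof -
      have "k \<in> keys l" using partition_keys [OF assms] that True by auto
      then have "1 \<le> lookup l k" by (simp add: in_keys_iff)
      then show ?thesis by (simp add: lookup_ones)
    qed
    then show ?thesis by (intro sum_mono) auto
  next
    case False
    then have "(\<Sum>k<i. lookup l k) = psize l"
      using partition_keys [OF assms] by (intro psize_eq_sum [symmetric]) auto
    moreover have "(\<Sum>k<i. lookup (ones (psize l)) k) = card {k \<in> {..<i}. k < psize l}"
      by (simp add: lookup_ones sum.If_cases Int_def)
    moreover have "card {k \<in> {..<i}. k < psize l} \<le> card {..<psize l}" by (intro card_mono) auto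
    ultimately show ?thesis by simp
  qed
  moreover have "psize (ones (psize l)) = psize l"
    by (simp add: psize_def keys_ones lookup_ones)
  ultimately show ?thesis
    by (auto simp: dominated_partitions_def dominated_by_def is_partition_def lookup_ones)
qed

section \<open>Identification with the Jack functions\<close>

definition spanned :: "(exponent \<Rightarrow> mpol) \<Rightarrow> exponent set \<Rightarrow> mpol \<Rightarrow> bool" where
  "spanned P A f \<longleftrightarrow> (\<exists>c. f = (\<Sum>m\<in>A. const (c m) * P m))"

lemma spanned_add: "spanned P A f \<Longrightarrow> spanned P A g \<Longrightarrow> spanned P A (f + g)"
proof -
  assume "spanned P A f" "spanned P A g"
  then obtain c d where "f = (\<Sum>m\<in>A. const (c m) * P m)" "g = (\<Sum>m\<in>A. const (d m) * P m)"
    by (auto simp: spanned_def)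
  then show ?thesis
    unfolding spanned_def by (intro exI [of _ "\<lambda>m. c m + d m"]) (simp add: const_add distrib_right sum.distrib)
qed

lemma spanned_const: "spanned P A f \<Longrightarrow> spanned P A (const k * f)"
proof -
  assume "spanned P A f"
  then obtain c where "f = (\<Sum>m\<in>A. const (c m) * P m)" by (auto simp: spanned_def)
  then show ?thesis
    unfolding spanned_def by (intro exI [of _ "\<lambda>m. k * c m"]) (simp add: const_mult sum_distrib_left mult.assoc)
qed

lemma spanned_sum: "(\<And>i. i \<in> I \<Longrightarrow> spanned P A (f i)) \<Longrightarrow> spanned P A (sum f I)"
proof (induction I rule: infinite_finite_induct)
  case (insert i I)
  then show ?case by (simp add: spanned_add)
qed (auto simp: spanned_def intro!: exI [of _ "\<lambda>_. 0"])

lemma spanned_mono: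
  assumes "spanned P A f" "A \<subseteq> B" "finite B"
  shows "spanned P B f"
proof -
  obtain c where f: "f = (\<Sum>m\<in>A. const (c m) * P m)" using assms(1) by (auto simp: spanned_def)
  also have "\<dots> = (\<Sum>m\<in>A. const (if m \<in> A then c m else 0) * P m)" by (intro sum.cong) auto
  also have "\<dots> = (\<Sum>m\<in>B. const (if m \<in> A then c m else 0) * P m)"
    using assms by (intro sum.mono_neutral_left) auto
  finally show ?thesis
    unfolding spanned_def by (intro exI [of _ "\<lambda>m. if m \<in> A then c m else 0"])
qed

lemma spanned_base: "m \<in> A \<Longrightarrow> finite A \<Longrightarrow> spanned P A (P m)"
  unfolding spanned_def by (intro exI [of _ "\<lambda>k. if k = m then 1 else 0"]) (simp add: if_distrib if_distribR cong: if_cong)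

text \<open>\<open>N <= n\<close> makes the power sums of degree \<open>N\<close> independent and
  provides the monomial x_1 ... x_N that fixes the normalization.\<close>

lemma jack_restrict_vars:
  assumes J: "is_jack_family J" and Nn: "N \<le> n" and l: "is_partition l" "psize l = N"
  shows "restrict_vars n (J l) = creation_prod n l n 1"
proof -
  obtain v where Jv: "\<And>l. is_partition l \<Longrightarrow> J l = (\<lambda>a. \<Sum>m\<in>dominated_partitions l. v l m * m_sym m a)"
    and v1: "\<And>l. is_partition l \<Longrightarrow> v l (ones (psize l)) = fact (psize l)"
  proof -
    from J obtain v where "\<forall>l. is_partition l \<longrightarrow>
        J l = (\<lambda>a. \<Sum>m | is_partition m \<and> dominated_by m l. v l m * m_sym m a) \<and> v l (ones (psize l)) = fact (psize l)"
      unfolding is_jack_family_def by blast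
    then show ?thesis
      using that [of v] by (simp add: dominated_partitions_def)
  qed
  have orth: "jack_inner (J l) (J m) = 0" if "is_partition l" "is_partition m" "l \<noteq> m" for l m
    using J that by (auto simp: is_jack_family_def)
  define P where "P l = restrict_vars n (J l)" for l
  define M where "M m = restrict_vars n (m_sym m)" for m
  define part where "part l \<longleftrightarrow> is_partition l \<and> psize l = N" for l
  have part_dom: "part m" if "part l" "m \<in> dominated_partitions l" for l m
    using that by (auto simp: part_def dominated_partitions_def dominated_by_def)
  have hom: "homogeneous_series N (J l)" if "part l" for l
  proof -
    have m: "homogeneous_series N (m_sym m)" if "m \<in> dominated_partitions l" for m
      using homogeneous_m_sym [of m] part_dom [OF \<open>part l\<close> that] by (simp add: part_def)
    have J: "J l a = (\<Sum>m\<in>dominated_partitions l. v l m * m_sym m a)" for a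
      using Jv [of l] that by (simp add: part_def)
    show ?thesis
      unfolding homogeneous_series_def
    proof (intro conjI allI impI)
      fix p :: "nat \<Rightarrow> nat" and a :: exponent assume "bij p"
      then show "J l (map_key p a) = J l a"
        unfolding J using m by (intro sum.cong refl) (simp add: homogeneous_series_def)
    next
      fix a assume "J l a \<noteq> 0"
      then obtain k where "k \<in> dominated_partitions l" "m_sym k a \<noteq> 0"
        unfolding J by (metis (no_types, lifting) mult_zero_right sum.neutral)
      then show "psize a = N" using m by (auto simp: homogeneous_series_def)
    qed
  qed
  have "\<exists>g. weight_homogeneous N g \<and> P l = eval_power_sums n g" if "part l" for l
    unfolding P_def
    by (rule ex_eval_power_sums [OF symmetric_restrict_vars [OF hom [OF that]] keys_restrict_vars [OF hom [OF that]]])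
  \<comment> \<open>\<open>g l\<close> is the restricted Jack function as a polynomial in the power
    sums, where the scalar product is diagonal.\<close>
  then obtain g where g: "\<And>l. part l \<Longrightarrow> weight_homogeneous N (g l)" "\<And>l. part l \<Longrightarrow> P l = eval_power_sums n (g l)"
    by metis
  have form0: "form (g l) (g m) = 0" if "part l" "part m" "l \<noteq> m" for l m
    using jack_inner_eq_form [OF hom [OF that(1)] g(1) [OF that(1)] _ hom [OF that(2)] g(1) [OF that(2)] _ Nn]
      g(2) [OF that(1)] g(2) [OF that(2)] orth [of l m] that by (simp add: P_def part_def)
  have PM: "P l = (\<Sum>m\<in>dominated_partitions l. const (v l m) * M m)" if "part l" for l
  proof (rule poly_mapping_eqI)
    fix a
    have "lookup (M m) a = (if keys a \<subseteq> {..<n} then m_sym m a else 0)" for m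
      unfolding M_def by (rule lookup_restrict_vars [OF homogeneous_m_sym])
    moreover have "lookup (P l) a = (if keys a \<subseteq> {..<n} then J l a else 0)"
      unfolding P_def by (rule lookup_restrict_vars [OF hom [OF that]])
    moreover have "J l a = (\<Sum>m\<in>dominated_partitions l. v l m * m_sym m a)"
      using Jv [of l] that by (simp add: part_def)
    ultimately show "lookup (P l) a = lookup (\<Sum>m\<in>dominated_partitions l. const (v l m) * M m) a"
      by (simp add: lookup_sum)
  qed
  have P1: "lookup (P l) (ones N) = fact N" if "part l" for l
  proof -
    have l: "is_partition l" "psize l = N" using that by (auto simp: part_def)
    note o = ones_in_dominated_partitions [OF l(1), unfolded l(2)]
    have "lookup (P l) (ones N) = J l (ones N)"
      using Nn by (auto simp: P_def lookup_restrict_vars [OF hom [OF that]] keys_ones)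
    also have "\<dots> = (\<Sum>m\<in>dominated_partitions l. if m = ones N then v l (ones N) else 0)"
      unfolding Jv [OF l(1)] using o
      by (intro sum.cong refl) (auto simp: dominated_partitions_def m_sym_partition)
    also have "\<dots> = fact N"
      using o v1 [OF l(1)] finite_dominated_partitions by (simp add: l(2))
    finally show ?thesis .
  qed
  have g_nonzero: "g l \<noteq> 0" if "part l" for l
  proof
    assume "g l = 0"
    then have "P l = 0" using g(2) [OF that] by (simp add: eval_power_sums_def)
    then show False using P1 [OF that] by simp
  qed
  have norm: "form (g l) (g l) \<noteq> 0" if "part l" for l
    using form_self_pos [OF g(1) [OF that] g_nonzero [OF that]] by simp
  have lin: "weight_homogeneous N (\<Sum>m\<in>A. const (c m) * g m) \<and>
      (\<Sum>m\<in>A. const (c m) * P m) = eval_power_sums n (\<Sum>m\<in>A. const (c m) * g m)"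
    if "\<And>m. m \<in> A \<Longrightarrow> part m" for A c
    using that g by (simp add: eval_power_sums_sum eval_power_sums_const weight_homogeneous_sum weight_homogeneous_const)
  have form_lin: "form (\<Sum>m\<in>A. const (c m) * g m) (g k) = (if k \<in> A then c k * form (g k) (g k) else 0)"
    if "finite A" "\<And>m. m \<in> A \<Longrightarrow> part m" "part k" for A c k
  proof -
    have "form (\<Sum>m\<in>A. const (c m) * g m) (g k) = (\<Sum>m\<in>A. if m = k then c k * form (g k) (g k) else 0)"
      unfolding form_sum_left form_const_left using that form0 by (intro sum.cong refl) auto
    then show ?thesis using that by simp
  qed
  \<comment> \<open>Inverts the triangular expansion (ii) of the Jack functions by induction along
    the dominance order.\<close>
  have M_span: "spanned P (dominated_partitions l) (M l)" if "part l" for l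
    using that
  proof (induction "card (dominated_partitions l)" arbitrary: l rule: less_induct)
    case less
    have lp: "is_partition l" using less.prems by (simp add: part_def)
    have l_in: "l \<in> dominated_partitions l" using lp by (simp add: dominated_partitions_def dominated_by_refl)
    let ?D = "dominated_partitions l - {l}"
    define R where "R = (\<Sum>m\<in>?D. const (v l m) * M m)"
    have R: "spanned P ?D R"
      unfolding R_def
    proof (intro spanned_sum spanned_const)
      fix m assume m: "m \<in> ?D"
      then have "spanned P (dominated_partitions m) (M m)"
        using dominated_partitions_psubset(2) [of m l] lp part_dom [OF less.prems] by (intro less.hyps) auto
      then show "spanned P ?D (M m)"
        by (rule spanned_mono) (use m dominated_partitions_psubset(1) [of m l] lp finite_dominated_partitions in auto)
    qed
    have Pl: "P l = const (v l l) * M l + R"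
      unfolding PM [OF less.prems] R_def using l_in finite_dominated_partitions by (simp add: sum.remove)
    \<comment> \<open>Otherwise \<open>g l\<close> would be a combination of \<open>g m\<close> with
      \<open>m\<close> strictly below \<open>l\<close>, all orthogonal to it, contrary to positive
      definiteness.\<close>
    have "v l l \<noteq> 0"
    proof
      assume "v l l = 0"
      then have "P l = R" using Pl by simp
      then obtain c where c: "P l = (\<Sum>m\<in>?D. const (c m) * P m)" using R by (auto simp: spanned_def)
      have D: "part m" if "m \<in> ?D" for m using that part_dom [OF less.prems] by auto
      have "g l = (\<Sum>m\<in>?D. const (c m) * g m)"
        by (rule eval_power_sums_inject [OF _ _ Nn]) (use lin [OF D, of ?D c] c g [OF less.prems] in auto)
      then have "form (g l) (g l) = 0"
        using form_lin [of ?D l c] D less.prems finite_dominated_partitions by auto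
      then show False using norm [OF less.prems] by simp
    qed
    then have "M l = const (1 / v l l) * (P l + const (-1) * R)"
      by (simp add: Pl const_uminus mult.assoc [symmetric] flip: const_mult)
    moreover have "spanned P (dominated_partitions l) (const (1 / v l l) * (P l + const (-1) * R))"
      using R l_in finite_dominated_partitions [of l]
      by (intro spanned_const spanned_add spanned_base) (auto intro: spanned_mono)
    ultimately show ?case by simp
  qed
  have main: "creation_prod n l n 1 = P l" if "part l" for l
    using that
  proof (induction "card (dominated_partitions l)" arbitrary: l rule: less_induct)
    case less
    define F where "F l = creation_prod n l n 1" for l
    let ?D = "dominated_partitions l"
    have created: "created n n (lookup m) (F m)" if "part m" for m
    proof -
      have m: "is_partition m" "keys m \<subseteq> {..<n}"
        using that Nn partition_keys_subset [of m n] by (auto simp: part_def)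
      have "(\<lambda>i. if i < n then lookup m i - lookup m n else 0) = lookup m"
      proof
        fix i
        have "lookup m j = 0" if "n \<le> j" for j using m(2) that by (auto simp: in_keys_iff subset_iff)
        then show "(if i < n then lookup m i - lookup m n else 0) = lookup m i" by auto
      qed
      then show ?thesis using created_creation_prod [OF m(1) order_refl, of n] by (simp add: F_def)
    qed
    have lp: "is_partition l" "psize l = N" "keys l \<subseteq> {..<n}"
      using less.prems Nn partition_keys_subset [of l n] by (auto simp: part_def)
    have l_in: "l \<in> ?D" using lp by (simp add: dominated_partitions_def dominated_by_refl)
    have D: "part m" if "m \<in> ?D" for m using that part_dom [OF less.prems] by auto
    have Fl: "symmetric_poly n (F l)" "dominated_poly n (lookup l) (F l)" "squarefree_coeffs n N (F l)"
      using created [OF less.prems] lp psize_eq_sum [of "{..<n}" l] by (simp_all add: created_def)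
    have "spanned P ?D (\<Sum>m\<in>?D. const (lookup (F l) m) * M m)"
    proof (intro spanned_sum spanned_const)
      fix m assume m: "m \<in> ?D"
      have "dominated_partitions m \<subseteq> ?D"
        using dominated_partitions_psubset(1) [OF m _ lp(1)] by (cases "m = l") auto
      then show "spanned P ?D (M m)"
        by (rule spanned_mono [OF M_span [OF D [OF m]] _ finite_dominated_partitions])
    qed
    then have "spanned P ?D (F l)"
      using symmetric_poly_expand [OF lp(1,3) Fl(1,2)] by (simp add: M_def)
    then obtain c where c: "F l = (\<Sum>m\<in>?D. const (c m) * P m)" by (auto simp: spanned_def)
    define G where "G = (\<Sum>m\<in>?D. const (c m) * g m)"
    have G: "weight_homogeneous N G" "F l = eval_power_sums n G"
      using lin [OF D, of ?D c] c by (simp_all add: G_def)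
    \<comment> \<open>The eigenvalue equation in \<open>n\<close> variables is pulled back to the
      power sums by injectivity.\<close>
    have op: "power_sum_op n N h = const (eigenvalue n (lookup m)) * h"
      if "weight_homogeneous N h" "F m = eval_power_sums n h" "part m" for h m
    proof (rule eval_power_sums_inject [OF _ _ Nn])
      show "weight_homogeneous N (power_sum_op n N h)" by (rule weight_homogeneous_power_sum_op [OF that(1)])
      show "weight_homogeneous N (const (eigenvalue n (lookup m)) * h)" by (rule weight_homogeneous_const [OF that(1)])
      show "eval_power_sums n (power_sum_op n N h) = eval_power_sums n (const (eigenvalue n (lookup m)) * h)"
        using xi_squares_eval_power_sums [OF that(1) order_refl, of n] created [OF that(3)] that(2)
        by (simp add: created_def eval_power_sums_const)
    qed
    \<comment> \<open>By induction \<open>P m\<close> is an eigenvector with a smaller eigenvalue.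
      Self-adjointness makes \<open>G\<close> orthogonal to \<open>g m\<close>, and their product is
      \<open>c m\<close> times a nonzero norm.\<close>
    have "c m = 0" if m: "m \<in> ?D" "m \<noteq> l" for m
    proof -
      have "F m = P m"
        unfolding F_def using dominated_partitions_psubset(2) [OF m lp(1)] D [OF m(1)] by (intro less.hyps)
      then have "power_sum_op n N (g m) = const (eigenvalue n (lookup m)) * g m"
        using op [OF g(1) [OF D [OF m(1)]] _ D [OF m(1)]] g(2) [OF D [OF m(1)]] by simp
      moreover have "power_sum_op n N G = const (eigenvalue n (lookup l)) * G"
        by (rule op [OF G less.prems])
      ultimately have "eigenvalue n (lookup l) * form G (g m) = eigenvalue n (lookup m) * form G (g m)"
        using form_power_sum_op [of n N G "g m"] by (simp add: form_const_left form_const_right)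
      moreover have "eigenvalue n (lookup m) < eigenvalue n (lookup l)"
        using eigenvalue_strict_mono [of l n m] lp Nn m by (auto simp: dominated_partitions_def)
      ultimately have "form G (g m) = 0" by simp
      then show ?thesis
        using form_lin [OF finite_dominated_partitions D D [OF m(1)], of l c] m norm [OF D [OF m(1)]] by (simp add: G_def)
    qed
    then have Fc: "F l = const (c l) * P l"
      unfolding c using l_in finite_dominated_partitions by (subst sum.remove [of _ l]) (auto intro!: sum.neutral)
    \<comment> \<open>Both sides have coefficient N! at x_1 ... x_N, which determines the remaining
      scalar.\<close>
    have "lookup (F l) (ones N) = fact N"
      using Fl(3) Nn by (auto simp: squarefree_coeffs_def ones_eq)
    then have "c l = 1"
      using P1 [OF less.prems] unfolding Fc by simp
    then show ?case using Fc by (simp add: F_def)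
  qed
  show ?thesis using main [of l] l by (simp add: P_def part_def)
qed

theorem theorem1:
  fixes n :: nat and l :: exponent and J :: "exponent \<Rightarrow> series"
  assumes "n \<ge> 1"
    and "is_partition l"
    and "plength l \<le> n"
    and "is_jack_family J"
  shows "restrict_vars n (J l) = creation_prod n l n 1"
proof -
  \<comment> \<open>At least |lambda| variables for the comparison; the surplus is set to zero
    afterwards.\<close>
  define n' where "n' = max n (psize l)"
  have n': "n \<le> n'" "psize l \<le> n'" by (auto simp: n'_def)
  have eq: "restrict_vars n' (J l) = creation_prod n' l n' 1"
    using assms n' by (intro jack_restrict_vars) auto
  have "lookup l i = 0" if "n \<le> i" for i
    using partition_keys [OF assms(2)] assms(3) that by (auto simp: not_in_keys_iff_lookup_eq_zero [symmetric])
  then have "creation_prod n l n 1 = restrict_poly n (restrict_vars n' (J l))"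
    unfolding eq using n' by (intro restrict_poly_creation_prod_le [symmetric])
  also have "\<dots> = restrict_vars n (J l)"
  proof (rule poly_mapping_eqI)
    fix a
    \<comment> \<open>\<open>restrict_vars\<close> yields the intended polynomial only for finite
      support, which holds because J_lambda is homogeneous.\<close>
    have fin: "finite {a. (if keys a \<subseteq> {..<k} then J l a else 0) \<noteq> 0}" for k
    proof -
      obtain v where v: "J l = (\<lambda>a. \<Sum>m | is_partition m \<and> dominated_by m l. v l m * m_sym m a)"
        using assms(2,4) unfolding is_jack_family_def by blast
      have "psize a = psize l" if a: "J l a \<noteq> 0" for a
      proof -
        obtain m where "dominated_by m l" "m_sym m a \<noteq> 0"
          using a unfolding v by (metis (mono_tags, lifting) mem_Collect_eq mult_zero_right sum.neutral)
        then show ?thesis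
          using homogeneous_m_sym [of m] by (auto simp: homogeneous_series_def dominated_by_def)
      qed
      then show ?thesis
        by (intro finite_subset [OF _ finite_bounded_exponents [of k "psize l"]]) (auto split: if_splits)
    qed
    show "lookup (restrict_poly n (restrict_vars n' (J l))) a = lookup (restrict_vars n (J l)) a"
      using n' by (auto simp: lookup_restrict_poly restrict_vars_def fin)
  qed
  finally show ?thesis ..
qed

end
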